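(* Let $X, Y$ be complete metric spaces and let $\mu$ be a non-atomic Radon probability measure on $X$. Let $T$ be a metric space, let $t \mapsto \nu_t$, $T \to \mathcal P_r(Y)$, be a mapping continuous in the weak topology, and let $h \colon X \times Y \times T \to [0, \infty)$ be a continuous function; write $h_t(x,y)=h(x,y,t)$. Suppose that for every $t\in T$ there are functions $a_t \in L^1(\mu)$ and $b_t \in L^1(\nu_t)$ such that $h(x, y, t) \le a_t(x) + b_t(y)$ for all $x\in X$, $y\in Y$, $t\in T$, and $$ \lim_{R \to +\infty} \sup_{t \in T} \Bigl(\int_{\{a_t \ge R\}} a_t \, d\mu + \int_{\{b_t \ge R\}} b_t \, d\nu_t \Bigr) = 0. $$ Then for any $\varepsilon > 0$ one can select, for all $t\in T$, $\varepsilon$-optimal Monge mappings $T_t^{\varepsilon}\colon X\to Y$ for the cost functions $h_t$ and measures $\mu$, $\nu_t$ (in particular $\mu \circ (T_t^{\varepsilon})^{-1} = \nu_t$ for every $t \in T$) such that $T_t^{\varepsilon}$ is continuous in $t$ in the sense of convergence $\mu$-a.e.: for every $t\in T$ and every sequence $t_n \to t$ in $T$, $T_{t_n}^{\varepsilon} \to T_t^{\varepsilon}$ $\mu$-a.e. as $n\to\infty$.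
   Context: A nonnegative Radon measure on a topological space $X$ is a bounded Borel measure $\mu\ge 0$ such that for every Borel set $B$ and every $\varepsilon>0$ there is a compact set $K\subset B$ with $\mu(B\setminus K)<\varepsilon$. $\mathcal P_r(Y)$ denotes the space of Radon probability measures on $Y$; its weak topology is generated by the seminorms $\mu\mapsto|\int f\,d\mu|$, where $f$ is a bounded continuous function on $Y$. For probability measures $\mu$ on $X$ and $\nu$ on $Y$, $\Pi(\mu,\nu)$ denotes the set of Borel probability measures $\sigma$ on $X\times Y$ with marginals $\mu$ and $\nu$, that is, $\sigma(A\times Y)=\mu(A)$ and $\sigma(X\times B)=\nu(B)$ for all Borel $A\subset X$, $B\subset Y$. For a nonnegative Borel cost function $h$ on $X\times Y$, the Kantorovich cost is $K_h(\mu,\nu)=\inf\{\int h\,d\sigma:\sigma\in\Pi(\mu,\nu)\}$. For a Borel mapping $S\colon X\to Y$, $(\mu\circ S^{-1})(B)=\mu(S^{-1}(B))$ for Borel sets $B\subset Y$. Given $\varepsilon>0$, an $\varepsilon$-optimal Monge mapping for the cost function $h$ and measures $\mu,\nu$ is a Borel mapping $S\colon X\to Y$ such that $\mu\circ S^{-1}=\nu$ and $\int_X h(x,S(x))\,\mu(dx)\le K_h(\mu,\nu)+\varepsilon$. *)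

theory Defs
  imports "HOL-Probability.Probability"
begin

definition radon_measure :: "'a::topological_space measure \<Rightarrow> bool" where
  "radon_measure M \<longleftrightarrow>
     sets M = sets borel \<and> finite_measure M \<and>
     (\<forall>B\<in>sets borel. \<forall>e>0. \<exists>K. compact K \<and> K \<subseteq> B \<and> measure M (B - K) < e)"

definition radon_probs :: "'a::topological_space measure set" where
  "radon_probs = {M. prob_space M \<and> radon_measure M}"

definition nonatomic :: "'a measure \<Rightarrow> bool" where
  "nonatomic M \<longleftrightarrow>
     \<not> (\<exists>A\<in>sets M. emeasure M A > 0 \<and>
          (\<forall>B\<in>sets M. B \<subseteq> A \<longrightarrow> emeasure M B = 0 \<or> emeasure M B = emeasure M A))"

text \<open>The weak topology on the Radon probability measures: the subbasis consists of the open balls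
  of the seminorms sending a signed measure to the absolute value of its integral against a bounded
  continuous function f; the carrier is \<^term>\<open>radon_probs\<close>.\<close>

definition weak_topology :: "'a::topological_space measure topology" where
  "weak_topology = topology_generated_by
     {{N \<in> radon_probs. \<bar>(\<integral>x. f x \<partial>N) - (\<integral>x. f x \<partial>M)\<bar> < e} | (f :: 'a \<Rightarrow> real) M e.
        continuous_on UNIV f \<and> bounded (range f) \<and> M \<in> radon_probs \<and> e > 0}"

lemma topspace_weak_topology: "topspace weak_topology = radon_probs"
proof -
  have "N \<in> topspace weak_topology" if "N \<in> radon_probs" for N :: "'a measure"
    unfolding weak_topology_def topology_generated_by_topspace
    by (rule UnionI[where X = "{L \<in> radon_probs. \<bar>(\<integral>x. (0::real) \<partial>L) - (\<integral>x. 0 \<partial>N)\<bar> < 1}"])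
       (use that in \<open>auto intro!: exI[of _ "\<lambda>_. 0::real"] exI[of _ N] exI[of _ "1::real"]\<close>)
  then show ?thesis
    by (auto simp: weak_topology_def topology_generated_by_topspace)
qed

text \<open>Here \<^term>\<open>borel\<close> is the Borel sigma-algebra of the product topology. Without separability
  it can be strictly larger than the product of the two Borel sigma-algebras, so couplings are not
  measures on \<^term>\<open>borel \<Otimes>\<^sub>M borel\<close>.\<close>

definition couplings ::
  "'a::topological_space measure \<Rightarrow> 'b::topological_space measure \<Rightarrow> ('a \<times> 'b) measure set" where
  "couplings M N = {P. sets P = sets borel \<and> prob_space P \<and>
     (\<forall>A\<in>sets borel. emeasure P (A \<times> UNIV) = emeasure M A) \<and>
     (\<forall>B\<in>sets borel. emeasure P (UNIV \<times> B) = emeasure N B)}"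

definition kantorovich_cost ::
  "('a::topological_space \<Rightarrow> 'b::topological_space \<Rightarrow> real) \<Rightarrow> 'a measure \<Rightarrow> 'b measure \<Rightarrow> ennreal" where
  "kantorovich_cost c M N = (INF P\<in>couplings M N. \<integral>\<^sup>+ (x, y). ennreal (c x y) \<partial>P)"

definition optimal_monge_map ::
  "real \<Rightarrow> ('a::topological_space \<Rightarrow> 'b::topological_space \<Rightarrow> real) \<Rightarrow>
   'a measure \<Rightarrow> 'b measure \<Rightarrow> ('a \<Rightarrow> 'b) \<Rightarrow> bool" where
  "optimal_monge_map \<epsilon> c M N S \<longleftrightarrow>
     S \<in> borel \<rightarrow>\<^sub>M borel \<and> distr M borel S = N \<and>
     (\<integral>\<^sup>+ x. ennreal (c x (S x)) \<partial>M) \<le> kantorovich_cost c M N + ennreal \<epsilon>"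

end

theory Submission imports Defs begin

text \<open>
  For complete metric Y there is a Skorohod map: one measurable map of the unit interval into Y for
  each Radon probability measure N, with image law N, that converges almost everywhere along weakly
  convergent sequences. It is obtained by splitting the unit interval into nested intervals whose
  lengths are the integrals of a well-ordered continuous partition of unity at scale
  \<^term>\<open>1 / 2 ^ k\<close>. Hence, if u is any map from X to the unit interval with uniform law, then
  composing u with the Skorohod maps of the measures with parameter t yields Monge maps that are
  automatically continuous in t, and only u has to be chosen.

  A nonatomic measure carries independent fair bits that generate the Borel sets. Discretizing an
  almost optimal coupling at one parameter gives a uniform u that depends on finitely many bits and
  the odd ones, and by continuity and uniform integrability it stays almost optimal nearby. Such
  local choices are glued by a selection driven by even bits: each parameter i comes with a depth and
  a ball with random radius, and at t one uses the first i (largest depth, then well-order) whose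
  ball contains t. For each t, almost every choice of radii makes this selection locally constant at t,
  and the selection is independent of the bits which determine the selected u.
\<close>

section \<open>Cells indexed by a well-order\<close>

text \<open>Continuity is demanded at every parameter and along every sequence in an arbitrary
  metric space, while an average of Monge maps is not a Monge map. Convex combinations of local
  plans are therefore replaced by a random choice: each \<open>x\<close> uses one plan, and which
  one is decided by bits that the plan ignores, so uniformity and cost become averages over the
  choice. The same randomness makes the boundary of the choice a null set for each fixed
  \<open>t\<close>. Optimality is measured against the Kantorovich cost at \<open>t\<close>, not at
  the centre of the local plan, so lower semicontinuity of that cost, up to a multiple of
  \<open>e\<close>, is needed as well. The truncation level \<open>N\<close> is fixed before the
  exceptional set, whose measure is at most \<open>e / N\<close>. The errors add up to
  \<open>26 * e\<close>: 24 for a local plan, 1 for the exceptional set, 1 for the truncation. None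
  of the spaces is assumed separable. Hence cells are indexed by a well-order, graphs are Borel
  thanks to countably valued approximants, and compact sets from the Radon property step in where
  countable additivity does not reach uncountable unions.\<close>

definition wordr :: "'a rel" where
  "wordr = (SOME r. well_order_on UNIV r)"

definition before :: "'a \<Rightarrow> 'a \<Rightarrow> bool" where
  "before i j \<longleftrightarrow> (i, j) \<in> wordr \<and> i \<noteq> j"

definition wleast :: "('a \<Rightarrow> bool) \<Rightarrow> 'a" where
  "wleast P = (SOME i. P i \<and> (\<forall>j. before j i \<longrightarrow> \<not> P j))"

lemma wordr: "well_order_on UNIV wordr"
  unfolding wordr_def by (rule someI_ex) (rule well_order_on)

lemma before_total: "i \<noteq> j \<Longrightarrow> before i j \<or> before j i"
  using wordr unfolding before_def well_order_on_def linear_order_on_def total_on_def by auto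

lemma before_trans: "before i j \<Longrightarrow> before j k \<Longrightarrow> before i k"
proof -
  assume a: "before i j" "before j k"
  have "trans (wordr :: 'a rel)" "antisym (wordr :: 'a rel)"
    using wordr by (auto simp: well_order_on_def linear_order_on_def partial_order_on_def preorder_on_def)
  then show ?thesis using a unfolding before_def by (metis antisymD transD)
qed

lemma before_irrefl [simp]: "\<not> before i i"
  by (simp add: before_def)

lemma wf_before: "wf {(i :: 'a, j). before i j}"
proof -
  have "{(i :: 'a, j). before i j} = wordr - Id" by (auto simp: before_def)
  then show ?thesis using wordr[where 'a = 'a] by (simp add: well_order_on_def)
qed

lemma wleast_ex:
  assumes "P i"
  shows "P (wleast P) \<and> (\<forall>j. before j (wleast P) \<longrightarrow> \<not> P j)"
proof -
  have "\<exists>i. P i \<and> (\<forall>j. before j i \<longrightarrow> \<not> P j)"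
  proof (rule wfE_min[OF wf_before, of i "Collect P"])
    show "i \<in> Collect P" using assms by simp
    fix z assume "z \<in> Collect P" "\<And>y. (y, z) \<in> {(i, j). before i j} \<Longrightarrow> y \<notin> Collect P"
    then have "P z \<and> (\<forall>j. before j z \<longrightarrow> \<not> P j)" by auto
    then show ?thesis by (rule exI)
  qed
  then show ?thesis unfolding wleast_def by (rule someI_ex)
qed

lemma wleastI: "P i \<Longrightarrow> P (wleast P)"
  by (rule wleast_ex[THEN conjunct1])

lemma not_before_wleast: "before j (wleast P) \<Longrightarrow> \<not> P j"
  using wleast_ex[of P j] by auto

lemma wleast_eqI:
  assumes "P i" "\<And>j. before j i \<Longrightarrow> \<not> P j"
  shows "wleast P = i"
  using wleast_ex[of P, OF assms(1)] assms(2)[of "wleast P"] assms(1) before_total[of "wleast P" i] by auto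

definition pre :: "'a \<Rightarrow> 'a set" where "pre i = {j. before j i}"
definition prei :: "'a \<Rightarrow> 'a set" where "prei i = insert i (pre i)"

lemma prei_mono: "before i j \<Longrightarrow> prei i \<subseteq> pre j"
  by (auto simp: pre_def prei_def intro: before_trans)

lemma pre_subset_prei: "pre i \<subseteq> prei i"
  by (auto simp: prei_def)

text \<open>Presents \<open>pre i\<close> as the union of a chain of sets \<open>prei j\<close>, the
  form in which the Dini argument can return an index before \<open>i\<close>.\<close>

lemma pre_eq_Union: "pre i = \<Union> (prei ` pre i)"
  using prei_mono by (fastforce simp: pre_def prei_def)

lemma prei_chain: "prei i \<subseteq> prei j \<or> prei j \<subseteq> prei i"
  by (metis before_total order_refl prei_mono pre_subset_prei subset_trans)

section \<open>Distance hats of initial segments\<close>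

lemma infdist_attained_less:
  assumes "infdist y A < b" "A \<noteq> {}"
  obtains a where "a \<in> A" "dist y a < b"
  using assms that by (auto simp: infdist_notempty cINF_less_iff)

text \<open>A Lipschitz cutoff that is 1 on \<open>A\<close> and 0 from distance
  \<open>1 / 2 ^ k\<close> on. The empty set needs its own case because \<open>infdist y {}\<close>
  is 0. Since \<open>hat k UNIV\<close> is 1, the increments from \<open>pre i\<close> to
  \<open>prei i\<close> act as a partition of unity along the well-order.\<close>

definition hat :: "nat \<Rightarrow> 'a::metric_space set \<Rightarrow> 'a \<Rightarrow> real" where
  "hat k A y = (if A = {} then 0 else max 0 (1 - 2 ^ k * infdist y A))"

lemma hat_bounds [simp]: "0 \<le> hat k A y" "hat k A y \<le> 1"
  by (auto simp: hat_def infdist_nonneg)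

lemma hat_empty [simp]: "hat k {} y = 0" by (simp add: hat_def)
lemma hat_UNIV [simp]: "hat k UNIV y = 1" by (simp add: hat_def)

lemma continuous_hat [continuous_intros]: "continuous_on S (hat k A)"
  by (cases "A = {}") (auto simp: hat_def[abs_def] intro!: continuous_intros)

lemma hat_le:
  assumes "infdist y B \<le> infdist y A" "B \<noteq> {}"
  shows "hat k A y \<le> hat k B y"
proof (cases "A = {}")
  case False
  have "max 0 (1 - 2 ^ k * infdist y A) \<le> max 0 (1 - 2 ^ k * infdist y B)"
    by (intro max.mono order_refl diff_left_mono mult_left_mono assms) auto
  then show ?thesis unfolding hat_def if_not_P[OF False] if_not_P[OF assms(2)] .
qed simp

lemma hat_mono: "A \<subseteq> B \<Longrightarrow> hat k A y \<le> hat k B y"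
proof (cases "A = {}")
  case False
  moreover assume "A \<subseteq> B"
  ultimately show ?thesis by (intro hat_le infdist_mono) auto
qed simp

lemma hat_lipschitz: "hat k A y \<le> hat k A z + 2 ^ k * dist y z"
proof (cases "A = {}")
  case False
  have "infdist z A \<le> infdist y A + dist y z"
    using infdist_triangle[of z A y] by (simp add: dist_commute)
  then have "2 ^ k * infdist z A \<le> 2 ^ k * infdist y A + 2 ^ k * dist y z"
    by (subst distrib_left[symmetric], intro mult_left_mono) auto
  then show ?thesis using False by (auto simp: hat_def max_def)
qed (simp add: hat_def)

text \<open>If the hat grows at \<open>y\<close>, adjoining \<open>i\<close> has brought the set
  closer to \<open>y\<close>, so a point of \<open>prei i\<close> that nearly realises the distance
  must be \<open>i\<close> itself.\<close>

lemma hat_step_dist: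
  assumes "hat k (pre i) y < hat k (prei i) y"
  shows "dist y i < 1 / 2 ^ k"
proof -
  have pos: "0 < hat k (prei i) y" using assms hat_bounds(1)[of k "pre i" y] by linarith
  \<comment> \<open>Two thresholds at once: \<open>1 / 2 ^ k\<close> because the new hat is
    positive, the distance to \<open>pre i\<close> because the hat has grown.\<close>
  define b where "b = (if pre i = {} then 1 / 2 ^ k else min (1 / 2 ^ k) (infdist y (pre i)))"
  have b: "infdist y (prei i) < 1 / 2 ^ k"
    using pos by (auto simp: hat_def max_def field_simps split: if_splits)
  moreover have "pre i \<noteq> {} \<Longrightarrow> infdist y (prei i) < infdist y (pre i)"
  proof (rule ccontr)
    assume "pre i \<noteq> {}" "\<not> infdist y (prei i) < infdist y (pre i)"
    then have "hat k (prei i) y \<le> hat k (pre i) y" by (intro hat_le) auto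
    then show False using assms by simp
  qed
  ultimately have "infdist y (prei i) < b" by (auto simp: b_def)
  then obtain a where a: "a \<in> prei i" "dist y a < b"
    by (rule infdist_attained_less) (auto simp: prei_def)
  have "a \<notin> pre i"
  proof
    assume "a \<in> pre i"
    then have "infdist y (pre i) \<le> dist y a" by (rule infdist_le)
    then show False using a(2) \<open>a \<in> pre i\<close> by (auto simp: b_def split: if_splits)
  qed
  then show ?thesis using a by (auto simp: prei_def b_def split: if_splits)
qed

lemma radon_probsD:
  assumes "N \<in> radon_probs"
  shows "prob_space N" "sets N = sets borel" "space N = UNIV"
  using assms sets_eq_imp_space_eq[of N borel] by (auto simp: radon_probs_def radon_measure_def)

lemma radon_compact:
  assumes "N \<in> radon_probs" "0 < (e::real)"
  obtains K where "compact K" "measure N (- K) < e"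
proof -
  have "\<exists>K. compact K \<and> K \<subseteq> UNIV \<and> measure N (UNIV - K) < e"
  proof -
    have "\<forall>B\<in>sets borel. \<forall>e>0. \<exists>K. compact K \<and> K \<subseteq> B \<and> measure N (B - K) < e"
      using assms(1) by (simp add: radon_probs_def radon_measure_def)
    from bspec[OF this, of UNIV] show ?thesis using assms(2) by simp
  qed
  then obtain K where "compact K" "measure N (UNIV - K) < e" by auto
  then show ?thesis using that[of K] by (simp add: Compl_eq_Diff_UNIV)
qed

lemma integrable_bcont:
  fixes f :: "'a::topological_space \<Rightarrow> real"
  assumes "N \<in> radon_probs" "continuous_on UNIV f" "\<And>x. 0 \<le> f x" "\<And>x. f x \<le> 1"
  shows "integrable N f"
proof -
  interpret prob_space N using radon_probsD[OF assms(1)] by simp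
  have "f \<in> borel_measurable N"
    using borel_measurable_continuous_onI[OF assms(2)] radon_probsD[OF assms(1)]
    by (simp cong: measurable_cong_sets)
  then show ?thesis
    by (intro integrable_const_bound[where B=1]) (use assms(3,4) in auto)
qed

lemma chain_finite_Union:
  assumes "finite F" "F \<noteq> {}" "F \<subseteq> C" "\<And>A B. A \<in> C \<Longrightarrow> B \<in> C \<Longrightarrow> A \<subseteq> B \<or> B \<subseteq> A"
  shows "\<Union> F \<in> C"
  using assms(1-3)
proof (induction rule: finite_ne_induct)
  case (insert A F)
  then have "A \<in> C" "\<Union> F \<in> C" by auto
  then have "A \<subseteq> \<Union>F \<or> \<Union>F \<subseteq> A" using assms(4) by blast
  then show ?case using \<open>A \<in> C\<close> \<open>\<Union> F \<in> C\<close> by (auto simp: sup.absorb1 sup.absorb2)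
qed auto

text \<open>A Dini argument on a large compact set.\<close>

lemma hat_dini:
  fixes N :: "'a::metric_space measure"
  assumes N: "N \<in> radon_probs"
    and C: "C \<noteq> {}" "\<And>A B. A \<in> C \<Longrightarrow> B \<in> C \<Longrightarrow> A \<subseteq> B \<or> B \<subseteq> A"
    and P: "continuous_on UNIV P" "\<And>y. 0 \<le> P y"
    and Q: "continuous_on UNIV Q" "\<And>y. 0 \<le> Q y" "\<And>y. P y + Q y \<le> 1"
    and v: "v < (\<integral>y. P y + Q y * hat k (\<Union>C) y \<partial>N)"
  shows "\<exists>A\<in>C. v < (\<integral>y. P y + Q y * hat k A y \<partial>N)"
proof -
  interpret prob_space N using radon_probsD[OF N] by simp
  have prob_space_UNIV: "prob UNIV = 1" using prob_space radon_probsD[OF N] by simp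
  have Q1: "Q y \<le> 1" for y using P(2)[of y] Q(3)[of y] by linarith
  have Qh: "Q y * hat k A y \<le> Q y" "0 \<le> Q y * hat k A y" for A y
    using Q(2)[of y] by (auto intro: mult_left_le)
  have int: "integrable N (\<lambda>y. P y + Q y * hat k A y)" for A
  proof (rule integrable_bcont[OF N])
    show "continuous_on UNIV (\<lambda>y. P y + Q y * hat k A y)" by (intro continuous_intros P Q)
    fix x show "0 \<le> P x + Q x * hat k A x" "P x + Q x * hat k A x \<le> 1"
      using P(2)[of x] Qh[of x A] Q(3)[of x] by linarith+
  qed
  define I where "I = (\<integral>y. P y + Q y * hat k (\<Union>C) y \<partial>N)"
  \<comment> \<open>Five shares: the loss on the compact set is \<open>3 * e\<close>, its complement
    costs \<open>e\<close>, and the last share keeps the final inequality strict.\<close>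
  define e where "e = (I - v) / 5"
  have e: "0 < e" using v by (simp add: e_def I_def)
  obtain K where K: "compact K" "measure N (- K) < e" using radon_compact[OF N e] .
  \<comment> \<open>Hats are Lipschitz with constant \<open>2 ^ k\<close>, so moving by less than
    \<open>r\<close> changes them by at most \<open>e\<close>.\<close>
  define r where "r = e / 2 ^ k"
  have r: "0 < r" "2 ^ k * r = e" using e by (auto simp: r_def)
  have near: "\<exists>A\<in>C. hat k (\<Union>C) y - e \<le> hat k A y" for y
  proof (cases "\<Union>C = {}")
    case False
    obtain a where a: "a \<in> \<Union>C" "dist y a < infdist y (\<Union>C) + r"
      using infdist_attained_less[of y "\<Union>C" "infdist y (\<Union>C) + r"] r False by (metis less_add_same_cancel1)
    then obtain A where A: "A \<in> C" "a \<in> A" by blast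
    have "infdist y A \<le> infdist y (\<Union>C) + r" using infdist_le[OF A(2), of y] a by linarith
    then have "2 ^ k * infdist y A \<le> 2 ^ k * infdist y (\<Union>C) + e"
      unfolding r(2)[symmetric] by (subst distrib_left[symmetric], intro mult_left_mono) auto
    then have "hat k (\<Union>C) y - e \<le> hat k A y"
      using A False e by (auto simp: hat_def max_def)
    then show ?thesis using A by blast
  qed (use C e in \<open>force simp: hat_def\<close>)
  then obtain A where A: "\<And>y. A y \<in> C" "\<And>y. hat k (\<Union>C) y - e \<le> hat k (A y) y" by metis
  obtain D where D: "finite D" "D \<subseteq> K" "K \<subseteq> (\<Union>y\<in>D. ball y r)"
  proof (rule compactE_image[OF K(1), of K "\<lambda>y. ball y r"])
    show "K \<subseteq> (\<Union>y\<in>K. ball y r)" using r by (auto intro!: bexI)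
  qed auto
  obtain A0 where A0: "A0 \<in> C" using C by blast
  \<comment> \<open>A chain contains the union of finitely many of its members; \<open>A0\<close>
    takes care of an empty \<open>D\<close>.\<close>
  define A1 where "A1 = \<Union> (insert A0 (A ` D))"
  have A1: "A1 \<in> C" unfolding A1_def
    by (rule chain_finite_Union) (use D A0 A C in auto)
  have K1: "hat k (\<Union>C) z \<le> hat k A1 z + 3 * e" if z: "z \<in> K" for z
  proof -
    obtain y where y: "y \<in> D" "dist y z < r" using D z by auto
    have "2 ^ k * dist y z \<le> e" unfolding r(2)[symmetric] using y by (intro mult_left_mono) auto
    moreover have "hat k (A y) z \<le> hat k A1 z"
      using y by (intro hat_mono) (auto simp: A1_def)
    ultimately show ?thesis
      using hat_lipschitz[of k "\<Union>C" z y] hat_lipschitz[of k "A y" y z] A(2)[of y]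
      by (simp add: dist_commute)
  qed
  have Kc: "K \<in> sets N" using K(1) radon_probsD[OF N] by (simp add: borel_compact)
  have "I \<le> (\<integral>y. (P y + Q y * hat k A1 y) + 3 * e + indicator (- K) y \<partial>N)"
    unfolding I_def
  proof (rule integral_mono[OF int])
    show "integrable N (\<lambda>y. (P y + Q y * hat k A1 y) + 3 * e + indicator (- K) y)"
      using Kc radon_probsD[OF N]
      by (intro Bochner_Integration.integrable_add int) (auto simp: Compl_in_sets_lebesgue intro!: integrable_real_indicator simp: Compl_eq_Diff_UNIV less_top[symmetric])
    fix z
    show "P z + Q z * hat k (\<Union>C) z \<le> (P z + Q z * hat k A1 z) + 3 * e + indicator (- K) z"
    proof (cases "z \<in> K")
      case True
      have "Q z * hat k (\<Union>C) z \<le> Q z * (hat k A1 z + 3 * e)"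
        using K1[OF True] Q(2) by (intro mult_left_mono) auto
      also have "\<dots> = Q z * hat k A1 z + Q z * (3 * e)" by (simp add: distrib_left)
      also have "Q z * (3 * e) \<le> 1 * (3 * e)" using Q1 e by (intro mult_right_mono) auto
      finally show ?thesis using True by simp
    next
      case False
      then show ?thesis using Qh(1)[of z "\<Union>C"] Qh(2)[of z A1] Q1[of z] e by auto
    qed
  qed
  also have "\<dots> = (\<integral>y. P y + Q y * hat k A1 y \<partial>N) + 3 * e + measure N (- K)"
    using Kc radon_probsD[OF N] int[of A1]
    by (subst Bochner_Integration.integral_add)
       (auto intro!: integrable_real_indicator simp: Compl_eq_Diff_UNIV less_top[symmetric] prob_space_UNIV)
  finally have "I < (\<integral>y. P y + Q y * hat k A1 y \<partial>N) + 4 * e" using K by simp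
  moreover have "I - v = 5 * e" by (simp add: e_def)
  ultimately have "v < (\<integral>y. P y + Q y * hat k A1 y \<partial>N)" using e by linarith
  then show ?thesis using A1 by blast
qed

section \<open>A Skorohod map on the Radon probability measures\<close>

text \<open>State \<open>(P, Q, c)\<close> of the parameter \<open>v\<close>: \<open>P\<close> is
  the total weight of all cells to the left, \<open>Q\<close> the weight of the current cell,
  \<open>c\<close> its centre. Functions are stored instead of their integrals, so \<open>N\<close>
  enters only through the indices picked by \<open>wleast\<close>, and two measures that make the
  same picks have identical states. The centre at depth 0 is a placeholder.\<close>

primrec cells :: "'a::metric_space measure \<Rightarrow> real \<Rightarrow> nat \<Rightarrow> ('a \<Rightarrow> real) \<times> ('a \<Rightarrow> real) \<times> 'a" where
  "cells N v 0 = ((\<lambda>_. 0), (\<lambda>_. 1), undefined)"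
| "cells N v (Suc k) = (case cells N v k of (P, Q, c) \<Rightarrow>
     (let i = wleast (\<lambda>i. v < (\<integral>y. P y + Q y * hat k (prei i) y \<partial>N)) in
       ((\<lambda>y. P y + Q y * hat k (pre i) y), (\<lambda>y. Q y * (hat k (prei i) y - hat k (pre i) y)), i)))"

definition low :: "'a::metric_space measure \<Rightarrow> real \<Rightarrow> nat \<Rightarrow> 'a \<Rightarrow> real" where
  "low N v k = fst (cells N v k)"
definition wgt :: "'a::metric_space measure \<Rightarrow> real \<Rightarrow> nat \<Rightarrow> 'a \<Rightarrow> real" where
  "wgt N v k = fst (snd (cells N v k))"
definition ctr :: "'a::metric_space measure \<Rightarrow> real \<Rightarrow> nat \<Rightarrow> 'a" where
  "ctr N v k = snd (snd (cells N v k))"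

lemma cells_eq: "cells N v k = (low N v k, wgt N v k, ctr N v k)"
  by (simp add: low_def wgt_def ctr_def)

lemma cells_0: "low N v 0 = (\<lambda>_. 0)" "wgt N v 0 = (\<lambda>_. 1)"
  by (simp_all add: low_def wgt_def)

lemma ctr_Suc: "ctr N v (Suc k) = wleast (\<lambda>i. v < (\<integral>y. low N v k y + wgt N v k y * hat k (prei i) y \<partial>N))"
  and low_Suc: "low N v (Suc k) = (\<lambda>y. low N v k y + wgt N v k y * hat k (pre (ctr N v (Suc k))) y)"
  and wgt_Suc: "wgt N v (Suc k) = (\<lambda>y. wgt N v k y * (hat k (prei (ctr N v (Suc k))) y - hat k (pre (ctr N v (Suc k))) y))"
  using cells_eq[of N v k] by (simp_all add: low_def wgt_def ctr_def Let_def split: prod.splits)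

declare cells.simps(2) [simp del]

lemma low_wgt_Suc: "low N v (Suc k) y + wgt N v (Suc k) y = low N v k y + wgt N v k y * hat k (prei (ctr N v (Suc k))) y"
  by (simp add: low_Suc wgt_Suc algebra_simps)

lemma hat_pre_prei: "hat k (pre i) y \<le> hat k (prei i) y"
  by (rule hat_mono[OF pre_subset_prei])

lemma cells_bounds:
  "0 \<le> low N v k y" "0 \<le> wgt N v k y" "low N v k y + wgt N v k y \<le> 1"
proof (induction k)
  case (Suc k)
  { case 1 show ?case using Suc by (simp add: low_Suc) }
  { case 2 show ?case using Suc(2) hat_pre_prei[of k "ctr N v (Suc k)" y] by (simp add: wgt_Suc) }
  { case 3
    have "wgt N v k y * hat k (prei (ctr N v (Suc k))) y \<le> wgt N v k y"
      using Suc(2) by (intro mult_left_le) auto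
    then show ?case using Suc(3) by (simp add: low_wgt_Suc) }
qed (auto simp: cells_0)

lemma cells_cont: "continuous_on UNIV (low N v k)" "continuous_on UNIV (wgt N v k)"
  by (induction k) (auto simp: cells_0 low_Suc wgt_Suc intro!: continuous_intros)

lemma low_mono: "low N v k y \<le> low N v (Suc k) y"
  using cells_bounds(2)[of N v k y] by (simp add: low_Suc)

lemma low_wgt_antimono: "low N v (Suc k) y + wgt N v (Suc k) y \<le> low N v k y + wgt N v k y"
  using cells_bounds(2)[of N v k y] by (simp add: low_wgt_Suc mult_left_le)

lemma cells_integrable:
  assumes "N' \<in> radon_probs"
  shows "integrable N' (low N v k)" "integrable N' (\<lambda>y. low N v k y + wgt N v k y)"
    "integrable N' (wgt N v k)"
    "integrable N' (\<lambda>y. low N v k y + wgt N v k y * hat j A y)"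
proof -
  have 1: "low N v k y \<le> 1" "wgt N v k y \<le> 1" for y
    using cells_bounds[of N v k y] by linarith+
  show "integrable N' (low N v k)" "integrable N' (wgt N v k)" "integrable N' (\<lambda>y. low N v k y + wgt N v k y)"
    by (intro integrable_bcont[OF assms] continuous_intros cells_cont cells_bounds 1 add_nonneg_nonneg)+
  have "low N v k y + wgt N v k y * hat j A y \<le> 1" for y
    using mult_left_le[OF hat_bounds(2)[of j A y] cells_bounds(2)[of N v k y]] cells_bounds(3)[of N v k y]
    by linarith
  then show "integrable N' (\<lambda>y. low N v k y + wgt N v k y * hat j A y)"
    by (intro integrable_bcont[OF assms] continuous_intros cells_cont cells_bounds add_nonneg_nonneg mult_nonneg_nonneg hat_bounds(1))
qed

abbreviation lo :: "'a::metric_space measure \<Rightarrow> real \<Rightarrow> nat \<Rightarrow> real" where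
  "lo N v k \<equiv> (\<integral>y. low N v k y \<partial>N)"
abbreviation hi :: "'a::metric_space measure \<Rightarrow> real \<Rightarrow> nat \<Rightarrow> real" where
  "hi N v k \<equiv> (\<integral>y. low N v k y + wgt N v k y \<partial>N)"

text \<open>The Dini argument serves twice. On the chain of all \<open>prei\<close>, whose union is
  the whole space, it shows that some index passes \<open>v\<close>; on the chain below the least
  such index it shows that no mass beyond \<open>v\<close> was skipped.\<close>

lemma cells_interval:
  assumes N: "N \<in> radon_probs" and v: "0 \<le> v" "v < 1"
  shows "lo N v k \<le> v" "v < hi N v k"
proof (induction k)
  case 0
  { case 1 show ?case using v by (simp add: cells_0) }
  { case 2 show ?case using v radon_probsD[OF N] prob_space.prob_space[of N] by (simp add: cells_0) }
next
  case (Suc k)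
  let ?P = "low N v k" and ?Q = "wgt N v k"
  let ?R = "\<lambda>i. v < (\<integral>y. ?P y + ?Q y * hat k (prei i) y \<partial>N)"
  have dini: "C \<noteq> {} \<Longrightarrow> (\<And>A B. A \<in> C \<Longrightarrow> B \<in> C \<Longrightarrow> A \<subseteq> B \<or> B \<subseteq> A) \<Longrightarrow>
      v < (\<integral>y. ?P y + ?Q y * hat k (\<Union>C) y \<partial>N) \<Longrightarrow> \<exists>A\<in>C. v < (\<integral>y. ?P y + ?Q y * hat k A y \<partial>N)" for C
    by (rule hat_dini[OF N]) (auto simp: cells_cont cells_bounds)
  have U: "\<Union>(range prei) = (UNIV :: 'a set)" by (auto simp: prei_def)
  have "\<exists>A\<in>range prei. v < (\<integral>y. ?P y + ?Q y * hat k A y \<partial>N)"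
    by (rule dini) (use Suc(2) in \<open>simp_all add: U image_iff, metis prei_chain\<close>)
  then obtain i where "?R i" by auto
  then have w: "?R (ctr N v (Suc k))" unfolding ctr_Suc by (rule wleastI)
  { case 2 show ?case using w by (simp add: low_wgt_Suc) }
  { case 1
    show ?case
    proof (rule ccontr)
      assume "\<not> lo N v (Suc k) \<le> v"
      then have lt: "v < (\<integral>y. ?P y + ?Q y * hat k (pre (ctr N v (Suc k))) y \<partial>N)" by (simp add: low_Suc)
      \<comment> \<open>The empty set keeps the chain nonempty when the centre is the first element
        of the well-order; its integral is the previous lower end.\<close>
      define C :: "'a set set" where "C = insert {} (prei ` pre (ctr N v (Suc k)))"
      have "\<Union>C = pre (ctr N v (Suc k))" using pre_eq_Union[of "ctr N v (Suc k)"] by (simp add: C_def)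
      then have "\<exists>A\<in>C. v < (\<integral>y. ?P y + ?Q y * hat k A y \<partial>N)"
      proof (intro dini)
        show "A \<subseteq> B \<or> B \<subseteq> A" if "A \<in> C" "B \<in> C" for A B
          using that unfolding C_def by (metis empty_subsetI imageE insertE prei_chain)
      qed (use lt in \<open>auto simp: C_def\<close>)
      then consider "v < (\<integral>y. ?P y + ?Q y * hat k {} y \<partial>N)" | i where "before i (ctr N v (Suc k))" "?R i"
        by (auto simp: C_def pre_def)
      then show False
      proof cases
        case 1 then show False using Suc(1) by simp
      next
        case 2 then show False using not_before_wleast[OF 2(1)[unfolded ctr_Suc]] by simp
      qed
    qed }
qed

lemma wgt_pos:
  assumes N: "N \<in> radon_probs" and v: "0 \<le> v" "v < 1"
  obtains y where "0 < wgt N v k y"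
proof (rule ccontr)
  assume "\<not> thesis"
  then have "wgt N v k y = 0" for y using that[of y] cells_bounds(2)[of N v k y] by (cases "wgt N v k y = 0") auto
  then show False using cells_interval[OF N v, of k] by simp
qed

text \<open>The weight is a product of increments, one per depth, so its positivity puts
  \<open>y\<close> near the centres of all depths at once.\<close>

lemma wgt_dist:
  assumes "0 < wgt N v k y" "j < k"
  shows "dist y (ctr N v (Suc j)) < 1 / 2 ^ j"
  using assms
proof (induction k)
  case (Suc k)
  have *: "0 < wgt N v k y" "hat k (pre (ctr N v (Suc k))) y < hat k (prei (ctr N v (Suc k))) y"
    using Suc(2) cells_bounds(2)[of N v k y] hat_pre_prei[of k "ctr N v (Suc k)" y]
    by (auto simp: wgt_Suc zero_less_mult_iff)
  show ?case
  proof (cases "j = k")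
    case True then show ?thesis using hat_step_dist[OF *(2)] by simp
  next
    case False then show ?thesis using Suc * by auto
  qed
qed simp

text \<open>At each depth the state is constant on half-open intervals of positive length, hence the
  states are those of the rational parameters.\<close>

lemma cells_eq_on_interval:
  assumes N: "N \<in> radon_probs" and v: "0 \<le> v" "v < 1"
    and "lo N v k \<le> v'" "v' < hi N v k"
  shows "cells N v' k = cells N v k"
  using assms(4,5)
proof (induction k)
  case (Suc k)
  have "lo N v k \<le> lo N v (Suc k)"
    by (intro integral_mono cells_integrable N low_mono)
  moreover have "hi N v (Suc k) \<le> hi N v k"
    by (intro integral_mono cells_integrable N low_wgt_antimono)
  ultimately have IH: "cells N v' k = cells N v k" using Suc by auto
  then have eq: "low N v' k = low N v k" "wgt N v' k = wgt N v k"
    by (auto simp: low_def wgt_def)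
  let ?i = "ctr N v (Suc k)"
  have "ctr N v' (Suc k) = ?i"
    unfolding ctr_Suc[of N v'] eq
  proof (rule wleast_eqI)
    show "v' < (\<integral>y. low N v k y + wgt N v k y * hat k (prei ?i) y \<partial>N)"
      using Suc(3) by (simp add: low_wgt_Suc)
    fix j assume "before j ?i"
    then have "hat k (prei j) y \<le> hat k (pre ?i) y" for y by (intro hat_mono prei_mono)
    then have "(\<integral>y. low N v k y + wgt N v k y * hat k (prei j) y \<partial>N) \<le> lo N v (Suc k)"
      unfolding low_Suc
      by (intro integral_mono cells_integrable N) (simp add: cells_bounds mult_left_mono)
    then show "\<not> v' < (\<integral>y. low N v k y + wgt N v k y * hat k (prei j) y \<partial>N)" using Suc(2) by linarith
  qed
  then show ?case
    by (simp add: cells_eq[of _ _ "Suc k"] low_Suc wgt_Suc eq)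
qed simp

section \<open>Dependence of the cells on the measure\<close>

definition weakconv :: "(nat \<Rightarrow> 'a::topological_space measure) \<Rightarrow> 'a measure \<Rightarrow> bool" where
  "weakconv Ns N \<longleftrightarrow> (\<forall>f::'a \<Rightarrow> real. continuous_on UNIV f \<longrightarrow> bounded (range f) \<longrightarrow>
     (\<lambda>n. \<integral>x. f x \<partial>Ns n) \<longlonglongrightarrow> (\<integral>x. f x \<partial>N))"

text \<open>Once \<open>v\<close> is not a left endpoint, each pick is certified by two strict
  inequalities between \<open>v\<close> and integrals of fixed continuous functions. Weak
  convergence preserves finitely many of these, so the states agree eventually and not merely in the
  limit.\<close>

lemma cells_eventually_eq:
  assumes N: "N \<in> radon_probs" and Ns: "\<And>n. Ns n \<in> radon_probs" and w: "weakconv Ns N"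
    and v: "0 \<le> v" "v < 1" and nb: "\<And>k. lo N v k \<noteq> v"
  shows "\<forall>\<^sub>F n in sequentially. cells (Ns n) v k = cells N v k"
proof (induction k)
  case (Suc k)
  let ?i = "ctr N v (Suc k)" and ?P = "low N v k" and ?Q = "wgt N v k"
  have lim: "(\<lambda>n. \<integral>y. ?P y + ?Q y * hat k A y \<partial>Ns n) \<longlonglongrightarrow> (\<integral>y. ?P y + ?Q y * hat k A y \<partial>N)" for A
  proof -
    have "0 \<le> ?P y + ?Q y * hat k A y \<and> ?P y + ?Q y * hat k A y \<le> 1" for y
      using mult_left_le[OF hat_bounds(2)[of k A y] cells_bounds(2)[of N v k y]] cells_bounds(3)[of N v k y]
       cells_bounds(1,2)[of N v k y] by (auto intro!: add_nonneg_nonneg)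
    then have "bounded (range (\<lambda>y. ?P y + ?Q y * hat k A y))" by (intro boundedI[where B=1]) auto
    moreover have "continuous_on UNIV (\<lambda>y. ?P y + ?Q y * hat k A y)"
      by (intro continuous_intros cells_cont)
    ultimately show ?thesis using w unfolding weakconv_def by blast
  qed
  have "v < (\<integral>y. ?P y + ?Q y * hat k (prei ?i) y \<partial>N)"
    using cells_interval(2)[OF N v, of "Suc k"] by (simp add: low_wgt_Suc)
  then have e1: "\<forall>\<^sub>F n in sequentially. v < (\<integral>y. ?P y + ?Q y * hat k (prei ?i) y \<partial>Ns n)"
    using lim by (auto dest: order_tendstoD)
  have "(\<integral>y. ?P y + ?Q y * hat k (pre ?i) y \<partial>N) < v"
    using cells_interval(1)[OF N v, of "Suc k"] nb[of "Suc k"] by (simp add: low_Suc)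
  then have e2: "\<forall>\<^sub>F n in sequentially. (\<integral>y. ?P y + ?Q y * hat k (pre ?i) y \<partial>Ns n) < v"
    using lim by (auto dest: order_tendstoD)
  from Suc e1 e2 show ?case
  proof eventually_elim
    case (elim n)
    have eq: "low (Ns n) v k = ?P" "wgt (Ns n) v k = ?Q"
      using elim by (auto simp: low_def wgt_def)
    have "ctr (Ns n) v (Suc k) = ?i"
      unfolding ctr_Suc[of "Ns n"] eq
    proof (rule wleast_eqI)
      show "v < (\<integral>y. ?P y + ?Q y * hat k (prei ?i) y \<partial>Ns n)" using elim by simp
      fix j assume "before j ?i"
      then have "hat k (prei j) y \<le> hat k (pre ?i) y" for y by (intro hat_mono prei_mono)
      then have "(\<integral>y. ?P y + ?Q y * hat k (prei j) y \<partial>Ns n) \<le> (\<integral>y. ?P y + ?Q y * hat k (pre ?i) y \<partial>Ns n)"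
        by (intro integral_mono cells_integrable Ns) (simp add: cells_bounds mult_left_mono)
      then show "\<not> v < (\<integral>y. ?P y + ?Q y * hat k (prei j) y \<partial>Ns n)" using elim by linarith
    qed
    then show ?case by (simp add: cells_eq[of _ _ "Suc k"] low_Suc wgt_Suc eq)
  qed
qed simp

text \<open>Parameters outside of the unit interval are junk and treated as 0.\<close>

definition skor :: "'a::metric_space measure \<Rightarrow> real \<Rightarrow> 'a" where
  "skor N v = lim (\<lambda>k. ctr N (if 0 \<le> v \<and> v < 1 then v else 0) (Suc k))"

lemma pow2_tendsto_0: "(\<lambda>k. c / 2 ^ k :: real) \<longlonglongrightarrow> 0"
  using tendsto_mult_right_zero[OF LIMSEQ_realpow_zero[of "1/2"], of c] by (simp add: power_one_over field_simps)

lemma pow2_small: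
  assumes "0 < (e::real)" obtains k where "c / 2 ^ k < e"
  using order_tendstoD(2)[OF pow2_tendsto_0 assms] by (auto simp: eventually_sequentially)

text \<open>A point where the deeper weight is positive is close to both centres.\<close>

lemma ctr_dist:
  assumes N: "N \<in> radon_probs" and v: "0 \<le> v" "v < 1" and "k \<le> j"
  shows "dist (ctr N v (Suc k)) (ctr N v (Suc j)) \<le> 2 / 2 ^ k"
proof -
  obtain y where y: "0 < wgt N v (Suc j) y" using wgt_pos[OF N v] .
  have "dist y (ctr N v (Suc k)) < 1 / 2 ^ k" "dist y (ctr N v (Suc j)) < 1 / 2 ^ j"
    using wgt_dist[OF y] assms(4) by auto
  moreover have "1 / 2 ^ j \<le> (1 / 2 ^ k :: real)" using assms(4) by (intro divide_left_mono power_increasing) auto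
  moreover have "dist (ctr N v (Suc k)) (ctr N v (Suc j)) \<le> dist y (ctr N v (Suc k)) + dist y (ctr N v (Suc j))"
    by (rule dist_triangle3)
  ultimately show ?thesis by simp
qed

lemma skor_lim:
  fixes N :: "'a::complete_space measure"
  assumes N: "N \<in> radon_probs" and v: "0 \<le> v" "v < 1"
  shows "(\<lambda>k. ctr N v (Suc k)) \<longlonglongrightarrow> skor N v" "dist (ctr N v (Suc k)) (skor N v) \<le> 2 / 2 ^ k"
proof -
  have "Cauchy (\<lambda>k. ctr N v (Suc k))"
  proof (rule metric_CauchyI)
    fix e :: real assume e: "0 < e"
    obtain M where M: "4 / 2 ^ M < e" by (rule pow2_small[OF e, of 4])
    have "dist (ctr N v (Suc m)) (ctr N v (Suc n)) < e" if "m \<ge> M" "n \<ge> M" for m n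
      using ctr_dist[OF N v that(1)] ctr_dist[OF N v that(2)] M
        dist_triangle3[of "ctr N v (Suc m)" "ctr N v (Suc n)" "ctr N v (Suc M)"] by simp
    then show "\<exists>M. \<forall>m\<ge>M. \<forall>n\<ge>M. dist (ctr N v (Suc m)) (ctr N v (Suc n)) < e" by blast
  qed
  then show lim: "(\<lambda>k. ctr N v (Suc k)) \<longlonglongrightarrow> skor N v"
    using v by (simp add: skor_def convergent_LIMSEQ_iff[symmetric] Cauchy_convergent)
  have "(\<lambda>j. dist (ctr N v (Suc k)) (ctr N v (Suc j))) \<longlonglongrightarrow> dist (ctr N v (Suc k)) (skor N v)"
    by (intro tendsto_intros lim)
  then show "dist (ctr N v (Suc k)) (skor N v) \<le> 2 / 2 ^ k"
    by (rule tendsto_upperbound)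
       (auto intro!: ctr_dist[OF N v] simp: eventually_sequentially)
qed

section \<open>The image of the uniform law under the Skorohod map\<close>

abbreviation unif :: "real measure" where
  "unif \<equiv> uniform_measure lborel {0..<1}"

lemma emeasure_unif: "A \<in> sets borel \<Longrightarrow> emeasure unif A = emeasure lborel ({0..<1} \<inter> A)"
  by (simp add: divide_ennreal_def)

lemma prob_space_unif: "prob_space unif"
  by (rule prob_space_uniform_measure) auto

lemma AE_unif_01: "AE v in unif. 0 \<le> v \<and> v < 1"
  by (rule AE_uniform_measureI) auto

lemma AE_unif_countable:
  assumes "countable A" shows "AE v in unif. v \<notin> A"
proof (rule AE_uniform_measureI)
  show "AE x in lborel. x \<in> {0..<1} \<longrightarrow> x \<notin> A"
    using AE_not_in[OF countable_imp_null_set_lborel[OF assms]] by auto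
qed auto

lemma low_le_1:
  assumes N: "N \<in> radon_probs"
  shows "hi N v k \<le> 1"
proof -
  interpret prob_space N using radon_probsD[OF N] by simp
  have "hi N v k \<le> (\<integral>y. 1 \<partial>N)"
    by (intro integral_mono cells_integrable N) (auto simp: cells_bounds)
  then show ?thesis using prob_space by simp
qed

text \<open>The cell interval extends to the right of \<open>v\<close>, so it contains a rational;
  hence only countably many states occur at each depth.\<close>

lemma rational_cell:
  assumes N: "N \<in> radon_probs" and v: "0 \<le> v" "v < 1"
  obtains q where "q \<in> \<rat>" "0 \<le> q" "q < 1" "cells N q k = cells N v k"
proof -
  have "v < hi N v k" by (rule cells_interval[OF N v])
  then obtain q where q: "q \<in> \<rat>" "v < q" "q < hi N v k"
    using Rats_dense_in_real by blast
  then have "cells N q k = cells N v k"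
    using cells_interval(1)[OF N v, of k] by (intro cells_eq_on_interval[OF N v]) auto
  then show ?thesis using that[of q] q v low_le_1[OF N, of v k] by auto
qed

text \<open>\<open>X\<close> may be any predicate of the state, such as a condition on the weight
  over a whole set: countably many intervals decide it, which yields Borel sets without a measurable
  structure on states.\<close>

lemma cells_level_set:
  assumes N: "N \<in> radon_probs"
  shows "{v. 0 \<le> v \<and> v < 1 \<and> X (cells N v k)} =
    (\<Union>q\<in>{q\<in>\<rat>. 0 \<le> q \<and> q < 1 \<and> X (cells N q k)}. {lo N q k ..< hi N q k})"
    (is "?L = (\<Union>q\<in>?Q. ?J q)")
proof safe
  fix v assume v: "0 \<le> v" "v < 1" "X (cells N v k)"
  obtain q where q: "q \<in> \<rat>" "0 \<le> q" "q < 1" "cells N q k = cells N v k"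
    using rational_cell[OF N v(1,2)] .
  moreover have "low N q k = low N v k" "wgt N q k = wgt N v k"
    using q by (auto simp: low_def wgt_def)
  ultimately show "v \<in> (\<Union>q\<in>?Q. ?J q)" using v cells_interval[OF N v(1,2), of k] by (auto intro!: exI[of _ q])
next
  fix v q assume q: "q \<in> \<rat>" "0 \<le> q" "q < 1" "X (cells N q k)" and v: "v \<in> ?J q"
  have "0 \<le> lo N q k" by (intro Bochner_Integration.integral_nonneg cells_bounds)
  then show "0 \<le> v" using v by auto
  show "v < 1" using v low_le_1[OF N, of q k] by auto
  show "X (cells N v k)" using cells_eq_on_interval[OF N q(2,3), of k v] v q by auto
qed

lemma countable_Rats_Collect: "countable {q\<in>\<rat>. P (q :: real)}"
  by (rule countable_subset[OF _ countable_rat]) auto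

lemma cells_level_borel:
  assumes N: "N \<in> radon_probs"
  shows "{v. 0 \<le> v \<and> v < 1 \<and> X (cells N v k)} \<in> sets borel"
  unfolding cells_level_set[OF N]
  by (intro sets.countable_UN' countable_Rats_Collect) auto

text \<open>Strong measurability. Without separability two Borel maps \<open>f\<close> and
  \<open>S\<close> need not form a Borel map \<open>(f, S)\<close> into the topological product; a
  limit \<open>S\<close> of countably valued maps guarantees it, as the coupling carried by a graph
  requires.\<close>

definition smeas :: "'a measure \<Rightarrow> ('a \<Rightarrow> 'b::metric_space) \<Rightarrow> bool" where
  "smeas M f \<longleftrightarrow> (\<exists>s. (\<forall>k::nat. s k \<in> M \<rightarrow>\<^sub>M count_space UNIV \<and> countable (s k ` space M)) \<and>
     (\<forall>x\<in>space M. (\<lambda>k. s k x) \<longlonglongrightarrow> f x))"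

lemma smeas_skor:
  fixes N :: "'a::complete_space measure"
  assumes N: "N \<in> radon_probs"
  shows "smeas borel (skor N)"
proof -
  define s where "s k v = ctr N (if 0 \<le> v \<and> v < 1 then v else 0) (Suc k)" for k v
  have lim: "(\<lambda>k. s k v) \<longlonglongrightarrow> skor N v" for v
    using skor_lim(1)[OF N, of v] skor_lim(1)[OF N, of 0]
    by (auto simp: s_def skor_def)
  have rng: "range (s k) \<subseteq> (\<lambda>q. ctr N q (Suc k)) ` \<rat>" for k
  proof safe
    fix v :: real
    define v' where "v' = (if 0 \<le> v \<and> v < 1 then v else 0)"
    have "0 \<le> v'" "v' < 1" by (auto simp: v'_def)
    then obtain q where "q \<in> \<rat>" "cells N q (Suc k) = cells N v' (Suc k)"
      using rational_cell[OF N, of v' "Suc k"] by metis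
    then show "s k v \<in> (\<lambda>q. ctr N q (Suc k)) ` \<rat>"
      by (intro image_eqI[of _ _ q]) (auto simp: s_def ctr_def v'_def)
  qed
  have cnt: "countable (range (s k))" for k
    using countable_subset[OF rng] countable_rat by blast
  have pre1: "s k -` {c} \<in> sets borel" for k c
  proof -
    \<comment> \<open>Junk parameters share the value at 0, hence the second set.\<close>
    have eq: "s k -` {c} = {v. 0 \<le> v \<and> v < 1 \<and> snd (snd (cells N v (Suc k))) = c} \<union>
       (if s k 0 = c then - {0..<1} else {})"
      by (auto simp: s_def ctr_def split: if_splits)
    show ?thesis unfolding eq using cells_level_borel[OF N, of "\<lambda>x. snd (snd x) = c" "Suc k"]
      by (intro sets.Un) (auto simp: Compl_in_sets_lebesgue intro: borel_comp)
  qed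
  have "s k \<in> borel \<rightarrow>\<^sub>M count_space (range (s k))" for k
    using cnt[of k] pre1 by (subst measurable_count_space_eq_countable) auto
  then have "s k \<in> borel \<rightarrow>\<^sub>M count_space UNIV" for k
    by (rule measurable_compose[where g="\<lambda>x. x"]) auto
  then show ?thesis unfolding smeas_def using cnt lim by (intro exI[of _ s]) auto
qed

text \<open>At the first depth where the states differ, the smaller parameter picks the earlier
  index \<open>i\<close>, and \<open>prei i\<close> lies inside \<open>pre j\<close> for the later
  index \<open>j\<close>; deeper steps only lower the left upper end and raise the right lower end.
  As the inequality is pointwise, weights of distinct cells add up to at most 1.\<close>

lemma cells_ordered:
  assumes N: "N \<in> radon_probs" and v: "0 \<le> v" "v < 1" "0 \<le> v'" "v' < 1" "v \<le> v'"
    and "cells N v k \<noteq> cells N v' k"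
  shows "low N v k y + wgt N v k y \<le> low N v' k y"
  using assms(7)
proof (induction k)
  case (Suc k)
  show ?case
  proof (cases "cells N v k = cells N v' k")
    case False
    then show ?thesis using Suc low_wgt_antimono[of N v k y] low_mono[of N v' k y] by simp
  next
    case True
    then have eq: "low N v' k = low N v k" "wgt N v' k = wgt N v k"
      by (auto simp: low_def wgt_def)
    let ?i = "ctr N v (Suc k)" and ?j = "ctr N v' (Suc k)"
    have "?i \<noteq> ?j" using Suc(2) eq by (auto simp: cells_eq[of _ _ "Suc k"] low_Suc wgt_Suc)
    moreover have "\<not> before ?j ?i"
    proof
      assume "before ?j ?i"
      then have "\<not> v < (\<integral>y. low N v k y + wgt N v k y * hat k (prei ?j) y \<partial>N)"
        unfolding ctr_Suc[of N v] by (rule not_before_wleast)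
      moreover have "v' < hi N v' (Suc k)"
        by (rule cells_interval) (use N v in auto)
      ultimately show False using v by (simp add: low_wgt_Suc eq)
    qed
    ultimately have "before ?i ?j" using before_total[of ?i ?j] by simp
    then have "hat k (prei ?i) y \<le> hat k (pre ?j) y" by (intro hat_mono prei_mono)
    then show ?thesis using cells_bounds(2)[of N v k y]
      by (simp add: low_wgt_Suc) (simp add: low_Suc eq mult_left_mono)
  qed
qed simp

text \<open>Each interval is as long as the integral of its weight. The sum of the weights of the
  distinct cells vanishes on \<open>C\<close> and is at most 1 since the cells are ordered, so it
  lies below the indicator of \<open>- C\<close>. Labels that repeat a cell do not change the
  union.\<close>

lemma finite_cells_mass:
  assumes N: "N \<in> radon_probs" and C: "C \<in> sets borel"
    and F: "finite F" "F \<subseteq> {0..<1}" "\<forall>v\<in>F. \<forall>y\<in>C. wgt N v k y = 0"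
  shows "emeasure lborel (\<Union>q\<in>F. {lo N q k ..< hi N q k})
    \<le> emeasure N (- C)"
proof -
  let ?J = "\<lambda>q. {lo N q k ..< hi N q k}"
  interpret prob_space N using radon_probsD[OF N] by simp
  \<comment> \<open>Labels are added in increasing order. The invariant: \<open>g\<close> is below
    the upper end of every later state, and below its lower end if that state is not among the cells
    counted so far.\<close>
  have "\<exists>g. integrable N g \<and> (\<forall>y. 0 \<le> g y) \<and> (\<forall>y\<in>C. g y = 0) \<and> emeasure lborel (\<Union>q\<in>F. ?J q) \<le> ennreal (\<integral>y. g y \<partial>N) \<and>
     (\<forall>v y. 0 \<le> v \<and> v < 1 \<and> (\<forall>q\<in>F. q \<le> v) \<longrightarrow> g y \<le> low N v k y + wgt N v k y \<and>
       ((\<forall>q\<in>F. cells N q k \<noteq> cells N v k) \<longrightarrow> g y \<le> low N v k y))"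
    using F
  proof (induction F rule: finite_linorder_max_induct)
    case empty
    show ?case by (intro exI[of _ "\<lambda>_. 0"]) (auto simp: cells_bounds intro!: add_nonneg_nonneg)
  next
    case (insert b F)
    from insert.IH insert.prems obtain g where g: "integrable N g" "\<And>y. 0 \<le> g y" "\<And>y. y \<in> C \<Longrightarrow> g y = 0"
      "emeasure lborel (\<Union>q\<in>F. ?J q) \<le> ennreal (\<integral>y. g y \<partial>N)"
      and g1: "\<And>v y. 0 \<le> v \<Longrightarrow> v < 1 \<Longrightarrow> (\<forall>q\<in>F. q \<le> v) \<Longrightarrow> g y \<le> low N v k y + wgt N v k y"
      and g2: "\<And>v y. 0 \<le> v \<Longrightarrow> v < 1 \<Longrightarrow> (\<forall>q\<in>F. q \<le> v) \<Longrightarrow> (\<forall>q\<in>F. cells N q k \<noteq> cells N v k) \<Longrightarrow> g y \<le> low N v k y"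
    proof -
      have "F \<subseteq> {0..<1}" "\<forall>v\<in>F. \<forall>y\<in>C. wgt N v k y = 0" using insert.prems by auto
      from insert.IH[OF this] show thesis
        by (elim exE conjE, intro that) (assumption | blast | simp)+
    qed
    have b: "0 \<le> b" "b < 1" using insert.prems by auto
    show ?case
    proof (cases "\<exists>q\<in>F. cells N q k = cells N b k")
      case True
      then obtain q where q: "q \<in> F" "cells N q k = cells N b k" by auto
      then have "low N q k = low N b k" "wgt N q k = wgt N b k" by (auto simp: low_def wgt_def)
      then have "(\<Union>q\<in>insert b F. ?J q) = (\<Union>q\<in>F. ?J q)" using q by auto
      then show ?thesis using g g1 g2 by (intro exI[of _ g]) auto
    next
      case False
      then have gb: "g y \<le> low N b k y" for y
        using g2[of b y] b insert.hyps(2) by fastforce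
      define g' where "g' y = g y + wgt N b k y" for y
      have le: "g' y \<le> low N b k y + wgt N b k y" for y using gb[of y] by (simp add: g'_def)
      have "emeasure lborel (\<Union>q\<in>insert b F. ?J q) \<le> emeasure lborel (\<Union>q\<in>F. ?J q) + emeasure lborel (?J b)"
        unfolding UN_insert using insert.hyps(1)
        by (subst Un_commute, intro emeasure_subadditive) (auto intro!: sets.finite_UN)
      also have "hi N b k = lo N b k + (\<integral>y. wgt N b k y \<partial>N)"
        by (intro Bochner_Integration.integral_add cells_integrable N)
      then have "emeasure lborel (?J b) = ennreal (\<integral>y. wgt N b k y \<partial>N)"
        by (simp add: integral_nonneg_AE cells_bounds)
      also have "emeasure lborel (\<Union>q\<in>F. ?J q) + ennreal (\<integral>y. wgt N b k y \<partial>N) \<le>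
          ennreal (\<integral>y. g y \<partial>N) + ennreal (\<integral>y. wgt N b k y \<partial>N)"
        using g by (intro add_right_mono)
      also have "\<dots> = ennreal (\<integral>y. g' y \<partial>N)"
        unfolding g'_def
        by (subst Bochner_Integration.integral_add)
           (auto intro!: cells_integrable N g integral_nonneg_AE ennreal_plus[symmetric] simp: cells_bounds)
      finally have 1: "emeasure lborel (\<Union>q\<in>insert b F. ?J q) \<le> ennreal (\<integral>y. g' y \<partial>N)" .
      have 2: "g' y \<le> low N v k y" if v: "0 \<le> v" "v < 1" "b \<le> v" "cells N b k \<noteq> cells N v k" for v y
        using le[of y] cells_ordered[OF N b v(1,2,3,4), of y] by simp
      have 3: "g' y \<le> low N v k y + wgt N v k y" if v: "0 \<le> v" "v < 1" "b \<le> v" for v y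
      proof (cases "cells N b k = cells N v k")
        case True
        then have "low N v k = low N b k" "wgt N v k = wgt N b k" by (auto simp: low_def wgt_def)
        then show ?thesis using le[of y] by simp
      next
        case False
        then show ?thesis using 2[OF v False, of y] cells_bounds(2)[of N v k y] by simp
      qed
      show ?thesis
      proof (intro exI[of _ g'] conjI allI impI ballI)
        show "integrable N g'" unfolding g'_def by (intro Bochner_Integration.integrable_add g cells_integrable N)
        show "0 \<le> g' y" for y using g(2)[of y] cells_bounds(2)[of N b k y] by (simp add: g'_def)
        show "g' y = 0" if "y \<in> C" for y using g(3)[OF that] insert.prems(2) that by (simp add: g'_def)
      qed (use 1 2 3 in auto)
    qed
  qed
  then obtain g where g: "integrable N g" "\<And>y. 0 \<le> g y" "\<And>y. y \<in> C \<Longrightarrow> g y = 0"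
      "emeasure lborel (\<Union>q\<in>F. ?J q) \<le> ennreal (\<integral>y. g y \<partial>N)"
      and g1: "\<And>v y. 0 \<le> v \<Longrightarrow> v < 1 \<Longrightarrow> (\<forall>q\<in>F. q \<le> v) \<Longrightarrow> g y \<le> low N v k y + wgt N v k y"
    by auto
  define v where "v = (if F = {} then 0 else Max F)"
  have "Max F \<in> {0..<1}" if "F \<noteq> {}" using F(2) Max_in[OF F(1) that] by blast
  then have v: "0 \<le> v" "v < 1" "\<forall>q\<in>F. q \<le> v" using F(1) by (auto simp: v_def)
  have "g y \<le> 1" for y using g1[OF v, of y] cells_bounds(3)[of N v k y] by simp
  then have "g y \<le> indicator (- C) y" for y using g(3)[of y] by (cases "y \<in> C") auto
  then have "(\<integral>y. g y \<partial>N) \<le> (\<integral>y. indicator (- C) y \<partial>N)"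
    using C radon_probsD[OF N]
    by (intro integral_mono g integrable_real_indicator) (auto simp: less_top[symmetric])
  also have "\<dots> = measure N (- C)" using C radon_probsD[OF N] by simp
  finally show ?thesis using order_trans[OF g(4) ennreal_leI] by (simp add: emeasure_eq_measure)
qed

text \<open>Open sets are increasing unions of closed sets, so the inequality passes to them;
  complements reverse it because both masses are 1. Equality on the open sets, a generator stable
  under intersection, suffices.\<close>

lemma closed_le_imp_eq:
  fixes M N :: "'a::metric_space measure"
  assumes M: "prob_space M" "sets M = sets borel" and N: "prob_space N" "sets N = sets borel"
    and le: "\<And>C. closed C \<Longrightarrow> emeasure N C \<le> emeasure M C"
  shows "M = N"
proof -
  interpret M: prob_space M by fact
  interpret N: prob_space N by fact
  have sp: "space M = UNIV" "space N = UNIV" using sets_eq_imp_space_eq[OF M(2)] sets_eq_imp_space_eq[OF N(2)] by auto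
  have op: "emeasure N G \<le> emeasure M G" if "open G" for G
  proof (cases "G = UNIV")
    case True then show ?thesis using M.emeasure_space_1 N.emeasure_space_1 sp by simp
  next
    case False
    define C where "C n = {x. 1 / Suc n \<le> infdist x (- G)}" for n
    have cl: "closed (C n)" for n
      unfolding C_def by (intro closed_Collect_le continuous_intros)
    have "x \<in> G \<longleftrightarrow> (\<exists>n. x \<in> C n)" for x
    proof
      assume "x \<in> G"
      then have "0 < infdist x (- G)"
        using in_closed_iff_infdist_zero[of "- G" x] that False infdist_nonneg[of x "- G"] by (auto simp: less_le)
      then show "\<exists>n. x \<in> C n" by (auto simp: C_def elim!: nat_approx_posE) (metis less_imp_le of_nat_Suc add.commute)
    next
      assume "\<exists>n. x \<in> C n"
      then have "infdist x (- G) \<noteq> 0" by (auto simp: C_def)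
      then show "x \<in> G" by (metis ComplI infdist_zero)
    qed
    then have Gu: "G = (\<Union>n. C n)" by auto
    have inc: "incseq C"
    proof (rule incseq_SucI)
      fix n
      have "1 / real (Suc (Suc n)) \<le> 1 / real (Suc n)" by (intro divide_left_mono) auto
      then show "C n \<subseteq> C (Suc n)" by (auto simp: C_def intro: order_trans)
    qed
    have "emeasure N G = (SUP n. emeasure N (C n))"
      unfolding Gu by (rule SUP_emeasure_incseq[symmetric]) (use cl N inc in auto)
    also have "\<dots> \<le> emeasure M G"
    proof (rule SUP_least)
      fix n
      have "emeasure N (C n) \<le> emeasure M (C n)" by (rule le[OF cl])
      also have "\<dots> \<le> emeasure M G" using that M by (intro emeasure_mono) (auto simp: Gu)
      finally show "emeasure N (C n) \<le> emeasure M G" .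
    qed
    finally show ?thesis .
  qed
  have eq: "emeasure M G = emeasure N G" if "open G" for G
  proof (rule antisym[OF _ op[OF that]])
    have "emeasure N (- G) \<le> emeasure M (- G)" using that by (intro le) auto
    moreover have "measure N (- G) = 1 - measure N G" "measure M (- G) = 1 - measure M G"
      using N.prob_compl[of G] M.prob_compl[of G] that M N sp by (auto simp: Compl_eq_Diff_UNIV)
    ultimately show "emeasure M G \<le> emeasure N G"
      by (simp add: M.emeasure_eq_measure N.emeasure_eq_measure)
  qed
  show ?thesis
  proof (rule measure_eqI_generator_eq[where E="{G. open G}" and \<Omega>=UNIV and A="\<lambda>_. UNIV"])
    show "sets M = sigma_sets UNIV {G. open G}" "sets N = sigma_sets UNIV {G. open G}"
      using M N by (auto simp: borel_def)
  qed (auto simp: Int_stable_def eq)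
qed

text \<open>Cells whose weight vanishes on \<open>C\<close> have total length at most the mass of
  \<open>- C\<close>, and all other parameters are sent close to \<open>C\<close>. Letting the depth
  grow gives the inequality for closed sets that \<open>closed_le_imp_eq\<close> needs.\<close>

lemma distr_skor:
  fixes N :: "'a::complete_space measure"
  assumes N: "N \<in> radon_probs" and ms: "skor N \<in> borel \<rightarrow>\<^sub>M borel"
  shows "distr unif borel (skor N) = N"
proof (rule closed_le_imp_eq)
  interpret N: prob_space N using radon_probsD[OF N] by simp
  interpret U: prob_space unif by (rule prob_space_unif)
  show "prob_space (distr unif borel (skor N))" by (rule U.prob_space_distr) (use ms in simp)
  show "prob_space N" "sets N = sets borel" using radon_probsD[OF N] by auto
  fix C :: "'a set" assume C: "closed C"
  show "emeasure N C \<le> emeasure (distr unif borel (skor N)) C"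
  proof (cases "C = {}")
    case False
    \<comment> \<open>The 3 is 1 + 2: a cell of depth \<open>Suc k\<close> that meets
      \<open>C\<close> has a point of \<open>C\<close> within \<open>1 / 2 ^ k\<close> of its
      centre, and the limit is within \<open>2 / 2 ^ k\<close> of the centre.\<close>
    define D where "D k = {y. infdist y C \<le> 3 / 2 ^ k}" for k :: nat
    have Dc: "closed (D k)" for k unfolding D_def by (intro closed_Collect_le continuous_intros)
    have step: "emeasure N C \<le> emeasure (distr unif borel (skor N)) (D k)" for k
    proof -
      define X where "X s \<longleftrightarrow> (\<forall>y\<in>C. fst (snd s) y = 0)" for s :: "('a \<Rightarrow> real) \<times> ('a \<Rightarrow> real) \<times> 'a"
      define V where "V = {v. 0 \<le> v \<and> v < 1 \<and> X (cells N v (Suc k))}"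
      let ?Q = "{q\<in>\<rat>. 0 \<le> q \<and> q < 1 \<and> X (cells N q (Suc k))}"
      let ?J = "\<lambda>q. {lo N q (Suc k) ..< hi N q (Suc k)}"
      have V: "V = (\<Union>q\<in>?Q. ?J q)" unfolding V_def by (rule cells_level_set[OF N])
      have Vb: "V \<in> sets borel" unfolding V_def by (rule cells_level_borel[OF N])
      have "emeasure lborel V \<le> emeasure N (- C)"
      proof (cases "?Q = {}")
        case False
        define e where "e = from_nat_into ?Q"
        have e: "range e = ?Q" unfolding e_def by (rule range_from_nat_into[OF False countable_Rats_Collect])
        \<comment> \<open>Finite parts of the label set, increasing in \<open>n\<close>, carry the
          finite estimate over to \<open>V\<close>.\<close>
        define W where "W n = (\<Union>q\<in>e ` {..n}. ?J q)" for n :: nat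
        have "V = (\<Union>n. W n)" unfolding V e[symmetric] W_def by auto
        moreover have "emeasure lborel (\<Union>n. W n) = (SUP n. emeasure lborel (W n))"
          by (rule SUP_emeasure_incseq[symmetric]) (force simp: W_def incseq_def)+
        moreover have "emeasure lborel (W n) \<le> emeasure N (- C)" for n
          unfolding W_def
        proof (rule finite_cells_mass[OF N])
          show "C \<in> sets borel" using C by simp
          show "e ` {..n} \<subseteq> {0..<1}" using e by auto
          have "X (cells N v (Suc k))" if "v \<in> e ` {..n}" for v using e that by auto
          then show "\<forall>v\<in>e ` {..n}. \<forall>y\<in>C. wgt N v (Suc k) y = 0" by (auto simp: X_def wgt_def)
        qed simp
        ultimately show ?thesis by (auto intro: SUP_least)
      next
      case True
      then have "V = {}" unfolding V by blast
      then show ?thesis by simp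
    qed
      then have "emeasure unif V \<le> emeasure N (- C)"
      proof -
        have "{0..<1} \<inter> V = V" by (auto simp: V_def)
        moreover assume "emeasure lborel V \<le> emeasure N (- C)"
        ultimately show ?thesis using emeasure_unif[OF Vb] by simp
      qed
      then have "measure unif V \<le> 1 - measure N C"
        using N.prob_compl[of C] C radon_probsD[OF N]
        by (simp add: N.emeasure_eq_measure U.emeasure_eq_measure Compl_eq_Diff_UNIV)
      then have "measure N C \<le> measure unif (- V)"
        using U.prob_compl[of V] Vb by (simp add: Compl_eq_Diff_UNIV)
      also have "\<dots> \<le> measure unif (skor N -` D k)"
      proof (rule U.finite_measure_mono_AE)
        show "skor N -` D k \<in> sets unif" using measurable_sets[OF ms, of "D k"] Dc by simp
        show "AE v in unif. v \<in> - V \<longrightarrow> v \<in> skor N -` D k"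
          using AE_unif_01
        proof eventually_elim
          case (elim v)
          show ?case
          proof
            assume "v \<in> - V"
            then have "\<not> X (cells N v (Suc k))" using elim by (auto simp: V_def)
            then obtain y where y: "y \<in> C" "wgt N v (Suc k) y \<noteq> 0" by (auto simp: X_def wgt_def)
            then have "0 < wgt N v (Suc k) y" using cells_bounds(2)[of N v "Suc k" y] by simp
            then have "dist y (ctr N v (Suc k)) < 1 / 2 ^ k" by (rule wgt_dist) simp
            moreover have "dist (ctr N v (Suc k)) (skor N v) \<le> 2 / 2 ^ k" using skor_lim(2)[OF N] elim by auto
            ultimately have "dist (skor N v) y \<le> 3 / 2 ^ k"
              using dist_triangle3[of "skor N v" y "ctr N v (Suc k)"]
              by (simp add: dist_commute add_divide_distrib[symmetric])
            then show "v \<in> skor N -` D k"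
              using infdist_le[OF y(1), of "skor N v"] by (simp add: D_def)
          qed
        qed
      qed
      finally show ?thesis using ms Dc
        by (simp add: emeasure_distr U.emeasure_eq_measure N.emeasure_eq_measure)
    qed
    interpret P: prob_space "distr unif borel (skor N)" by (rule U.prob_space_distr) (use ms in simp)
    have D0: "(\<Inter>k. D k) = C"
    proof safe
      fix y assume y: "y \<in> (\<Inter>k. D k)"
      have "infdist y C \<le> 0"
        by (rule tendsto_lowerbound[OF pow2_tendsto_0[of 3]]) (use y in \<open>auto simp: D_def\<close>)
      then have "infdist y C = 0" using infdist_nonneg[of y C] by simp
      then show "y \<in> C" using in_closed_iff_infdist_zero[OF C False] by simp
    qed (auto simp: D_def)
    have dec: "decseq D"
    proof (rule decseq_SucI)
      fix n
      have "3 / 2 ^ Suc n \<le> (3 / 2 ^ n :: real)" by (intro divide_left_mono) auto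
      then show "D (Suc n) \<subseteq> D n" by (auto simp: D_def)
    qed
    have "emeasure N C \<le> (INF k. emeasure (distr unif borel (skor N)) (D k))"
      by (rule INF_greatest) (rule step)
    also have "\<dots> = emeasure (distr unif borel (skor N)) (\<Inter>k. D k)"
      by (rule INF_emeasure_decseq) (use Dc dec in auto)
    finally show ?thesis unfolding D0 .
  qed simp
qed simp

text \<open>The exceptional set consists of the left endpoints of the cells of \<open>N\<close>,
  countable because rational labels exhaust the states. It depends on \<open>N\<close> alone and not
  on the sequence.\<close>

lemma skor_converges:
  fixes N :: "'a::complete_space measure"
  assumes N: "N \<in> radon_probs"
  obtains Z where "countable Z"
    "\<And>Ns v. (\<And>n. Ns n \<in> radon_probs) \<Longrightarrow> weakconv Ns N \<Longrightarrow> 0 \<le> v \<Longrightarrow> v < 1 \<Longrightarrow> v \<notin> Z \<Longrightarrow>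
      (\<lambda>n. skor (Ns n) v) \<longlonglongrightarrow> skor N v"
proof
  define Z where "Z = (\<Union>k. (\<lambda>q. lo N q k) ` \<rat>)"
  show "countable Z" unfolding Z_def by (intro countable_UN countable_image countable_rat) auto
  fix Ns v assume Ns: "\<And>n. Ns n \<in> radon_probs" and w: "weakconv Ns N" and v: "0 \<le> v" "v < 1" "v \<notin> Z"
  have nb: "lo N v k \<noteq> v" for k
  proof
    assume *: "lo N v k = v"
    obtain q where q: "q \<in> \<rat>" "cells N q k = cells N v k" using rational_cell[OF N v(1,2)] by metis
    then have "low N q k = low N v k" by (simp add: low_def)
    then have "v \<in> Z" using * q by (auto simp: Z_def image_iff intro!: exI[of _ k] bexI[of _ q])
    then show False using v by simp
  qed
  show "(\<lambda>n. skor (Ns n) v) \<longlonglongrightarrow> skor N v"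
  proof (rule metric_LIMSEQ_I)
    fix e :: real assume e: "0 < e"
    obtain k where k: "4 / 2 ^ k < e" by (rule pow2_small[OF e, of 4])
    obtain M where M: "\<And>n. n \<ge> M \<Longrightarrow> cells (Ns n) v (Suc k) = cells N v (Suc k)"
      using cells_eventually_eq[OF N Ns w v(1,2) nb, of "Suc k"] by (auto simp: eventually_sequentially)
    have "dist (skor (Ns n) v) (skor N v) < e" if "n \<ge> M" for n
    proof -
      have "ctr (Ns n) v (Suc k) = ctr N v (Suc k)" using M[OF that] by (simp add: ctr_def)
      then show ?thesis
        using skor_lim(2)[OF Ns v(1,2), of n k] skor_lim(2)[OF N v(1,2), of k] k
          dist_triangle3[of "skor (Ns n) v" "skor N v" "ctr N v (Suc k)"] by simp
    qed
    then show "\<exists>M. \<forall>n\<ge>M. dist (skor (Ns n) v) (skor N v) < e" by blast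
  qed
qed

section \<open>Binary digits of a uniform variable\<close>

text \<open>Index 0 is the first digit after the binary point; dyadic rationals get their
  terminating expansion.\<close>

definition dig :: "real \<Rightarrow> nat \<Rightarrow> bool" where
  "dig v k = odd \<lfloor>2 ^ Suc k * v\<rfloor>"

abbreviation coin :: "bool measure" where
  "coin \<equiv> measure_pmf (pmf_of_set UNIV)"

abbreviation coins :: "(nat \<Rightarrow> bool) measure" where
  "coins \<equiv> PiM UNIV (\<lambda>_. coin)"

definition bin :: "(nat \<Rightarrow> bool) \<Rightarrow> real" where
  "bin w = (\<Sum>k. of_bool (w k) / 2 ^ Suc k)"

lemma dig_half:
  assumes "0 \<le> v" "v < 1"
  shows "dig (v / 2) 0 = False" "dig ((1 + v) / 2) 0 = True"
    "dig (v / 2) (Suc k) = dig v k" "dig ((1 + v) / 2) (Suc k) = dig v k"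
proof -
  have "\<lfloor>v\<rfloor> = 0" "\<lfloor>1 + v\<rfloor> = 1" using assms by (auto simp: floor_eq_iff)
  moreover have e: "2 ^ Suc 0 * (v / 2) = v" "2 ^ Suc 0 * ((1 + v) / 2) = 1 + v" by simp_all
  ultimately show "dig (v / 2) 0 = False" "dig ((1 + v) / 2) 0 = True"
    unfolding dig_def e by simp_all
  have "2 ^ Suc (Suc k) * (v / 2) = 2 ^ Suc k * v" by simp
  then show "dig (v / 2) (Suc k) = dig v k" unfolding dig_def by (simp only:)
  have "2 ^ Suc (Suc k) * ((1 + v) / 2) = 2 ^ Suc k * v + of_int (2 ^ Suc k)" by (simp add: field_simps)
  then have "\<lfloor>2 ^ Suc (Suc k) * ((1 + v) / 2)\<rfloor> = \<lfloor>2 ^ Suc k * v\<rfloor> + 2 ^ Suc k"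
    by (simp only: floor_add_int[symmetric])
  then show "dig ((1 + v) / 2) (Suc k) = dig v k" unfolding dig_def by simp
qed

lemma measurable_dig [measurable]: "(\<lambda>v. dig v k) \<in> borel \<rightarrow>\<^sub>M count_space UNIV"
proof -
  have "(\<lambda>v::real. \<lfloor>2 ^ Suc k * v\<rfloor>) \<in> borel \<rightarrow>\<^sub>M count_space UNIV" by measurable
  then have "(\<lambda>v::real. odd \<lfloor>2 ^ Suc k * v\<rfloor>) \<in> borel \<rightarrow>\<^sub>M count_space UNIV"
    by (rule measurable_compose) simp
  then show ?thesis by (simp add: dig_def[abs_def])
qed

text \<open>Self-similarity: conditioned on its first binary digit, the rescaled rest of a uniform
  variable is uniform again.\<close>

lemma unif_split:
  assumes S: "S \<in> sets borel"
  shows "emeasure unif S = (emeasure unif {v. v / 2 \<in> S} + emeasure unif {v. (1 + v) / 2 \<in> S}) / 2"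
proof -
  have [measurable]: "S \<in> sets borel" by fact
  have "{v. v / 2 \<in> S} = (\<lambda>v. v / 2) -` S \<inter> space borel" "{v. (1 + v) / 2 \<in> S} = (\<lambda>v. (1 + v) / 2) -` S \<inter> space borel" by auto
  moreover have "(\<lambda>v::real. v / 2) -` S \<inter> space borel \<in> sets borel" "(\<lambda>v::real. (1 + v) / 2) -` S \<inter> space borel \<in> sets borel"
    by (rule measurable_sets[OF _ S]; simp)+
  ultimately have m: "{v. v / 2 \<in> S} \<in> sets borel" "{v. (1 + v) / 2 \<in> S} \<in> sets borel" by simp_all
  have sc: "emeasure lborel T = emeasure lborel {v. (t + v) / 2 \<in> T} / 2" if T: "T \<in> sets borel" for T and t :: real
  proof -
    have m: "{v. (t + v) / 2 \<in> T} \<in> sets borel"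
    proof -
      have "(\<lambda>v. (t + v) / 2) -` T \<inter> space borel \<in> sets borel" by (rule measurable_sets[OF _ T]) simp
      then show ?thesis by (simp add: vimage_def)
    qed
    have "emeasure lborel T = (\<integral>\<^sup>+x. indicator T x \<partial>lborel)" using T by simp
    also have "\<dots> = ennreal \<bar>1 / 2\<bar> * (\<integral>\<^sup>+x. indicator T (t / 2 + 1 / 2 * x) \<partial>lborel)"
      using T by (intro nn_integral_real_affine) auto
    also have "(\<integral>\<^sup>+x. indicator T (t / 2 + 1 / 2 * x) \<partial>lborel) = (\<integral>\<^sup>+x. indicator {v. (t + v) / 2 \<in> T} x \<partial>lborel)"
      by (intro nn_integral_cong) (auto simp: indicator_def add_divide_distrib)
    also have "\<dots> = emeasure lborel {v. (t + v) / 2 \<in> T}" using m by simp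
    finally show ?thesis by (simp add: divide_ennreal_def mult.commute ennreal_divide_numeral[symmetric] divide_ennreal[symmetric])
  qed
  have "{0..<1} \<inter> S = ({0..<1/2} \<inter> S) \<union> ({1/2..<1} \<inter> S)" by auto
  then have "emeasure unif S = emeasure lborel ({0..<1/2} \<inter> S) + emeasure lborel ({1/2..<1} \<inter> S)"
    using S by (subst emeasure_unif) (auto intro!: plus_emeasure[symmetric] simp del: emeasure_uniform_measure)
  also have "emeasure lborel ({0..<1/2} \<inter> S) = emeasure lborel {v. (0 + v) / 2 \<in> {0..<1/2} \<inter> S} / 2"
    by (rule sc) simp
  also have "{v. (0 + v) / 2 \<in> {0..<1/2} \<inter> S} = {0..<1} \<inter> {v. v / 2 \<in> S}" by auto
  also have "emeasure lborel \<dots> = emeasure unif {v. v / 2 \<in> S}" by (rule emeasure_unif[symmetric]) (rule m)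
  also have "emeasure lborel ({1/2..<1} \<inter> S) = emeasure lborel {v. (1 + v) / 2 \<in> {1/2..<1} \<inter> S} / 2"
    by (rule sc) simp
  also have "{v. (1 + v) / 2 \<in> {1/2..<1} \<inter> S} = {0..<1} \<inter> {v. (1 + v) / 2 \<in> S}" by auto
  also have "emeasure lborel \<dots> = emeasure unif {v. (1 + v) / 2 \<in> S}" by (rule emeasure_unif[symmetric]) (rule m)
  finally show ?thesis by (simp add: add_divide_distrib_ennreal)
qed

lemma emeasure_coin: "emeasure coin A = (of_bool (False \<in> A) + of_bool (True \<in> A)) / 2"
proof -
  have A: "A = (if False \<in> A then {False} else {}) \<union> (if True \<in> A then {True} else {})"
  proof (rule set_eqI)
    fix x show "x \<in> A \<longleftrightarrow> x \<in> (if False \<in> A then {False} else {}) \<union> (if True \<in> A then {True} else {})"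
      by (cases x) auto
  qed
  have "card A = of_bool (False \<in> A) + of_bool (True \<in> A)" by (subst A) simp
  then show ?thesis
    by (simp add: emeasure_pmf_of_set divide_ennreal[symmetric] ennreal_of_nat_eq_real_of_nat[symmetric])
qed

text \<open>Digits are split off at the front: each half of the interval fixes digit 0 and shifts
  the others, so the induction must generalise over \<open>A\<close>.\<close>

lemma emeasure_dig:
  "emeasure unif {v. \<forall>j<n. dig v j \<in> A j} = (\<Prod>j<n. emeasure coin (A j))"
proof (induction n arbitrary: A)
  case 0
  interpret prob_space unif by (rule prob_space_unif)
  show ?case using emeasure_space_1 by simp
next
  case (Suc n)
  have m: "{v. \<forall>j<n. dig v j \<in> A j} \<in> sets borel" for n A
  proof -
    have "{v \<in> space borel. \<forall>j<n. dig v j \<in> A j} \<in> sets borel" by measurable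
    then show ?thesis by simp
  qed
  let ?S = "{v. \<forall>j<Suc n. dig v j \<in> A j}" and ?R = "{v. \<forall>j<n. dig v j \<in> A (Suc j)}"
  have all: "(\<forall>j<Suc n. P j) \<longleftrightarrow> P 0 \<and> (\<forall>j<n. P (Suc j))" for P by (auto simp: less_Suc_eq_0_disj)
  have eq: "emeasure unif {v. v / 2 \<in> ?S} = of_bool (False \<in> A 0) * emeasure unif ?R"
    "emeasure unif {v. (1 + v) / 2 \<in> ?S} = of_bool (True \<in> A 0) * emeasure unif ?R"
  proof -
    have "{v. (t + v) / 2 \<in> ?S} \<in> sets borel" for t :: real
    proof -
      have "(\<lambda>v. (t + v) / 2) -` ?S \<inter> space borel \<in> sets borel" by (rule measurable_sets[OF _ m]) simp
      then show ?thesis by (simp add: vimage_def)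
    qed
    from this[of 0] this[of 1] have m': "{v. v / 2 \<in> ?S} \<in> sets borel" "{v. (1 + v) / 2 \<in> ?S} \<in> sets borel" by auto
    have "{0..<1} \<inter> {v. v / 2 \<in> ?S} = (if False \<in> A 0 then {0..<1} \<inter> ?R else {})"
      "{0..<1} \<inter> {v. (1 + v) / 2 \<in> ?S} = (if True \<in> A 0 then {0..<1} \<inter> ?R else {})"
      unfolding all by (auto simp: dig_half)
    then show "emeasure unif {v. v / 2 \<in> ?S} = of_bool (False \<in> A 0) * emeasure unif ?R"
      "emeasure unif {v. (1 + v) / 2 \<in> ?S} = of_bool (True \<in> A 0) * emeasure unif ?R"
      using m' m by (auto simp: emeasure_unif simp del: emeasure_uniform_measure)
  qed
  have "emeasure unif ?S = (of_bool (False \<in> A 0) * emeasure unif ?R + of_bool (True \<in> A 0) * emeasure unif ?R) / 2"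
    using unif_split[OF m, of "Suc n" A] unfolding eq .
  also have "\<dots> = emeasure coin (A 0) * emeasure unif ?R"
  proof -
    have "(a * r + b * r) / 2 = (a + b) / 2 * r" for a b r :: ennreal
      by (simp add: distrib_right[symmetric] ennreal_times_divide mult.commute)
    then show ?thesis unfolding emeasure_coin .
  qed
  finally show ?case unfolding Suc by (simp only: prod.lessThan_Suc_shift)
qed

lemma measurable_dig_coins: "dig \<in> borel \<rightarrow>\<^sub>M coins"
proof (rule measurable_PiM_single')
  fix i show "(\<lambda>v. dig v i) \<in> borel \<rightarrow>\<^sub>M coin"
    using measurable_dig[of i] by (simp cong: measurable_cong_sets)
qed auto

lemma distr_dig: "distr unif coins dig = coins"
proof -
  interpret product_prob_space "\<lambda>_::nat. coin" UNIV
    by standard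
  show ?thesis
  proof (rule PiM_eq)
    fix J and F :: "nat \<Rightarrow> bool set" assume J: "finite J" "\<And>j. j \<in> J \<Longrightarrow> F j \<in> sets coin"
    \<comment> \<open>A condition on the digits in \<open>J\<close> becomes one on the first
      \<open>n\<close> digits, padded with \<open>UNIV\<close>.\<close>
    define n where "n = Suc (Max (insert 0 J))"
    define A where "A j = (if j \<in> J then F j else UNIV)" for j
    have n: "j < n" if "j \<in> J" for j using J that by (auto simp: n_def less_Suc_eq_le)
    have eq: "prod_emb UNIV (\<lambda>_. coin) J (Pi\<^sub>E J F) = {w. \<forall>j\<in>J. w j \<in> F j}"
      by (auto simp: prod_emb_def PiE_def Pi_def space_PiM)
    have ms: "{w. \<forall>j\<in>J. w j \<in> F j} \<in> sets coins" unfolding eq[symmetric] using J by (intro sets_PiM_I) auto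
    have "emeasure (distr unif coins dig) {w. \<forall>j\<in>J. w j \<in> F j} = emeasure unif {v. \<forall>j\<in>J. dig v j \<in> F j}"
      using measurable_dig_coins ms by (subst emeasure_distr) (auto simp: vimage_def simp del: emeasure_uniform_measure)
    also have "{v. \<forall>j\<in>J. dig v j \<in> F j} = {v. \<forall>j<n. dig v j \<in> A j}" using n by (auto simp: A_def)
    also have "emeasure unif \<dots> = (\<Prod>j<n. emeasure coin (A j))" by (rule emeasure_dig)
    also have "\<dots> = (\<Prod>j\<in>J. emeasure coin (F j))"
    proof (rule prod.mono_neutral_cong_right)
      show "\<forall>i\<in>{..<n} - J. emeasure coin (A i) = 1"
        using measure_pmf.emeasure_space_1 by (auto simp: A_def)
    qed (use n in \<open>auto simp: A_def\<close>)
    finally show "emeasure (distr unif coins dig) (prod_emb UNIV (\<lambda>_. coin) J (Pi\<^sub>E J F)) = (\<Prod>j\<in>J. emeasure coin (F j))"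
      unfolding eq .
  qed simp
qed

lemma summable_bin: "summable (\<lambda>k. of_bool (w k) / 2 ^ Suc k :: real)"
proof (rule summable_comparison_test)
  show "\<exists>N. \<forall>n\<ge>N. norm (of_bool (w n) / 2 ^ Suc n :: real) \<le> (1 / 2) ^ n"
    by (auto simp: power_one_over field_simps)
qed (simp add: summable_geometric)

lemma measurable_coins_component [measurable]: "(\<lambda>w. w k) \<in> coins \<rightarrow>\<^sub>M count_space UNIV"
  using measurable_component_singleton[of k UNIV "\<lambda>_. coin"] by (simp cong: measurable_cong_sets)

lemma measurable_bin [measurable]: "bin \<in> borel_measurable coins"
  unfolding bin_def[abs_def] by (intro borel_measurable_suminf) measurable

lemma bin_dig:
  assumes v: "0 \<le> v" "v < 1"
  shows "bin (dig v) = v"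
proof -
  \<comment> \<open>Cutting the expansion after \<open>n\<close> digits gives the dyadic floor of
    \<open>v\<close>.\<close>
  have part: "(\<Sum>k<n. of_bool (dig v k) / 2 ^ Suc k :: real) = of_int \<lfloor>2 ^ n * v\<rfloor> / 2 ^ n" for n
  proof (induction n)
    case 0
    have "\<lfloor>v\<rfloor> = 0" using v by (auto simp: floor_eq_iff)
    then show ?case by simp
  next
    case (Suc n)
    define z where "z = \<lfloor>2 ^ Suc n * v\<rfloor>"
    have "\<lfloor>2 ^ n * v\<rfloor> = \<lfloor>(2 ^ Suc n * v) / 2\<rfloor>" by simp
    also have "\<dots> = z div 2" using floor_divide_real_eq_div[of 2 "2 ^ Suc n * v"] by (simp add: z_def)
    finally have h: "\<lfloor>2 ^ n * v\<rfloor> = z div 2" .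
    have "dig v n = odd z" by (simp add: dig_def z_def)
    then have "real_of_int z = 2 * of_int \<lfloor>2 ^ n * v\<rfloor> + of_bool (dig v n)"
      unfolding h by (cases "odd z") (auto elim!: oddE evenE)
    then show ?case using Suc by (simp add: z_def field_simps)
  qed
  have "(\<lambda>n. of_int \<lfloor>2 ^ n * v\<rfloor> / 2 ^ n :: real) \<longlonglongrightarrow> v"
  proof (rule tendsto_sandwich)
    show "\<forall>\<^sub>F n in sequentially. v - (1 / 2) ^ n \<le> of_int \<lfloor>2 ^ n * v\<rfloor> / 2 ^ n"
    proof (rule always_eventually, rule allI)
      fix n
      have "2 ^ n * v - 1 \<le> of_int \<lfloor>2 ^ n * v\<rfloor>" by linarith
      then have "(2 ^ n * v - 1) / 2 ^ n \<le> of_int \<lfloor>2 ^ n * v\<rfloor> / 2 ^ n" by (rule divide_right_mono) simp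
      then show "v - (1 / 2) ^ n \<le> of_int \<lfloor>2 ^ n * v\<rfloor> / 2 ^ n" by (simp add: diff_divide_distrib power_one_over)
    qed
    show "\<forall>\<^sub>F n in sequentially. of_int \<lfloor>2 ^ n * v\<rfloor> / 2 ^ n \<le> v"
    proof (rule always_eventually, rule allI)
      fix n
      have "of_int \<lfloor>2 ^ n * v\<rfloor> / 2 ^ n \<le> (2 ^ n * v) / 2 ^ n" by (rule divide_right_mono) auto
      then show "of_int \<lfloor>2 ^ n * v\<rfloor> / 2 ^ n \<le> v" by simp
    qed
    show "(\<lambda>n. v - (1 / 2) ^ n) \<longlonglongrightarrow> v" using tendsto_diff[OF tendsto_const LIMSEQ_realpow_zero[of "1/2"], of v] by simp
  qed simp
  then have "(\<lambda>k. of_bool (dig v k) / 2 ^ Suc k) sums v" unfolding sums_def part .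
  then show ?thesis unfolding bin_def by (simp add: sums_iff)
qed

lemma distr_bin: "distr coins borel bin = unif"
proof -
  have "distr coins borel bin = distr (distr unif coins dig) borel bin" by (simp add: distr_dig)
  also have "\<dots> = distr unif borel (bin \<circ> dig)"
    using measurable_dig_coins by (intro distr_distr) auto
  also have "\<dots> = distr unif borel (\<lambda>v. v)"
  proof (rule distr_cong_AE)
    show "AE v in unif. (bin \<circ> dig) v = v"
      using AE_unif_01 by eventually_elim (simp add: bin_dig)
    show "bin \<circ> dig \<in> borel_measurable unif"
      using measurable_comp[OF measurable_dig_coins measurable_bin] by (simp cong: measurable_cong_sets)
  qed auto
  also have "\<dots> = unif" by (rule distr_id2) simp
  finally show ?thesis .
qed

text \<open>Any bits listed without repetition encode a uniform variable, so one stream of bits can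
  be divided among several purposes.\<close>

lemma distr_bin_reindex:
  assumes "inj f"
  shows "distr coins borel (\<lambda>w. bin (\<lambda>n. w (f n))) = unif"
proof -
  have "distr coins coins (\<lambda>w. \<lambda>n\<in>UNIV. w (f n)) = coins"
    by (rule distr_PiM_reindex[of UNIV "\<lambda>_. coin" f UNIV, simplified]) (use assms prob_space_measure_pmf in auto)
  then have d: "distr coins coins (\<lambda>w n. w (f n)) = coins" by (simp add: restrict_UNIV)
  have m: "(\<lambda>w n. w (f n)) \<in> coins \<rightarrow>\<^sub>M coins"
    by (rule measurable_PiM_single') (use measurable_component_singleton[of _ UNIV "\<lambda>_. coin"] in auto)
  have "unif = distr (distr coins coins (\<lambda>w n. w (f n))) borel bin" by (simp add: d distr_bin)
  also have "\<dots> = distr coins borel (bin \<circ> (\<lambda>w n. w (f n)))" by (rule distr_distr) (use m in auto)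
  finally show ?thesis by (simp add: comp_def)
qed


section \<open>Generating bits on a nonatomic space\<close>

text \<open>In base 4 with digits 0 and 1 no expansion is ambiguous: the remainder stays below 1 and
  earlier digits contribute multiples of 4, so the parity of the integer part is the digit
  \<open>w k\<close>. One real number thus remembers countably many truth values.\<close>

lemma quad_digit:
  "w k = odd \<lfloor>4 ^ Suc k * (\<Sum>j. of_bool (w j) / 4 ^ Suc j :: real)\<rfloor>"
proof -
  have sm: "summable (\<lambda>j. of_bool (w j) / 4 ^ Suc j :: real)" for w
  proof (rule summable_comparison_test)
    show "\<exists>N. \<forall>n\<ge>N. norm (of_bool (w n) / 4 ^ Suc n :: real) \<le> (1 / 4) ^ n"
      by (auto simp: power_one_over field_simps)
  qed (simp add: summable_geometric)
  have up: "(\<Sum>j. of_bool (w j) / 4 ^ Suc j :: real) < 1" and nn: "0 \<le> (\<Sum>j. of_bool (w j) / 4 ^ Suc j :: real)" for w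
  proof -
    have geo: "(\<lambda>j. 1 / 4 * (1 / 4) ^ j :: real) sums (1 / 4 * (1 / (1 - 1 / 4)))"
      by (intro sums_mult geometric_sums) simp
    have "(\<Sum>j. of_bool (w j) / 4 ^ Suc j :: real) \<le> (\<Sum>j. 1 / 4 * (1 / 4) ^ j)"
      by (rule suminf_le[OF _ sm sums_summable[OF geo]]) (auto simp: power_one_over field_simps)
    also have "\<dots> < 1" unfolding sums_unique[OF geo, symmetric] by simp
    finally show "(\<Sum>j. of_bool (w j) / 4 ^ Suc j :: real) < 1" .
    show "0 \<le> (\<Sum>j. of_bool (w j) / 4 ^ Suc j :: real)" by (rule suminf_nonneg[OF sm]) simp
  qed
  define z :: int where "z = (\<Sum>j<k. of_bool (w j) * 4 ^ (k - j))"
  define t where "t = (\<Sum>j. of_bool (w (j + Suc k)) / 4 ^ Suc j :: real)"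
  have "(\<Sum>j. of_bool (w j) / 4 ^ Suc j :: real) = (\<Sum>j. of_bool (w (j + Suc k)) / 4 ^ Suc (j + Suc k)) + (\<Sum>j<Suc k. of_bool (w j) / 4 ^ Suc j)"
    by (rule suminf_split_initial_segment[OF sm])
  also have "(\<Sum>j. of_bool (w (j + Suc k)) / 4 ^ Suc (j + Suc k) :: real) = t / 4 ^ Suc k"
    unfolding t_def by (subst suminf_divide[OF sm, symmetric]) (simp add: power_add mult_ac)
  finally have "4 ^ Suc k * (\<Sum>j. of_bool (w j) / 4 ^ Suc j :: real) = t + 4 ^ Suc k * (\<Sum>j<Suc k. of_bool (w j) / 4 ^ Suc j)"
    by (simp add: distrib_left)
  also have "4 ^ Suc k * (\<Sum>j<Suc k. of_bool (w j) / 4 ^ Suc j :: real) = of_int z + of_bool (w k)"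
  proof -
    have "4 ^ Suc k * (of_bool (w j) / 4 ^ Suc j :: real) = of_bool (w j) * 4 ^ (k - j)" if "j < k" for j
      using that by (simp add: power_diff)
    then show ?thesis
      by (simp add: z_def sum_distrib_left distrib_left of_int_sum del: power_Suc) 
  qed
  finally have "\<lfloor>4 ^ Suc k * (\<Sum>j. of_bool (w j) / 4 ^ Suc j :: real)\<rfloor> = \<lfloor>t + of_int (z + of_bool (w k))\<rfloor>"
    by simp
  also have "\<dots> = z + of_bool (w k)" using up[of "\<lambda>j. w (j + Suc k)"] nn[of "\<lambda>j. w (j + Suc k)"]
    unfolding t_def[symmetric] by (auto simp: floor_eq_iff)
  finally have fl: "\<lfloor>4 ^ Suc k * (\<Sum>j. of_bool (w j) / 4 ^ Suc j :: real)\<rfloor> = z + of_bool (w k)" .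
  have "even z" unfolding z_def by (rule dvd_sum) auto
  then show ?thesis unfolding fl by simp
qed

text \<open>\<open>F\<close> is the distribution function of \<open>g\<close>. It may be flat, so
  \<open>F (g x) \<le> F s\<close> does not force \<open>g x \<le> s\<close>, but flat stretches
  carry no mass. The last conclusion says that passing from \<open>g\<close> to
  \<open>F (g x)\<close> loses no event up to null sets.\<close>

lemma uniformize:
  fixes g :: "'a \<Rightarrow> real"
  assumes "prob_space M" and g [measurable]: "g \<in> borel_measurable M"
    and na: "\<And>c. measure M {x \<in> space M. g x = c} = 0"
  obtains F where "mono F" "distr M borel (\<lambda>x. F (g x)) = unif"
    "\<And>s. AE x in M. F (g x) \<le> F s \<longleftrightarrow> g x \<le> s"
proof -
  interpret prob_space M by fact
  interpret D: real_distribution "distr M borel g" by (rule real_distribution_distr) simp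
  define F where "F = cdf (distr M borel g)"
  have F: "F s = measure M {x \<in> space M. g x \<le> s}" for s
    unfolding F_def cdf_def by (subst measure_distr) (auto intro!: arg_cong[of _ _ "measure M"])
  have mono: "mono F" unfolding F_def by (intro monoI D.cdf_nondecreasing)
  have cont: "isCont F s" for s
    unfolding F_def D.isCont_cdf
  proof (subst measure_distr)
    have "g -` {s} \<inter> space M = {x \<in> space M. g x = s}" by auto
    then show "measure M (g -` {s} \<inter> space M) = 0" using na[of s] by simp
  qed auto
  have lim: "(F \<longlongrightarrow> 0) at_bot" "(F \<longlongrightarrow> 1) at_top"
    unfolding F_def by (rule D.cdf_lim_at_bot D.cdf_lim_at_top_prob)+
  have [measurable]: "F \<in> borel_measurable borel" by (rule borel_measurable_mono[OF mono])
  have ivt: "\<exists>s. F s = c" if c: "0 < c" "c < 1" for c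
  proof -
    obtain l where l: "F l < c" using order_tendstoD(2)[OF lim(1) c(1)] by (auto simp: eventually_at_bot_linorder)
    obtain u where u: "c < F u" using order_tendstoD(1)[OF lim(2) c(2)] by (auto simp: eventually_at_top_linorder)
    have "l \<le> u" using l u monoD[OF mono, of u l] by (cases "l \<le> u") auto
    then show ?thesis using IVT[of F l c u] l u cont by (auto simp: less_imp_le)
  qed
  have le: "measure M {x \<in> space M. F (g x) \<le> c} = c" if c: "0 < c" "c < 1" for c
  proof (rule antisym)
    obtain s where s: "F s = c" using ivt[OF c] by auto
    have "measure M {x \<in> space M. g x \<le> s} \<le> measure M {x \<in> space M. F (g x) \<le> c}"
      using s monoD[OF mono] by (intro finite_measure_mono) auto
    then show "c \<le> measure M {x \<in> space M. F (g x) \<le> c}" using s F by simp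
    \<comment> \<open>Levels \<open>c'\<close> slightly above \<open>c\<close> are used because
      \<open>F\<close> may be flat at height \<open>c\<close>.\<close>
    show "measure M {x \<in> space M. F (g x) \<le> c} \<le> c"
    proof (rule dense_ge_bounded[OF c(2)])
      fix c' assume c': "c < c'" "c' < 1"
      obtain s' where s': "F s' = c'" using ivt[of c'] c c' by auto
      have "g x \<le> s'" if "F (g x) \<le> c" for x
        using monoD[OF mono, of s' "g x"] s' that c' by (cases "g x \<le> s'") auto
      then have "measure M {x \<in> space M. F (g x) \<le> c} \<le> measure M {x \<in> space M. g x \<le> s'}"
        by (intro finite_measure_mono) auto
      then show "measure M {x \<in> space M. F (g x) \<le> c} \<le> c'" using s' F by simp
    qed
  qed
  have F01: "0 \<le> F s" "F s \<le> 1" for s unfolding F by auto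
  have le': "measure M {x \<in> space M. F (g x) \<le> c} = max 0 (min 1 c)" for c
  proof -
    consider "c < 0" | "c = 0" | "0 < c" "c < 1" | "1 \<le> c" by linarith
    then show ?thesis
    proof cases
      case 1
      then have e: "{x \<in> space M. F (g x) \<le> c} = {}" using F01(1) by (auto simp: not_le intro: less_le_trans)
      show ?thesis unfolding e using 1 by simp
    next
      case 2
      have "measure M {x \<in> space M. F (g x) \<le> 0} \<le> d" if "0 < d" "d < 1" for d
      proof -
        have "measure M {x \<in> space M. F (g x) \<le> 0} \<le> measure M {x \<in> space M. F (g x) \<le> d}"
          using that by (intro finite_measure_mono) auto
        then show ?thesis using le[OF that] by simp
      qed
      then have "measure M {x \<in> space M. F (g x) \<le> 0} \<le> 0" by (rule dense_ge_bounded[OF zero_less_one])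
      then show ?thesis using 2 measure_nonneg[of M "{x \<in> space M. F (g x) \<le> 0}"] by simp
    next
      case 4
      then have e: "{x \<in> space M. F (g x) \<le> c} = space M" using F01(2) by (auto intro: order_trans)
      show ?thesis unfolding e using 4 prob_space by simp
    qed (use le in simp)
  qed
  have d: "distr M borel (\<lambda>x. F (g x)) = unif"
  proof (rule cdf_unique)
    show "real_distribution (distr M borel (\<lambda>x. F (g x)))" by (rule real_distribution_distr) simp
    show "real_distribution unif"
      using prob_space_unif by (simp add: real_distribution_def real_distribution_axioms_def)
    show "cdf (distr M borel (\<lambda>x. F (g x))) = cdf unif"
    proof
      fix c
      have "cdf (distr M borel (\<lambda>x. F (g x))) c = measure M {x \<in> space M. F (g x) \<le> c}"
        unfolding cdf_def by (subst measure_distr) (auto intro!: arg_cong[of _ _ "measure M"])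
      also have "\<dots> = max 0 (min 1 c)" by (rule le')
      also have "\<dots> = measure lborel ({0..<1} \<inter> {..c})"
      proof -
        consider "c < 0" | "0 \<le> c" "c < 1" | "1 \<le> c" by linarith
        then show ?thesis
        proof cases
          case 1 then have "{0..<1} \<inter> {..c} = {}" by auto
          then show ?thesis using 1 by simp
        next
          case 2 then have "{0..<1} \<inter> {..c} = {0..c}" by auto
          then show ?thesis using 2 by simp
        next
          case 3 then have "{0..<1} \<inter> {..c} = {0..<1}" by auto
          then show ?thesis using 3 by simp
        qed
      qed
      also have "\<dots> = cdf unif c"
        unfolding cdf_def measure_def by (subst emeasure_unif) auto
      finally show "cdf (distr M borel (\<lambda>x. F (g x))) c = cdf unif c" .
    qed
  qed
  have "AE x in M. F (g x) \<le> F s \<longleftrightarrow> g x \<le> s" for s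
  proof -
    have "measure M ({x \<in> space M. F (g x) \<le> F s} - {x \<in> space M. g x \<le> s}) =
      measure M {x \<in> space M. F (g x) \<le> F s} - measure M {x \<in> space M. g x \<le> s}"
      by (rule finite_measure_Diff) (auto intro: monoD[OF mono])
    also have "\<dots> = 0" unfolding le' F[symmetric] using F01[of s] by simp
    finally have "AE x in M. x \<notin> {x \<in> space M. F (g x) \<le> F s} - {x \<in> space M. g x \<le> s}"
      by (intro AE_not_in) (auto simp: null_sets_def emeasure_eq_measure)
    then show ?thesis by (rule AE_mp) (auto intro!: AE_I2 intro: monoD[OF mono])
  qed
  with mono d show thesis by (rule that)
qed

text \<open>Compact sets exhaust the mass and are totally bounded; this stands in for separability
  of the space.\<close>

lemma radon_separable:
  fixes N :: "'a::metric_space measure"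
  assumes N: "N \<in> radon_probs"
  obtains Z D where "Z \<in> sets borel" "emeasure N (- Z) = 0" "countable D" "D \<noteq> {}"
    "\<forall>x\<in>Z. \<forall>e>0. \<exists>d\<in>D. dist d x < e"
proof -
  interpret prob_space N using radon_probsD[OF N] by simp
  have "\<exists>K. compact K \<and> measure N (- K) < 1 / Suc n" for n
    using radon_compact[OF N, of "1 / Suc n"] by (metis of_nat_0_less_iff zero_less_Suc zero_less_divide_1_iff)
  then obtain K where K: "\<And>n::nat. compact (K n)" "\<And>n. measure N (- K n) < 1 / Suc n" by metis
  define Z where "Z = (\<Union>n. K n)"
  have Zb: "Z \<in> sets borel" unfolding Z_def using K(1) by (auto intro: borel_compact)
  have Kb: "K n \<in> sets N" for n using K(1) radon_probsD[OF N] by (simp add: borel_compact)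
  have "measure N (- Z) \<le> 1 / Suc n" for n
  proof -
    have "measure N (- Z) \<le> measure N (- K n)"
      using Kb[of n] radon_probsD[OF N] by (intro finite_measure_mono) (auto simp: Z_def intro: borel_comp)
    then show ?thesis using K(2)[of n] by simp
  qed
  note le = this
  have "measure N (- Z) \<le> 0"
  proof (rule ccontr)
    assume "\<not> measure N (- Z) \<le> 0"
    then obtain n where "1 / Suc n < measure N (- Z)" using nat_approx_posE[of "measure N (- Z)"] by auto
    then show False using le[of n] by simp
  qed
  then have Z0: "emeasure N (- Z) = 0" by (simp add: emeasure_eq_measure measure_le_0_iff)
  have "\<exists>k. finite k \<and> K n \<subseteq> (\<Union>x\<in>k. ball x (1 / Suc m))" for n m
  proof -
    have "\<forall>\<epsilon>>0. \<exists>k. finite k \<and> k \<subseteq> K n \<and> K n \<subseteq> (\<Union>x\<in>k. ball x \<epsilon>)"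
      using seq_compact_imp_totally_bounded[of "K n"] K(1)[of n] by (simp add: compact_eq_seq_compact_metric)
    from this[rule_format, of "1 / Suc m"] show ?thesis by auto
  qed
  then obtain k where k: "\<And>n m::nat. finite (k n m)" "\<And>n m. K n \<subseteq> (\<Union>x\<in>k n m. ball x (1 / Suc m))" by metis
  \<comment> \<open>The extra point keeps \<open>D\<close> nonempty, as its enumeration
    requires.\<close>
  define D where "D = insert undefined (\<Union>n m. k n m)"
  show thesis
  proof (rule that[OF Zb Z0, of D])
    show "countable D" 
    proof -
      have "countable (\<Union>n m. k n m)" by (intro countable_UN countableI_type countable_finite k)
      then show ?thesis by (simp add: D_def)
    qed
    show "D \<noteq> {}" by (simp add: D_def)
    show "\<forall>x\<in>Z. \<forall>e>0. \<exists>d\<in>D. dist d x < e"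
    proof (intro ballI allI impI)
      fix x and e :: real assume x: "x \<in> Z" and e: "0 < e"
      obtain m where m: "1 / Suc m < e" using nat_approx_posE[OF e] by auto
      obtain n where "x \<in> K n" using x by (auto simp: Z_def)
      then obtain d where "d \<in> k n m" "dist d x < 1 / Suc m" using k(2)[of n m] by auto
      then show "\<exists>d\<in>D. dist d x < e" using m by (intro bexI[of _ d]) (auto simp: D_def)
    qed
  qed
qed

lemma nonatomic_singleton:
  fixes M :: "'a::t1_space measure"
  assumes "nonatomic M" "sets M = sets borel"
  shows "emeasure M {x} = 0"
proof (rule ccontr)
  assume "emeasure M {x} \<noteq> 0"
  then have "\<exists>A\<in>sets M. 0 < emeasure M A \<and> (\<forall>B\<in>sets M. B \<subseteq> A \<longrightarrow> emeasure M B = 0 \<or> emeasure M B = emeasure M A)"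
    using assms(2) by (intro bexI[of _ "{x}"]) (auto simp: subset_singleton_iff zero_less_iff_neq_zero)
  then show False using assms(1) by (simp add: nonatomic_def)
qed

text \<open>A point is coded by its memberships in countably many balls, the code is made uniform,
  and its binary digits are the bits. The code is injective on a set of full measure, so
  nonatomicity makes its law atomless. Conversely the bits return the code almost everywhere and the
  code returns the balls; as the sets approximable by finite words form a sigma-algebra, they
  include all Borel sets.\<close>

theorem generating_bits:
  fixes \<mu> :: "'x::metric_space measure"
  assumes \<mu>: "\<mu> \<in> radon_probs" and na: "nonatomic \<mu>"
  obtains B :: "'x \<Rightarrow> nat \<Rightarrow> bool" where "B \<in> borel \<rightarrow>\<^sub>M coins" "distr \<mu> coins B = coins"
    "\<And>A e. A \<in> sets borel \<Longrightarrow> 0 < e \<Longrightarrow>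
      \<exists>m S. measure \<mu> ((A - {x. map (B x) [0..<m] \<in> S}) \<union> ({x. map (B x) [0..<m] \<in> S} - A)) < e"
proof -
  interpret prob_space \<mu> using radon_probsD[OF \<mu>] by simp
  have sets [measurable_cong]: "sets \<mu> = sets borel" and sp: "space \<mu> = UNIV" using radon_probsD[OF \<mu>] by auto
  obtain Z D where Z: "Z \<in> sets borel" "emeasure \<mu> (- Z) = 0" and D: "countable D" "D \<noteq> {}"
    and ZD: "\<forall>x\<in>Z. \<forall>e>0. \<exists>d\<in>D. dist d x < e"
    by (rule radon_separable[OF \<mu>])
  have AEZ: "AE x in \<mu>. x \<in> Z"
  proof (rule AE_I[of _ _ "- Z"])
    show "- Z \<in> sets \<mu>" using Z sets by (auto intro: borel_comp)
  qed (use Z in auto)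
  define c where "c = from_nat_into (D \<times> (UNIV :: nat set))"
  have c: "range c = D \<times> UNIV" unfolding c_def by (rule range_from_nat_into) (use D in auto)
  define A where "A k = ball (fst (c k)) (1 / Suc (snd (c k)))" for k
  have Ab [measurable]: "A k \<in> sets borel" for k by (simp add: A_def)
  have Aopen: "\<exists>k. x \<in> A k \<and> A k \<subseteq> U" if U: "open U" "x \<in> U" "x \<in> Z" for U x
  proof -
    obtain e where e: "0 < e" "ball x e \<subseteq> U" using openE[OF U(1,2)] by blast
    obtain m where m: "1 / Suc m < e / 2" using nat_approx_posE[of "e / 2"] e by auto
    obtain d where d: "d \<in> D" "dist d x < 1 / Suc m" using ZD[rule_format, OF U(3), of "1 / Suc m"] by auto
    have "(d, m) \<in> range c" using d by (simp add: c)
    then obtain k where k: "c k = (d, m)" by auto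
    have "A k \<subseteq> ball x e"
    proof
      fix y assume "y \<in> A k"
      then have "dist d y < 1 / Suc m" by (simp add: A_def k)
      then show "y \<in> ball x e" using d m dist_triangle3[of x y d] by simp
    qed
    then show ?thesis using d e by (intro exI[of _ k]) (auto simp: A_def k)
  qed
  define g0 where "g0 x = (\<Sum>j. of_bool (x \<in> A j) / 4 ^ Suc j :: real)" for x
  have g0m [measurable]: "g0 \<in> borel_measurable borel"
    unfolding g0_def[abs_def] by (intro borel_measurable_suminf) measurable
  have g0d: "x \<in> A k \<longleftrightarrow> odd \<lfloor>4 ^ Suc k * g0 x\<rfloor>" for x k
    unfolding g0_def by (rule quad_digit)
  \<comment> \<open>On \<open>Z\<close> the balls separate points, so a level set of the code has at
    most one point there.\<close>
  have g0na: "measure \<mu> {x \<in> space \<mu>. g0 x = r} = 0" for r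
  proof (cases "\<exists>x\<in>Z. g0 x = r")
    case True
    then obtain x where x: "x \<in> Z" "g0 x = r" by auto
    have "y = x" if y: "y \<in> Z" "g0 y = r" for y
    proof (rule ccontr)
      assume "y \<noteq> x"
      then obtain k where "x \<in> A k" "A k \<subseteq> - {y}" using Aopen[of "- {y}" x] x by auto
      then show False using g0d[of x k] g0d[of y k] x y by auto
    qed
    then have "{x \<in> space \<mu>. g0 x = r} \<subseteq> {x} \<union> - Z" by auto
    then have "emeasure \<mu> {x \<in> space \<mu>. g0 x = r} \<le> emeasure \<mu> ({x} \<union> - Z)"
      using Z sets by (intro emeasure_mono) (auto intro: borel_comp)
    also have "\<dots> \<le> emeasure \<mu> {x} + emeasure \<mu> (- Z)"
      using Z sets by (intro emeasure_subadditive) (auto intro: borel_comp)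
    also have "\<dots> = 0" using Z nonatomic_singleton[OF na sets] by simp
    finally show ?thesis by (simp add: measure_def)
  next
    case False
    then have "{x \<in> space \<mu>. g0 x = r} \<subseteq> - Z" by auto
    then have "emeasure \<mu> {x \<in> space \<mu>. g0 x = r} \<le> emeasure \<mu> (- Z)"
      using Z sets by (intro emeasure_mono) (auto intro: borel_comp)
    then show ?thesis using Z by (simp add: measure_def)
  qed
  obtain F where F: "mono F" "distr \<mu> borel (\<lambda>x. F (g0 x)) = unif" "\<And>s. AE x in \<mu>. F (g0 x) \<le> F s \<longleftrightarrow> g0 x \<le> s"
    using uniformize[OF prob_space_axioms _ g0na] by auto
  have [measurable]: "F \<in> borel_measurable borel" by (rule borel_measurable_mono[OF F(1)])
  define B where "B x = dig (F (g0 x))" for x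
  have Bm: "B \<in> borel \<rightarrow>\<^sub>M coins"
    unfolding B_def by (rule measurable_compose[OF _ measurable_dig_coins]) simp
  have Bd: "distr \<mu> coins B = coins"
  proof -
    have "distr \<mu> coins B = distr (distr \<mu> borel (\<lambda>x. F (g0 x))) coins dig"
      unfolding B_def by (subst distr_distr[OF measurable_dig_coins]) (auto simp: comp_def)
    then show ?thesis by (simp only: F(2) distr_dig)
  qed
  have binB: "AE x in \<mu>. bin (B x) = F (g0 x)"
  proof -
    have "AE v in distr \<mu> borel (\<lambda>x. F (g0 x)). 0 \<le> v \<and> v < 1" unfolding F(2) by (rule AE_unif_01)
    then have "AE x in \<mu>. 0 \<le> F (g0 x) \<and> F (g0 x) < 1" by (subst (asm) AE_distr_iff) auto
    then show ?thesis by eventually_elim (simp add: B_def bin_dig)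
  qed
  define V where "V m S = {x. map (B x) [0..<m] \<in> S}" for m S
  have Bk [measurable]: "(\<lambda>x. B x k) \<in> borel \<rightarrow>\<^sub>M count_space UNIV" for k
    using measurable_compose[OF Bm measurable_coins_component] .
  have Vb [measurable]: "V m S \<in> sets borel" for m S
  proof -
    have "(\<lambda>x. map (B x) [0..<m]) \<in> borel \<rightarrow>\<^sub>M count_space UNIV"
    proof (induction m)
      case (Suc m)
      have "(\<lambda>p. fst p @ [snd p]) \<in> count_space UNIV \<Otimes>\<^sub>M count_space UNIV \<rightarrow>\<^sub>M count_space (UNIV :: bool list set)"
        by (simp add: pair_measure_countable)
      from measurable_compose[OF measurable_Pair[OF Suc Bk[of m]] this] show ?case by simp
    qed simp
    from measurable_sets[OF this, of S] show ?thesis by (simp add: V_def vimage_def)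
  qed
  have Vup: "\<exists>S'. V m S = V n S'" if "m \<le> n" for m n S
  proof (intro exI[of _ "{l. take m l \<in> S}"])
    have "take m (map (B x) [0..<n]) = map (B x) [0..<m]" for x using that by (simp add: take_map)
    then show "V m S = V n {l. take m l \<in> S}" by (simp add: V_def)
  qed
  have Vun: "\<exists>m S. V m1 S1 \<union> V m2 S2 = V m S" for m1 S1 m2 S2
  proof -
    obtain S1' S2' where "V m1 S1 = V (max m1 m2) S1'" "V m2 S2 = V (max m1 m2) S2'"
      using Vup[of m1 "max m1 m2" S1] Vup[of m2 "max m1 m2" S2] by auto
    then have "V m1 S1 \<union> V m2 S2 = V (max m1 m2) (S1' \<union> S2')" by (auto simp: V_def)
    then show ?thesis by blast
  qed
  define sd where "sd A V = (A - V) \<union> (V - A)" for A V :: "'x set"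
  have sdb [measurable]: "A \<in> sets borel \<Longrightarrow> C \<in> sets borel \<Longrightarrow> sd A C \<in> sets borel" for A C
    unfolding sd_def by auto
  \<comment> \<open>The good sets: the Borel sets that finite words approximate in measure.\<close>
  define apx where "apx A \<longleftrightarrow> A \<in> sets borel \<and> (\<forall>e>0. \<exists>m S. measure \<mu> (sd A (V m S)) < e)" for A
  have apx_borel: "apx A \<Longrightarrow> A \<in> sets borel" for A by (simp add: apx_def)
  have apx_V: "apx (V m S)" for m S
    unfolding apx_def using Vb by (auto intro!: exI[of _ m] exI[of _ S] simp: sd_def)
  have apx_compl: "apx (- A)" if apA: "apx A" for A
    unfolding apx_def
  proof (intro conjI allI impI)
    show "- A \<in> sets borel" using apA by (auto simp: apx_def intro: borel_comp)
    fix e :: real assume "0 < e"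
    then obtain m S where "measure \<mu> (sd A (V m S)) < e" using apA by (auto simp: apx_def)
    moreover have "sd (- A) (V m (- S)) = sd A (V m S)" by (auto simp: sd_def V_def)
    ultimately show "\<exists>m S. measure \<mu> (sd (- A) (V m S)) < e" by metis
  qed
  have apx_un: "apx (A \<union> A')" if apA: "apx A" "apx A'" for A A'
    unfolding apx_def
  proof (intro conjI allI impI)
    show "A \<union> A' \<in> sets borel" using apA by (auto simp: apx_def)
    fix e :: real assume "0 < e"
    then obtain m S m' S' where 1: "measure \<mu> (sd A (V m S)) < e / 2" "measure \<mu> (sd A' (V m' S')) < e / 2"
      using apA unfolding apx_def by (meson half_gt_zero)
    obtain n T where nT: "V m S \<union> V m' S' = V n T" using Vun by blast
    have "measure \<mu> (sd (A \<union> A') (V n T)) \<le> measure \<mu> (sd A (V m S) \<union> sd A' (V m' S'))"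
      unfolding nT[symmetric] using apA[THEN apx_borel] sets
      by (intro finite_measure_mono) (auto simp: sd_def)
    also have "\<dots> \<le> measure \<mu> (sd A (V m S)) + measure \<mu> (sd A' (V m' S'))"
      using apA[THEN apx_borel] sets by (intro measure_Un_le) (auto simp: sd_def)
    finally show "\<exists>m S. measure \<mu> (sd (A \<union> A') (V m S)) < e" using 1 by (intro exI[of _ n] exI[of _ T]) simp
  qed
  \<comment> \<open>A finite subunion uses up one half of the error, its approximating word set the
    other half.\<close>
  have apx_UN: "apx (\<Union>i. A i)" if A: "\<And>i::nat. apx (A i)" for A
    unfolding apx_def
  proof (intro conjI allI impI)
    have Ab: "A i \<in> sets borel" for i using A by (rule apx_borel)
    then show Ub: "(\<Union>i. A i) \<in> sets borel" by auto
    fix e :: real assume e: "0 < e"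
    define C where "C n = (\<Union>i\<le>n. A i)" for n
    have apxC: "apx (C n)" for n
      by (induction n) (auto simp: C_def atMost_Suc intro!: A apx_un)
    have Cb: "C n \<in> sets borel" for n using apxC by (rule apx_borel)
    have "(\<lambda>n. measure \<mu> (C n)) \<longlonglongrightarrow> measure \<mu> (\<Union>n. C n)"
    proof (rule finite_Lim_measure_incseq)
      show "incseq C" unfolding C_def by (intro incseq_SucI UN_mono) auto
    qed (use Cb sets in auto)
    moreover have "(\<Union>n. C n) = (\<Union>i. A i)" by (auto simp: C_def)
    ultimately have "\<forall>\<^sub>F n in sequentially. measure \<mu> (\<Union>i. A i) - e / 2 < measure \<mu> (C n)"
      using e by (intro order_tendstoD(1)[where y = "measure \<mu> (\<Union>i. A i)"]) auto
    then obtain n where n: "measure \<mu> (\<Union>i. A i) - e / 2 < measure \<mu> (C n)" by (auto simp: eventually_sequentially)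
    obtain m S where mS: "measure \<mu> (sd (C n) (V m S)) < e / 2"
      using apxC[of n] e unfolding apx_def by (meson half_gt_zero)
    have sub: "C n \<subseteq> (\<Union>i. A i)" by (auto simp: C_def)
    have "measure \<mu> (sd (\<Union>i. A i) (V m S)) \<le> measure \<mu> (((\<Union>i. A i) - C n) \<union> sd (C n) (V m S))"
      using sub Ub Cb sets by (intro finite_measure_mono) (auto simp: sd_def)
    also have "\<dots> \<le> measure \<mu> ((\<Union>i. A i) - C n) + measure \<mu> (sd (C n) (V m S))"
      using Ub Cb sets by (intro measure_Un_le) (auto simp: sd_def)
    also have "measure \<mu> ((\<Union>i. A i) - C n) = measure \<mu> (\<Union>i. A i) - measure \<mu> (C n)"
      using sub Ub Cb sets by (intro finite_measure_Diff) auto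
    finally show "\<exists>m S. measure \<mu> (sd (\<Union>i. A i) (V m S)) < e" using n mS by (intro exI[of _ m] exI[of _ S]) simp
  qed
  have apx_null: "apx A'" if A: "apx A" and A'b: "A' \<in> sets borel" and ae: "AE x in \<mu>. x \<in> A \<longleftrightarrow> x \<in> A'" for A A'
    unfolding apx_def
  proof (intro conjI allI impI A'b)
    fix e :: real assume "0 < e"
    then obtain m S where mS: "measure \<mu> (sd A (V m S)) < e" using A by (auto simp: apx_def)
    have "measure \<mu> (sd A' (V m S)) = measure \<mu> (sd A (V m S))"
    proof (rule measure_eq_AE)
      show "AE x in \<mu>. x \<in> sd A' (V m S) \<longleftrightarrow> x \<in> sd A (V m S)"
        using ae by eventually_elim (auto simp: sd_def)
    qed (use A'b apx_borel[OF A] sets in \<open>auto simp: sd_def\<close>)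
    then show "\<exists>m S. measure \<mu> (sd A' (V m S)) < e" using mS by metis
  qed
  interpret S: sigma_algebra UNIV "Collect apx"
  proof (rule sigma_algebra_iff2[THEN iffD2], intro conjI allI ballI impI)
    show "{} \<in> Collect apx" using apx_V[of 0 "{}"] by (simp add: V_def)
  qed (use apx_compl apx_UN in \<open>auto simp: Compl_eq_Diff_UNIV[symmetric] image_subset_iff\<close>)
  define \<SS> where "\<SS> = sigma UNIV (Collect apx)"
  have sS: "sets \<SS> = Collect apx" "space \<SS> = UNIV"
    unfolding \<SS>_def by (auto simp: S.sigma_sets_eq)
  have BS: "B \<in> \<SS> \<rightarrow>\<^sub>M coins"
  proof (rule measurable_PiM_single')
    fix k
    have "(\<lambda>x. B x k) \<in> \<SS> \<rightarrow>\<^sub>M count_space UNIV"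
    proof (rule measurable_count_space_eq2_countable[THEN iffD2], intro conjI ballI)
      fix b
      have "(\<lambda>x. B x k) -` {b} = V (Suc k) {l. l ! k = b}" by (auto simp: V_def nth_append)
      then show "(\<lambda>x. B x k) -` {b} \<inter> space \<SS> \<in> sets \<SS>" using apx_V by (simp add: sS)
    qed auto
    then show "(\<lambda>x. B x k) \<in> \<SS> \<rightarrow>\<^sub>M coin" by (simp cong: measurable_cong_sets)
  qed auto
  have binS: "(\<lambda>x. bin (B x)) \<in> \<SS> \<rightarrow>\<^sub>M borel" by (rule measurable_compose[OF BS measurable_bin])
  \<comment> \<open>Up to a null set \<open>g0 x \<le> s\<close> is the event
    \<open>bin (B x) \<le> F s\<close>, by the last property of \<open>F\<close>.\<close>
  have g0S: "g0 \<in> \<SS> \<rightarrow>\<^sub>M borel"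
  proof (rule borel_measurableI_le)
    fix s
    have "(\<lambda>x. bin (B x)) -` {..F s} \<inter> space \<SS> \<in> sets \<SS>" by (rule measurable_sets[OF binS]) simp
    then have 1: "apx {x. bin (B x) \<le> F s}" by (simp add: sS vimage_def)
    have "{x \<in> space borel. g0 x \<le> s} \<in> sets borel" by measurable
    then have "apx {x. g0 x \<le> s}"
      by (intro apx_null[OF 1]) (use binB F(3)[of s] in \<open>auto elim!: AE_mp[rotated 1] simp: eventually_mono\<close>)
    then show "{x \<in> space \<SS>. g0 x \<le> s} \<in> sets \<SS>" by (simp add: sS)
  qed
  have apxA: "apx (A k)" for k
  proof -
    have "(\<lambda>x. \<lfloor>4 ^ Suc k * g0 x\<rfloor>) \<in> \<SS> \<rightarrow>\<^sub>M count_space UNIV" using g0S by measurable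
    then have "(\<lambda>x. \<lfloor>4 ^ Suc k * g0 x\<rfloor>) -` {n. odd n} \<inter> space \<SS> \<in> sets \<SS>" by (rule measurable_sets) simp
    moreover have "(\<lambda>x. \<lfloor>4 ^ Suc k * g0 x\<rfloor>) -` {n. odd n} \<inter> space \<SS> = A k" using g0d by (auto simp: sS)
    ultimately show ?thesis by (simp add: sS)
  qed
  \<comment> \<open>On \<open>Z\<close> an open set agrees with the union of the coded balls that it
    contains.\<close>
  have apxU: "apx U" if "open U" for U
  proof (rule apx_null)
    show "apx (\<Union>k. if A k \<subseteq> U then A k else {})"
      by (intro apx_UN) (use apxA apx_V[of 0 "{}"] in \<open>auto simp: V_def\<close>)
    show "U \<in> sets borel" using that by simp
    show "AE x in \<mu>. x \<in> (\<Union>k. if A k \<subseteq> U then A k else {}) \<longleftrightarrow> x \<in> U"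
      using AEZ
    proof eventually_elim
      case (elim x)
      show ?case using Aopen[OF that _ elim] by (fastforce split: if_splits)
    qed
  qed
  have "apx A" if "A \<in> sets borel" for A
  proof -
    have "sigma_sets UNIV {U. open U} \<subseteq> Collect apx" by (rule S.sigma_sets_subset) (use apxU in auto)
    then show ?thesis using that by (auto simp: borel_def)
  qed
  then show thesis
    by (intro that[OF Bm Bd]) (auto simp: apx_def sd_def V_def)
qed

section \<open>Strongly measurable maps\<close>

text \<open>With a fixed second entry the pairing is continuous in the first; a countably valued
  second entry patches countably many such maps, and limits of Borel maps into a metric space are
  Borel.\<close>

lemma smeas_pair:
  fixes f :: "'m \<Rightarrow> 'a::metric_space" and S :: "'m \<Rightarrow> 'b::metric_space"
  assumes f: "f \<in> M \<rightarrow>\<^sub>M borel" and S: "smeas M S"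
  shows "(\<lambda>x. (f x, S x)) \<in> M \<rightarrow>\<^sub>M borel"
proof -
  obtain s where s: "\<And>k::nat. s k \<in> M \<rightarrow>\<^sub>M count_space UNIV" "\<And>k. countable (s k ` space M)"
    "\<And>x. x \<in> space M \<Longrightarrow> (\<lambda>k. s k x) \<longlonglongrightarrow> S x"
    using S by (auto simp: smeas_def)
  have "(\<lambda>x. (f x, s k x)) \<in> M \<rightarrow>\<^sub>M borel" for k
  proof (rule measurable_compose_countable'[where f="\<lambda>i x. (f x, i)" and g="s k" and I="s k ` space M"])
    show "(\<lambda>x. (f x, i)) \<in> M \<rightarrow>\<^sub>M borel" for i
      by (rule measurable_compose[OF f]) (intro borel_measurable_continuous_onI continuous_intros)
    show "s k \<in> M \<rightarrow>\<^sub>M count_space (s k ` space M)"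
      using measurable_sets[OF s(1)[of k]] by (intro measurableI) auto
  qed (rule s(2))
  then show ?thesis
    by (rule borel_measurable_LIMSEQ_metric[where f="\<lambda>k x. (f x, s k x)"]) (intro tendsto_Pair tendsto_const s)
qed

lemma smeas_compose:
  assumes "u \<in> M \<rightarrow>\<^sub>M N" "smeas N S"
  shows "smeas M (\<lambda>x. S (u x))"
proof -
  obtain s where s: "\<And>k::nat. s k \<in> N \<rightarrow>\<^sub>M count_space UNIV" "\<And>k. countable (s k ` space N)"
    "\<And>x. x \<in> space N \<Longrightarrow> (\<lambda>k. s k x) \<longlonglongrightarrow> S x"
    using assms(2) by (auto simp: smeas_def)
  have sp: "u x \<in> space N" if "x \<in> space M" for x using measurable_space[OF assms(1) that] .
  show ?thesis unfolding smeas_def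
  proof (intro exI[of _ "\<lambda>k x. s k (u x)"] conjI allI ballI)
    fix k
    show "(\<lambda>x. s k (u x)) \<in> M \<rightarrow>\<^sub>M count_space UNIV" by (rule measurable_compose[OF assms(1) s(1)])
    have "(\<lambda>x. s k (u x)) ` space M \<subseteq> s k ` space N" using sp by auto
    then show "countable ((\<lambda>x. s k (u x)) ` space M)" using s(2) countable_subset by blast
  qed (use s(3) sp in auto)
qed

lemma smeas_measurable:
  assumes "smeas M S" shows "S \<in> M \<rightarrow>\<^sub>M borel"
proof -
  have "(\<lambda>x. (0::real, S x)) \<in> M \<rightarrow>\<^sub>M borel" by (rule smeas_pair[OF _ assms]) simp
  from measurable_compose[OF this borel_measurable_continuous_onI[OF continuous_on_snd[OF continuous_on_id]]]
  show ?thesis by simp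
qed

lemma smeas_dist:
  assumes "smeas M S" "smeas M S'"
  shows "(\<lambda>x. dist (S x) (S' x)) \<in> borel_measurable M"
proof -
  have "(\<lambda>x. (S x, S' x)) \<in> M \<rightarrow>\<^sub>M borel"
    by (rule smeas_pair[OF smeas_measurable[OF assms(1)] assms(2)])
  moreover have "(\<lambda>p. dist (fst p) (snd p)) \<in> borel_measurable borel"
    by (intro borel_measurable_continuous_onI continuous_intros)
  ultimately have "(\<lambda>x. dist (fst (S x, S' x)) (snd (S x, S' x))) \<in> borel_measurable M"
    by (rule measurable_compose)
  then show ?thesis by simp
qed

section \<open>Compactness, weak limits, quantiles and finite tables\<close>

lemma compact_uniform_near:
  fixes f :: "'a::metric_space \<Rightarrow> real"
  assumes f: "continuous_on UNIV f" and K: "compact K" and e: "0 < e"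
  obtains d where "0 < d" "\<And>p q. p \<in> K \<Longrightarrow> dist q p < d \<Longrightarrow> \<bar>f q - f p\<bar> < e"
proof -
  have "\<forall>x\<in>K. \<exists>d>0. \<forall>y. dist y x < d \<longrightarrow> \<bar>f y - f x\<bar> < e / 2"
  proof
    fix x
    have "\<exists>d>0. \<forall>y\<in>UNIV. dist y x < d \<longrightarrow> dist (f y) (f x) < e / 2"
      using f[unfolded continuous_on_iff, rule_format, of x "e / 2"] e by auto
    then show "\<exists>d>0. \<forall>y. dist y x < d \<longrightarrow> \<bar>f y - f x\<bar> < e / 2" by (simp add: dist_real_def)
  qed
  then obtain d where d: "\<And>x. x \<in> K \<Longrightarrow> 0 < d x" "\<And>x y. x \<in> K \<Longrightarrow> dist y x < d x \<Longrightarrow> \<bar>f y - f x\<bar> < e / 2"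
    by metis
  \<comment> \<open>A Lebesgue number of the cover. Since \<open>q\<close> may lie outside
    \<open>K\<close>, uniform continuity of \<open>f\<close> on \<open>K\<close> would not be
    enough.\<close>
  obtain r where r: "0 < r" "\<And>x. x \<in> K \<Longrightarrow> \<exists>G\<in>(\<lambda>x. ball x (d x)) ` K. ball x r \<subseteq> G"
    by (rule Heine_Borel_lemma[OF K, of "(\<lambda>x. ball x (d x)) ` K"]) (use d(1) in auto)
  show thesis
  proof (rule that[OF r(1)])
    fix p q assume p: "p \<in> K" "dist q p < r"
    obtain x where x: "x \<in> K" "ball p r \<subseteq> ball x (d x)" using r(2)[OF p(1)] by auto
    have "p \<in> ball x (d x)" "q \<in> ball x (d x)" using x p r(1) by (auto simp: dist_commute subset_iff)
    then have "\<bar>f p - f x\<bar> < e / 2" "\<bar>f q - f x\<bar> < e / 2" using d(2)[OF x(1)] by (auto simp: dist_commute)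
    then show "\<bar>f q - f p\<bar> < e" by linarith
  qed
qed

lemma weak_topology_seq:
  assumes c: "continuous_map euclidean weak_topology \<nu>" and u: "u \<longlonglongrightarrow> t"
    and r: "\<And>t. \<nu> t \<in> radon_probs"
  shows "weakconv (\<lambda>n. \<nu> (u n)) (\<nu> t)"
  unfolding weakconv_def
proof (intro allI impI)
  fix f :: "'b \<Rightarrow> real" assume f: "continuous_on UNIV f" "bounded (range f)"
  show "(\<lambda>n. \<integral>x. f x \<partial>\<nu> (u n)) \<longlonglongrightarrow> (\<integral>x. f x \<partial>\<nu> t)"
  proof (rule LIMSEQ_I)
    fix e :: real assume e: "0 < e"
    define W where "W = {N \<in> radon_probs. \<bar>(\<integral>x. f x \<partial>N) - (\<integral>x. f x \<partial>\<nu> t)\<bar> < e}"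
    have "openin weak_topology W"
      unfolding weak_topology_def W_def
      by (rule topology_generated_by_Basis) (use f e r in blast)
    then have "openin euclidean {s. \<nu> s \<in> W}"
      using openin_continuous_map_preimage[OF c] by simp
    then have "open {s. \<nu> s \<in> W}" by simp
    moreover have "t \<in> {s. \<nu> s \<in> W}" using e r by (simp add: W_def)
    ultimately have "\<forall>\<^sub>F n in sequentially. u n \<in> {s. \<nu> s \<in> W}" using topological_tendstoD[OF u] by blast
    then show "\<exists>no. \<forall>n\<ge>no. norm ((\<integral>x. f x \<partial>\<nu> (u n)) - (\<integral>x. f x \<partial>\<nu> t)) < e"
      by (auto simp: W_def eventually_sequentially)
  qed
qed

text \<open>\<open>I\<close> is the quantile function of \<open>M\<close>. It is only controlled on
  the open unit interval; the default value 0 of \<open>q\<close> matters only on a null set of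
  \<open>unif\<close>.\<close>

lemma real_distribution_as_image_of_unif:
  assumes "real_distribution M"
  obtains q where "q \<in> borel_measurable borel" "distr unif borel q = M"
proof -
  interpret cdf_distribution M using assms by (simp add: cdf_distribution_def)
  define q where "q v = (if v \<in> {0<..<1} then I v else 0)" for v
  have Im: "I \<in> borel_measurable (restrict_space borel {0<..<1})"
    using measurable_CI by (simp cong: measurable_cong_sets add: sets_restrict_space)
  have qm: "q \<in> borel_measurable borel"
  proof -
    have "q = (\<lambda>x. indicator {0<..<1} x *\<^sub>R I x)" by (auto simp: q_def fun_eq_iff indicator_def)
    then show ?thesis using Im by (subst (asm) borel_measurable_restrict_space_iff) auto
  qed
  have "distr unif borel q = distr (restrict_space lborel {0<..<1}) borel I"
  proof (rule measure_eqI)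
    fix A assume "A \<in> sets (distr unif borel q)"
    then have A: "A \<in> sets borel" by simp
    have "emeasure (distr unif borel q) A = emeasure unif (q -` A)"
      using qm A by (subst emeasure_distr) auto
    also have "\<dots> = emeasure lborel ({0..<1} \<inter> q -` A)"
      using measurable_sets[OF qm A] by (subst emeasure_unif) auto
    also have "\<dots> = emeasure lborel ({0<..<1} \<inter> q -` A)"
    proof (rule emeasure_eq_AE)
      have "AE x in lborel. x \<noteq> (0::real)" using AE_lborel_singleton[of 0] .
      then show "AE x in lborel. x \<in> {0..<1} \<inter> q -` A \<longleftrightarrow> x \<in> {0<..<1} \<inter> q -` A"
        by eventually_elim auto
    qed (use measurable_sets[OF qm A] in auto)
    also have "{0<..<1} \<inter> q -` A = I -` A \<inter> {0<..<1}" by (auto simp: q_def)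
    also have "emeasure lborel \<dots> = emeasure (restrict_space lborel {0<..<1}) (I -` A \<inter> {0<..<1})"
      by (subst emeasure_restrict_space) auto
    also have "\<dots> = emeasure (distr (restrict_space lborel {0<..<1}) borel I) A"
      using A measurable_CI by (subst emeasure_distr) (auto simp: space_restrict_space cong: measurable_cong_sets)
    finally show "emeasure (distr unif borel q) A = emeasure (distr (restrict_space lborel {0<..<1}) borel I) A" .
  qed simp
  then show thesis using that[OF qm] distr_I_eq_M by simp
qed

text \<open>The table of joint masses is realised by reweighting the uniform law: given
  \<open>w\<close>, the classes of \<open>jj\<close> get the conditional probabilities of row
  \<open>w\<close>, and inside each class the law stays uniform. The column condition makes the
  mixture of the rows uniform again.\<close>

lemma finite_table_kernel:
  fixes jj :: "real \<Rightarrow> 'q" and s :: "'w \<Rightarrow> 'q \<Rightarrow> real"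
  assumes jj: "jj \<in> borel \<rightarrow>\<^sub>M count_space UNIV" and Q: "finite Q" "range jj \<subseteq> Q" and W: "finite W"
    and s0: "\<And>w q. 0 \<le> s w q"
    and col: "\<And>q. q \<in> Q \<Longrightarrow> (\<Sum>w\<in>W. s w q) = measure unif (jj -` {q})"
  obtains L where "\<And>w. w \<in> W \<Longrightarrow> real_distribution (L w)"
    "\<And>w q. w \<in> W \<Longrightarrow> q \<in> Q \<Longrightarrow> (\<Sum>q\<in>Q. s w q) * measure (L w) (jj -` {q}) = s w q"
    "\<And>A. A \<in> sets borel \<Longrightarrow> (\<Sum>w\<in>W. (\<Sum>q\<in>Q. s w q) * measure (L w) A) = measure unif A"
proof -
  interpret U: prob_space unif by (rule prob_space_unif)
  define p where "p w = (\<Sum>q\<in>Q. s w q)" for w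
  define r where "r q = measure unif (jj -` {q})" for q
  define f where "f w v = s w (jj v) / (p w * r (jj v))" for w v
  \<comment> \<open>A row of total mass 0 leaves the choice of its law free.\<close>
  define L where "L w = (if p w = 0 then unif else density unif (\<lambda>v. ennreal (f w v)))" for w
  have jb: "jj -` {q} \<in> sets borel" for q using measurable_sets[OF jj, of "{q}"] by simp
  have p0: "0 \<le> p w" for w unfolding p_def by (intro sum_nonneg s0)
  have r0: "0 \<le> r q" for q by (simp add: r_def)
  have fm: "f w \<in> borel_measurable borel" for w
    unfolding f_def by (rule measurable_compose[OF jj, where g="\<lambda>q. s w q / (p w * r q)"]) simp
  have f0: "0 \<le> f w v" for w v unfolding f_def using s0 p0 r0 by simp
  \<comment> \<open>An entry is at most its column sum, so it vanishes where the density divides by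
    0.\<close>
  have sle: "s w q \<le> r q" if "w \<in> W" "q \<in> Q" for w q
    using member_le_sum[OF that(1), of "\<lambda>w. s w q"] s0 W col[OF that(2)] by (simp add: r_def)
  have dens: "emeasure (density unif (\<lambda>v. ennreal (f w v))) A
      = ennreal (\<Sum>q\<in>Q. s w q / (p w * r q) * measure unif (jj -` {q} \<inter> A))" if A: "A \<in> sets borel" for w A
  proof -
    have "emeasure (density unif (\<lambda>v. ennreal (f w v))) A = (\<integral>\<^sup>+v. ennreal (f w v) * indicator A v \<partial>unif)"
      by (rule emeasure_density) (use fm A in auto)
    also have "\<dots> = (\<integral>\<^sup>+v. (\<Sum>q\<in>Q. ennreal (s w q / (p w * r q)) * indicator (jj -` {q} \<inter> A) v) \<partial>unif)"
    proof (rule nn_integral_cong)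
      fix v
      have "(\<Sum>q\<in>Q. ennreal (s w q / (p w * r q)) * indicator (jj -` {q} \<inter> A) v)
        = (\<Sum>q\<in>{jj v}. ennreal (s w q / (p w * r q)) * indicator (jj -` {q} \<inter> A) v)"
        using Q by (intro sum.mono_neutral_right) (auto simp: indicator_def)
      then show "ennreal (f w v) * indicator A v = (\<Sum>q\<in>Q. ennreal (s w q / (p w * r q)) * indicator (jj -` {q} \<inter> A) v)"
        by (simp add: f_def indicator_def)
    qed
    also have "\<dots> = (\<Sum>q\<in>Q. \<integral>\<^sup>+v. ennreal (s w q / (p w * r q)) * indicator (jj -` {q} \<inter> A) v \<partial>unif)"
      using jb A by (intro nn_integral_sum) auto
    also have "\<dots> = (\<Sum>q\<in>Q. ennreal (s w q / (p w * r q) * measure unif (jj -` {q} \<inter> A)))"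
    proof (rule sum.cong[OF refl])
      fix q
      have "jj -` {q} \<inter> A \<in> sets unif" using jb A by auto
      then have "(\<integral>\<^sup>+v. ennreal (s w q / (p w * r q)) * indicator (jj -` {q} \<inter> A) v \<partial>unif)
        = ennreal (s w q / (p w * r q)) * emeasure unif (jj -` {q} \<inter> A)" by (rule nn_integral_cmult_indicator)
      also have "\<dots> = ennreal (s w q / (p w * r q) * measure unif (jj -` {q} \<inter> A))"
        unfolding U.emeasure_eq_measure using s0 p0 r0 by (intro ennreal_mult[symmetric]) auto
      finally show "(\<integral>\<^sup>+v. ennreal (s w q / (p w * r q)) * indicator (jj -` {q} \<inter> A) v \<partial>unif)
        = ennreal (s w q / (p w * r q) * measure unif (jj -` {q} \<inter> A))" .
    qed
    also have "\<dots> = ennreal (\<Sum>q\<in>Q. s w q / (p w * r q) * measure unif (jj -` {q} \<inter> A))"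
      using s0 p0 r0 by (intro sum_ennreal) auto
    finally show ?thesis .
  qed
  have nn: "0 \<le> (\<Sum>q\<in>Q. s w q / (p w * r q) * measure unif (jj -` {q} \<inter> A))" for w A
    using s0 p0 r0 by (intro sum_nonneg) auto
  have densm: "measure (density unif (\<lambda>v. ennreal (f w v))) A
      = (\<Sum>q\<in>Q. s w q / (p w * r q) * measure unif (jj -` {q} \<inter> A))" if A: "A \<in> sets borel" for w A
    unfolding measure_def dens[OF A] using nn by (simp add: measure_def[symmetric])
  have canc: "s w q / (p w * r q) * r q = s w q / p w" if "w \<in> W" "q \<in> Q" for w q
    using sle[OF that] s0[of w q] by (cases "r q = 0") auto
  have pL: "p w * measure (L w) A = (\<Sum>q\<in>Q. s w q / r q * measure unif (jj -` {q} \<inter> A))"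
    if A: "A \<in> sets borel" and w: "w \<in> W" for A w
  proof (cases "p w = 0")
    case True
    then have "s w q = 0" if "q \<in> Q" for q using s0 Q that by (simp add: p_def sum_nonneg_eq_0_iff)
    then show ?thesis using True by simp
  next
    case False
    then show ?thesis by (simp add: L_def densm[OF A] sum_distrib_left mult.assoc[symmetric])
  qed
  show thesis
  proof (rule that[of L])
    fix w assume w: "w \<in> W"
    show "real_distribution (L w)"
    proof (cases "p w = 0")
      case True
      then show ?thesis using prob_space_unif by (simp add: L_def real_distribution_def real_distribution_axioms_def)
    next
      case False
      have "(\<Sum>q\<in>Q. s w q / (p w * r q) * measure unif (jj -` {q} \<inter> UNIV)) = (\<Sum>q\<in>Q. s w q / p w)"
        using canc[OF w] by (intro sum.cong) (auto simp: r_def)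
      also have "\<dots> = 1" using False by (simp add: sum_divide_distrib[symmetric] p_def)
      finally have "emeasure (density unif (\<lambda>v. ennreal (f w v))) UNIV = 1" using dens[of UNIV w] by simp
      then have "prob_space (density unif (\<lambda>v. ennreal (f w v)))" by (intro prob_spaceI) simp
      then show ?thesis using False by (simp add: L_def real_distribution_def real_distribution_axioms_def)
    qed
    fix q assume q: "q \<in> Q"
    have "p w * measure (L w) (jj -` {q}) = (\<Sum>q'\<in>Q. s w q' / r q' * measure unif (jj -` {q'} \<inter> jj -` {q}))"
      by (rule pL[OF jb w])
    also have "\<dots> = (\<Sum>q'\<in>{q}. s w q' / r q' * measure unif (jj -` {q'} \<inter> jj -` {q}))"
    proof (rule sum.mono_neutral_right)
      show "\<forall>i\<in>Q - {q}. s w i / r i * measure unif (jj -` {i} \<inter> jj -` {q}) = 0"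
      proof
        fix i assume "i \<in> Q - {q}"
        then have "jj -` {i} \<inter> jj -` {q} = {}" by auto
        then show "s w i / r i * measure unif (jj -` {i} \<inter> jj -` {q}) = 0" by (simp only: measure_empty mult_zero_right)
      qed
    qed (use q Q in auto)
    also have "\<dots> = s w q / r q * r q" by (simp add: r_def)
    also have "\<dots> = s w q" using sle[OF w q] s0[of w q] by (cases "r q = 0") auto
    finally show "(\<Sum>q\<in>Q. s w q) * measure (L w) (jj -` {q}) = s w q" by (simp add: p_def)
  next
    fix A :: "real set" assume A: "A \<in> sets borel"
    have "(\<Sum>w\<in>W. p w * measure (L w) A) = (\<Sum>w\<in>W. \<Sum>q\<in>Q. s w q / r q * measure unif (jj -` {q} \<inter> A))"
      using pL[OF A] by (intro sum.cong) auto
    also have "\<dots> = (\<Sum>q\<in>Q. \<Sum>w\<in>W. s w q / r q * measure unif (jj -` {q} \<inter> A))" by (rule sum.swap)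
    also have "\<dots> = (\<Sum>q\<in>Q. measure unif (jj -` {q} \<inter> A))"
    proof (rule sum.cong[OF refl])
      fix q assume q: "q \<in> Q"
      have "(\<Sum>w\<in>W. s w q / r q * measure unif (jj -` {q} \<inter> A)) = r q / r q * measure unif (jj -` {q} \<inter> A)"
        using col[OF q] by (simp add: sum_distrib_right[symmetric] sum_divide_distrib[symmetric] r_def)
      also have "\<dots> = measure unif (jj -` {q} \<inter> A)"
      proof (cases "r q = 0")
        case True
        have "measure unif (jj -` {q} \<inter> A) \<le> r q" unfolding r_def using jb by (intro U.finite_measure_mono) auto
        then have "measure unif (jj -` {q} \<inter> A) = 0" using True measure_nonneg[of unif "jj -` {q} \<inter> A"] by linarith
        then show ?thesis by simp
      qed simp
      finally show "(\<Sum>w\<in>W. s w q / r q * measure unif (jj -` {q} \<inter> A)) = measure unif (jj -` {q} \<inter> A)" .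
    qed
    also have "\<dots> = measure unif (\<Union>q\<in>Q. jj -` {q} \<inter> A)"
      using Q jb A by (intro U.finite_measure_finite_Union[symmetric]) (auto simp: disjoint_family_on_def)
    also have "(\<Union>q\<in>Q. jj -` {q} \<inter> A) = A" using Q by auto
    finally show "(\<Sum>w\<in>W. (\<Sum>q\<in>Q. s w q) * measure (L w) A) = measure unif A" by (simp add: p_def)
  qed
qed

section \<open>Bits on a probability space\<close>

locale bits =
  fixes \<mu> :: "'x::metric_space measure" and B :: "'x \<Rightarrow> nat \<Rightarrow> bool"
  assumes radon: "\<mu> \<in> radon_probs"
    and measurable_B: "B \<in> borel \<rightarrow>\<^sub>M coins" and distr_B: "distr \<mu> coins B = coins"
    and generating: "\<And>A e. A \<in> sets borel \<Longrightarrow> 0 < e \<Longrightarrow>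
      \<exists>m S. measure \<mu> ((A - {x. map (B x) [0..<m] \<in> S}) \<union> ({x. map (B x) [0..<m] \<in> S} - A)) < e"
begin

sublocale prob_space \<mu> using radon_probsD[OF radon] by simp

lemma sets_mu [measurable_cong]: "sets \<mu> = sets borel" and space_mu [simp]: "space \<mu> = UNIV"
  using radon_probsD[OF radon] by auto

definition word :: "nat \<Rightarrow> 'x \<Rightarrow> bool list" where
  "word m x = map (B x) [0..<m]"

definition \<F> :: "nat set \<Rightarrow> 'x measure" where
  "\<F> J = vimage_algebra UNIV (\<lambda>x. restrict (B x) J) (PiM J (\<lambda>_. coin))"

text \<open>These bits are reserved for the random choice of a plan. A plan of depth
  \<open>m\<close> may use the complement: the bits before \<open>m\<close> and all odd ones.
  Splitting by parity leaves infinitely many bits to both sides at every depth.\<close>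

definition tail :: "nat \<Rightarrow> nat set" where
  "tail m = {k. even k \<and> m \<le> k}"

lemma space_F [simp]: "space (\<F> J) = UNIV"
  by (simp add: \<F>_def)

lemma B_component: "(\<lambda>x. B x k) \<in> borel \<rightarrow>\<^sub>M coin"
  using measurable_compose[OF measurable_B measurable_component_singleton[of k UNIV "\<lambda>_. coin"]] by simp

lemma measurable_to_F:
  assumes "\<And>k. k \<in> J \<Longrightarrow> (\<lambda>x. B x k) \<in> M \<rightarrow>\<^sub>M coin"
  shows "(\<lambda>x. x) \<in> M \<rightarrow>\<^sub>M \<F> J"
  unfolding \<F>_def
proof (rule measurable_vimage_algebra2)
  show "(\<lambda>x. restrict (B x) J) \<in> M \<rightarrow>\<^sub>M PiM J (\<lambda>_. coin)"
    by (rule measurable_restrict) (rule assms)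
qed auto

lemma F_component:
  assumes "k \<in> J" shows "(\<lambda>x. B x k) \<in> \<F> J \<rightarrow>\<^sub>M coin"
proof -
  have "(\<lambda>x. restrict (B x) J) \<in> \<F> J \<rightarrow>\<^sub>M PiM J (\<lambda>_. coin)"
    unfolding \<F>_def by (rule measurable_vimage_algebra1) (auto simp: space_PiM)
  from measurable_compose[OF this measurable_component_singleton[OF assms]] show ?thesis using assms by simp
qed

lemma id_F_F: "J \<subseteq> J' \<Longrightarrow> (\<lambda>x. x) \<in> \<F> J' \<rightarrow>\<^sub>M \<F> J"
  by (rule measurable_to_F, rule F_component) auto

lemma id_borel_F: "(\<lambda>x. x) \<in> borel \<rightarrow>\<^sub>M \<F> J"
  by (rule measurable_to_F, rule B_component)

lemma F_mono: "J \<subseteq> J' \<Longrightarrow> f \<in> \<F> J \<rightarrow>\<^sub>M N \<Longrightarrow> f \<in> \<F> J' \<rightarrow>\<^sub>M N"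
  by (rule measurable_compose[OF id_F_F])

lemma F_borel: "f \<in> \<F> J \<rightarrow>\<^sub>M N \<Longrightarrow> f \<in> borel \<rightarrow>\<^sub>M N"
  by (rule measurable_compose[OF id_borel_F])

lemma F_sets_borel: "E \<in> sets (\<F> J) \<Longrightarrow> E \<in> sets borel"
  using measurable_sets[OF id_borel_F[of J], of E] by simp

lemma indep_F:
  assumes E: "E \<in> sets (\<F> J)" "A \<in> sets (\<F> J')" and d: "J \<inter> J' = {}"
  shows "measure \<mu> (E \<inter> A) = measure \<mu> E * measure \<mu> A"
proof -
  have comp: "distr \<mu> coin (\<lambda>x. B x k) = coin" for k
  proof -
    have "distr \<mu> coin (\<lambda>x. B x k) = distr (distr \<mu> coins B) coin (\<lambda>w. w k)"
      using measurable_B by (subst distr_distr) (auto simp: comp_def)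
    also have "\<dots> = coin" unfolding distr_B by (rule distr_PiM_component) (auto intro: prob_space_measure_pmf)
    finally show ?thesis .
  qed
  have iv: "indep_vars (\<lambda>_. coin) (\<lambda>k x. B x k) UNIV"
  proof (subst indep_vars_iff_distr_eq_PiM)
    show "random_variable coin (\<lambda>x. B x k)" for k using B_component by simp
    show "distr \<mu> coins (\<lambda>x. \<lambda>i\<in>UNIV. B x i) = (\<Pi>\<^sub>M i\<in>UNIV. distr \<mu> coin (\<lambda>x. B x i))"
      by (simp add: comp restrict_UNIV distr_B)
  qed auto
  have "indep_var (PiM J (\<lambda>_. coin)) (\<lambda>x. restrict (B x) J) (PiM J' (\<lambda>_. coin)) (\<lambda>x. restrict (B x) J')"
    using indep_var_restrict[OF iv d] by simp
  moreover obtain X where X: "X \<in> sets (PiM J (\<lambda>_. coin))" "E = (\<lambda>x. restrict (B x) J) -` X"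
    using E(1) unfolding \<F>_def by (auto simp: sets_vimage_algebra2 Pi_def space_PiM)
  moreover obtain Y where Y: "Y \<in> sets (PiM J' (\<lambda>_. coin))" "A = (\<lambda>x. restrict (B x) J') -` Y"
    using E(2) unfolding \<F>_def by (auto simp: sets_vimage_algebra2 Pi_def space_PiM)
  ultimately have "measure \<mu> ((\<lambda>x. (restrict (B x) J, restrict (B x) J')) -` (X \<times> Y) \<inter> space \<mu>) =
      measure \<mu> ((\<lambda>x. restrict (B x) J) -` X \<inter> space \<mu>) * measure \<mu> ((\<lambda>x. restrict (B x) J') -` Y \<inter> space \<mu>)"
    by (intro indep_varD)
  moreover have "(\<lambda>x. (restrict (B x) J, restrict (B x) J')) -` (X \<times> Y) = E \<inter> A" using X Y by auto
  ultimately show ?thesis using X Y by simp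
qed

text \<open>On the events of the bits in \<open>J'\<close>, restricting \<mu> to \<open>E\<close>
  amounts to multiplying it by the mass of \<open>E\<close>; integrating \<open>f\<close> against
  both measures gives the product formula.\<close>

lemma indep_F_nn_integral:
  assumes E: "E \<in> sets (\<F> J)" and f: "f \<in> borel_measurable (\<F> J')" and d: "J \<inter> J' = {}"
  shows "(\<integral>\<^sup>+x. indicator E x * f x \<partial>\<mu>) = emeasure \<mu> E * (\<integral>\<^sup>+x. f x \<partial>\<mu>)"
proof -
  have Eb: "E \<in> sets \<mu>" using F_sets_borel[OF E] by (simp add: sets_mu)
  have idm: "(\<lambda>x. x) \<in> \<mu> \<rightarrow>\<^sub>M \<F> J'" using id_borel_F by (simp cong: measurable_cong_sets)
  define \<rho> where "\<rho> = distr (density \<mu> (indicator E)) (\<F> J') (\<lambda>x. x)"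
  have idm': "(\<lambda>x. x) \<in> density \<mu> (indicator E) \<rightarrow>\<^sub>M \<F> J'" using idm by (simp cong: measurable_cong_sets)
  have "\<rho> = scale_measure (emeasure \<mu> E) (distr \<mu> (\<F> J') (\<lambda>x. x))"
  proof (rule measure_eqI)
    fix A assume "A \<in> sets \<rho>"
    then have A: "A \<in> sets (\<F> J')" by (simp add: \<rho>_def)
    have Ab: "A \<in> sets \<mu>" using F_sets_borel[OF A] by (simp add: sets_mu)
    have "emeasure \<rho> A = emeasure (density \<mu> (indicator E)) A"
      unfolding \<rho>_def using emeasure_distr[OF idm' A] by simp
    also have "\<dots> = emeasure \<mu> (E \<inter> A)"
      using Eb Ab by (subst emeasure_density) (auto simp: indicator_inter_arith[symmetric] nn_integral_indicator)
    also have "\<dots> = emeasure \<mu> E * emeasure \<mu> A"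
      using indep_F[OF E A d] by (simp add: emeasure_eq_measure ennreal_mult)
    also have "\<dots> = emeasure (scale_measure (emeasure \<mu> E) (distr \<mu> (\<F> J') (\<lambda>x. x))) A"
      using emeasure_distr[OF idm A] by simp
    finally show "emeasure \<rho> A = emeasure (scale_measure (emeasure \<mu> E) (distr \<mu> (\<F> J') (\<lambda>x. x))) A" .
  qed (simp add: \<rho>_def)
  moreover have fm: "f \<in> borel_measurable \<mu>" using measurable_compose[OF idm f] .
  have "(\<integral>\<^sup>+x. f x \<partial>\<rho>) = (\<integral>\<^sup>+x. indicator E x * f x \<partial>\<mu>)"
    unfolding \<rho>_def using Eb fm f by (subst nn_integral_distr[OF idm']) (auto simp: nn_integral_density)
  moreover have "(\<integral>\<^sup>+x. f x \<partial>scale_measure (emeasure \<mu> E) (distr \<mu> (\<F> J') (\<lambda>x. x))) = emeasure \<mu> E * (\<integral>\<^sup>+x. f x \<partial>\<mu>)"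
    using f by (subst nn_integral_scale_measure) (auto simp: nn_integral_distr[OF idm])
  ultimately show ?thesis by simp
qed

lemma measurable_word: "word m \<in> \<F> {..<m} \<rightarrow>\<^sub>M count_space UNIV"
proof -
  have "k \<le> m \<Longrightarrow> (\<lambda>x. map (B x) [0..<k]) \<in> \<F> {..<m} \<rightarrow>\<^sub>M count_space UNIV" for k
  proof (induction k)
    case (Suc k)
    have "(\<lambda>x. B x k) \<in> \<F> {..<m} \<rightarrow>\<^sub>M count_space UNIV"
      using F_component[of k "{..<m}"] Suc by (simp cong: measurable_cong_sets)
    moreover have "(\<lambda>p. fst p @ [snd p]) \<in> count_space UNIV \<Otimes>\<^sub>M count_space UNIV \<rightarrow>\<^sub>M count_space (UNIV :: bool list set)"
      by (simp add: pair_measure_countable)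
    ultimately show ?case
      using measurable_compose[OF measurable_Pair[OF Suc.IH, of "\<lambda>x. B x k" "count_space UNIV"]] Suc by fastforce
  qed simp
  from this[OF order_refl] show ?thesis by (simp add: word_def[abs_def])
qed

lemma measurable_bits_bin:
  assumes "range f \<subseteq> J"
  shows "(\<lambda>x. bin (\<lambda>n. B x (f n))) \<in> borel_measurable (\<F> J)"
proof (rule measurable_compose[OF _ measurable_bin])
  show "(\<lambda>x n. B x (f n)) \<in> \<F> J \<rightarrow>\<^sub>M coins"
  proof (rule measurable_PiM_single')
    fix n show "(\<lambda>x. B x (f n)) \<in> \<F> J \<rightarrow>\<^sub>M coin" by (rule F_component) (use assms in auto)
  qed auto
qed

lemma distr_bits_bin:
  assumes "inj f"
  shows "distr \<mu> borel (\<lambda>x. bin (\<lambda>n. B x (f n))) = unif"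
proof -
  have "(\<lambda>w n. w (f n)) \<in> coins \<rightarrow>\<^sub>M coins"
    by (rule measurable_PiM_single') (use measurable_component_singleton[of _ UNIV "\<lambda>_. coin"] in auto)
  then have m: "(\<lambda>w. bin (\<lambda>n. w (f n))) \<in> borel_measurable coins" by (rule measurable_compose) simp
  have "distr \<mu> borel (\<lambda>x. bin (\<lambda>n. B x (f n))) = distr (distr \<mu> coins B) borel (\<lambda>w. bin (\<lambda>n. w (f n)))"
    using measurable_B by (subst distr_distr[OF m]) (auto simp: comp_def)
  then show ?thesis by (simp add: distr_B distr_bin_reindex[OF assms])
qed

text \<open>Finitely many balls cover most of the mass, and each is nearly a word set. Off the
  errors the word tells which balls contain \<open>x\<close>, and \<open>c\<close> returns the
  centre of one of them.\<close>

lemma word_approximates_once: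
  assumes d: "0 < d" and k: "0 < k"
  shows "\<exists>m c. \<exists>N\<in>sets borel. measure \<mu> N \<le> k \<and> (\<forall>x. x \<notin> N \<longrightarrow> dist x (c (word m x)) < d)"
proof -
  obtain K where K: "compact K" "measure \<mu> (- K) < k / 2" using radon_compact[OF radon, of "k / 2"] k by auto
  obtain P where P: "finite P" "P \<subseteq> K" "K \<subseteq> (\<Union>x\<in>P. ball x d)"
  proof (rule compactE_image[OF K(1), of K "\<lambda>x. ball x d"])
    show "K \<subseteq> (\<Union>x\<in>K. ball x d)" using d by auto
  qed auto
  \<comment> \<open>The complement of \<open>K\<close> takes \<open>k / 2\<close>, and the
    \<open>card P\<close> approximation errors together at most \<open>k / 2\<close>; the 1 guards
    against an empty \<open>P\<close>.\<close>
  define e where "e = k / (2 * (real (card P) + 1))"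
  have e: "0 < e" using k by (simp add: e_def)
  define V where "V m S = {x. word m x \<in> S}" for m S
  define sd where "sd A C = (A - C) \<union> (C - A)" for A C :: "'x set"
  have "\<exists>m S. measure \<mu> (sd (ball p d) (V m S)) < e" for p
    using generating[of "ball p d" e] e by (simp add: V_def word_def sd_def)
  then obtain m S where mS: "\<And>p. measure \<mu> (sd (ball p d) (V (m p) (S p))) < e" by metis
  define n where "n = Max (insert 0 (m ` P))"
  have n: "m p \<le> n" if "p \<in> P" for p using P that by (auto simp: n_def)
  define c where "c w = (SOME p. p \<in> P \<and> take (m p) w \<in> S p)" for w
  define N where "N = - K \<union> (\<Union>p\<in>P. sd (ball p d) (V (m p) (S p)))"
  have Vb: "V i T \<in> sets borel" for i T
    using measurable_sets[OF F_borel[OF measurable_word[of i]], of T] by (simp add: V_def vimage_def)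
  have sdb: "sd (ball p d) (V i T) \<in> sets borel" for p i T using Vb by (auto simp: sd_def)
  have Kb: "- K \<in> sets borel" using K by (auto intro: borel_comp borel_compact)
  have Nb: "N \<in> sets borel" unfolding N_def using P by (intro sets.Un Kb sets.finite_UN sdb)
  have "measure \<mu> N \<le> measure \<mu> (- K) + measure \<mu> (\<Union>p\<in>P. sd (ball p d) (V (m p) (S p)))"
    unfolding N_def using Kb sdb P by (intro measure_Un_le) (auto simp: sets_mu)
  also have "measure \<mu> (\<Union>p\<in>P. sd (ball p d) (V (m p) (S p))) \<le> (\<Sum>p\<in>P. measure \<mu> (sd (ball p d) (V (m p) (S p))))"
    using P sdb by (intro measure_UNION_le) (auto simp: sets_mu)
  also have "\<dots> \<le> (\<Sum>p\<in>P. e)" using mS by (intro sum_mono less_imp_le)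
  also have "\<dots> \<le> k / 2" using k by (simp add: e_def field_simps)
  finally have Nk: "measure \<mu> N \<le> k" using K by simp
  have "dist x (c (word n x)) < d" if x: "x \<notin> N" for x
  proof -
    have tk: "take (m p) (word n x) = word (m p) x" if "p \<in> P" for p
      using n[OF that] by (simp add: word_def take_map)
    have iff: "x \<in> ball p d \<longleftrightarrow> take (m p) (word n x) \<in> S p" if "p \<in> P" for p
      using x that tk[OF that] by (auto simp: N_def sd_def V_def)
    have "x \<in> K" using x by (simp add: N_def)
    then obtain p where "p \<in> P" "x \<in> ball p d" using P by auto
    then have "\<exists>p. p \<in> P \<and> take (m p) (word n x) \<in> S p" using iff by auto
    then have "c (word n x) \<in> P \<and> take (m (c (word n x))) (word n x) \<in> S (c (word n x))"
      unfolding c_def by (rule someI_ex)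
    then have "x \<in> ball (c (word n x)) d" using iff by auto
    then show ?thesis by (simp add: dist_commute)
  qed
  then show ?thesis using Nb Nk by blast
qed

text \<open>Errors of geometric size yield one exceptional set for all scales \<open>d\<close>, so
  it can be fixed before any local plan is made; only the word length depends on
  \<open>d\<close>.\<close>

lemma word_approximates:
  assumes k: "0 < k"
  obtains N where "N \<in> sets borel" "measure \<mu> N \<le> k"
    "\<And>d. 0 < d \<Longrightarrow> \<exists>m c. \<forall>x. x \<notin> N \<longrightarrow> dist x (c (word m x)) < d"
proof -
  have "\<exists>N m c. N \<in> sets borel \<and> measure \<mu> N \<le> k * (1 / 2) ^ Suc n \<and> (\<forall>x. x \<notin> N \<longrightarrow> dist x (c (word m x)) < 1 / Suc n)" for n
    using word_approximates_once[of "1 / Suc n" "k * (1 / 2) ^ Suc n"] k by auto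
  then obtain N m c where N: "\<And>n. N n \<in> sets borel" "\<And>n. measure \<mu> (N n) \<le> k * (1 / 2) ^ Suc n"
    "\<And>n x. x \<notin> N n \<Longrightarrow> dist x (c n (word (m n) x)) < 1 / Suc n" by metis
  show thesis
  proof (rule that[of "\<Union>n. N n"])
    show "(\<Union>n. N n) \<in> sets borel" using N(1) by auto
    have ss: "(\<lambda>n. k * (1 / 2) ^ Suc n) sums k" using sums_mult[OF power_half_series, of k] by simp
    have sm: "summable (\<lambda>n. measure \<mu> (N n))"
      by (rule summable_comparison_test[OF _ sums_summable[OF ss]]) (use N(2) in auto)
    have "measure \<mu> (\<Union>n. N n) \<le> (\<Sum>n. measure \<mu> (N n))"
      using N(1) sm by (intro finite_measure_subadditive_countably) (auto simp: sets_mu)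
    also have "\<dots> \<le> (\<Sum>n. k * (1 / 2) ^ Suc n)"
      by (rule suminf_le[OF N(2) sm sums_summable[OF ss]])
    finally show "measure \<mu> (\<Union>n. N n) \<le> k" using ss by (simp add: sums_iff)
    fix d :: real assume "0 < d"
    then obtain n where n: "1 / Suc n < d" using nat_approx_posE by blast
    show "\<exists>m c. \<forall>x. x \<notin> (\<Union>n. N n) \<longrightarrow> dist x (c (word m x)) < d"
      using N(3)[of _ n] n by (intro exI[of _ "m n"] exI[of _ "c n"]) (auto intro: less_trans)
  qed
qed

section \<open>Uniform variables with a prescribed joint table\<close>

definition uniform_rv :: "('x \<Rightarrow> real) \<Rightarrow> bool" where
  "uniform_rv u \<longleftrightarrow> u \<in> borel \<rightarrow>\<^sub>M borel \<and> distr \<mu> borel u = unif"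

lemma uniform_rv_measure: "uniform_rv u \<Longrightarrow> A \<in> sets borel \<Longrightarrow> measure \<mu> {x. u x \<in> A} = measure unif A"
  using measure_distr[of u \<mu> borel A] by (simp add: uniform_rv_def vimage_def sets_mu cong: measurable_cong_sets)

lemma mpI:
  assumes u: "u \<in> borel \<rightarrow>\<^sub>M borel" and "\<And>A. A \<in> sets borel \<Longrightarrow> measure \<mu> {x. u x \<in> A} = measure unif A"
  shows "uniform_rv u"
proof -
  interpret U: prob_space unif by (rule prob_space_unif)
  have um: "u \<in> \<mu> \<rightarrow>\<^sub>M borel" using u by simp
  have "distr \<mu> borel u = unif"
  proof (rule measure_eqI)
    fix A assume "A \<in> sets (distr \<mu> borel u)"
    then have A: "A \<in> sets borel" by simp
    then show "emeasure (distr \<mu> borel u) A = emeasure unif A"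
      using assms(2)[OF A] um
      by (simp add: emeasure_distr emeasure_eq_measure U.emeasure_eq_measure vimage_def del: emeasure_uniform_measure)
  qed simp
  then show ?thesis using u by (simp add: uniform_rv_def)
qed

text \<open>On each cell of depth m, the odd bits beyond m drive a quantile transform.\<close>

lemma lift_table:
  fixes jj :: "real \<Rightarrow> 'q" and s :: "bool list \<Rightarrow> 'q \<Rightarrow> real"
  assumes jj: "jj \<in> borel \<rightarrow>\<^sub>M count_space UNIV" and Q: "finite Q" "range jj \<subseteq> Q"
    and s0: "\<And>w q. 0 \<le> s w q"
    and col: "\<And>q. q \<in> Q \<Longrightarrow> (\<Sum>w | length w = m. s w q) = measure unif (jj -` {q})"
    and row: "\<And>w. length w = m \<Longrightarrow> (\<Sum>q\<in>Q. s w q) = measure \<mu> {x. word m x = w}"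
  obtains u where "uniform_rv u" "u \<in> borel_measurable (\<F> (- tail m))"
    "\<And>w q. length w = m \<Longrightarrow> q \<in> Q \<Longrightarrow> measure \<mu> {x. word m x = w \<and> jj (u x) = q} = s w q"
proof -
  let ?W = "{w :: bool list. length w = m}"
  have W: "finite ?W" using finite_lists_length_eq[of "UNIV :: bool set" m] by simp
  obtain L where L: "\<And>w. w \<in> ?W \<Longrightarrow> real_distribution (L w)"
    "\<And>w q. w \<in> ?W \<Longrightarrow> q \<in> Q \<Longrightarrow> (\<Sum>q\<in>Q. s w q) * measure (L w) (jj -` {q}) = s w q"
    "\<And>A. A \<in> sets borel \<Longrightarrow> (\<Sum>w\<in>?W. (\<Sum>q\<in>Q. s w q) * measure (L w) A) = measure unif A"
    by (rule finite_table_kernel[OF jj Q W, of s]) (use s0 col in auto)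
  have "\<exists>q. w \<in> ?W \<longrightarrow> q \<in> borel_measurable borel \<and> distr unif borel q = L w" for w
    using real_distribution_as_image_of_unif[OF L(1), of w] by metis
  then obtain g0 where g0: "\<And>w. w \<in> ?W \<Longrightarrow> g0 w \<in> borel_measurable borel \<and> distr unif borel (g0 w) = L w" by metis
  \<comment> \<open>Words of other lengths do not occur, but the measurability of \<open>u\<close>
    is checked for every \<open>w\<close>.\<close>
  define g where "g w = (if w \<in> ?W then g0 w else (\<lambda>_. 0))" for w
  have gm: "g w \<in> borel_measurable borel" for w using g0 by (auto simp: g_def)
  have gd: "distr unif borel (g w) = L w" if "length w = m" for w using g0 that by (auto simp: g_def)
  \<comment> \<open>Odd positions from \<open>2 * m + 1\<close> on: disjoint from the first
    \<open>m\<close> bits, hence independent of the word, and never in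
    \<open>tail m\<close>.\<close>
  define f where "f n = 2 * (m + n) + 1" for n :: nat
  have "inj f" by (auto simp: f_def inj_on_def)
  define \<eta> where "\<eta> x = bin (\<lambda>n. B x (f n))" for x
  have \<eta>m: "\<eta> \<in> borel_measurable (\<F> (range f))"
    unfolding \<eta>_def by (rule measurable_bits_bin) simp
  have \<eta>d: "uniform_rv \<eta>" using F_borel[OF \<eta>m] distr_bits_bin[OF \<open>inj f\<close>] by (simp add: uniform_rv_def \<eta>_def[abs_def])
  define u where "u x = g (word m x) (\<eta> x)" for x
  have ft: "range f \<subseteq> - tail m" "{..<m} \<subseteq> - tail m" "{..<m} \<inter> range f = {}"
    by (auto simp: f_def tail_def)
  have um: "u \<in> borel_measurable (\<F> (- tail m))"
    unfolding u_def
  proof (rule measurable_compose_countable)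
    show "(\<lambda>x. g w (\<eta> x)) \<in> borel_measurable (\<F> (- tail m))" for w
      by (rule measurable_compose[OF F_mono[OF ft(1) \<eta>m] gm])
    show "word m \<in> \<F> (- tail m) \<rightarrow>\<^sub>M count_space UNIV" by (rule F_mono[OF ft(2) measurable_word])
  qed
  have wm: "{x. word m x = w} \<in> sets (\<F> {..<m})" for w
    using measurable_sets[OF measurable_word, of "{w}" m] by (simp add: vimage_def)
  have joint: "measure \<mu> {x. word m x = w \<and> u x \<in> A} = (\<Sum>q\<in>Q. s w q) * measure (L w) A"
    if w: "length w = m" and A: "A \<in> sets borel" for w A
  proof -
    have gA: "g w -` A \<in> sets borel" using measurable_sets[OF gm A] by simp
    have "{x. \<eta> x \<in> g w -` A} \<in> sets (\<F> (range f))"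
      using measurable_sets[OF \<eta>m gA] by (simp add: vimage_def)
    from indep_F[OF wm this ft(3)]
    have "measure \<mu> ({x. word m x = w} \<inter> {x. \<eta> x \<in> g w -` A}) = measure \<mu> {x. word m x = w} * measure \<mu> {x. \<eta> x \<in> g w -` A}" .
    also have "{x. word m x = w} \<inter> {x. \<eta> x \<in> g w -` A} = {x. word m x = w \<and> u x \<in> A}" by (auto simp: u_def)
    also have "measure \<mu> {x. \<eta> x \<in> g w -` A} = measure unif (g w -` A)" by (rule uniform_rv_measure[OF \<eta>d gA])
    also have "\<dots> = measure (distr unif borel (g w)) A" using gm A by (subst measure_distr) auto
    finally show ?thesis using gd[OF w] row[OF w] by simp
  qed
  show thesis
  proof (rule that[OF _ um])
    show "measure \<mu> {x. word m x = w \<and> jj (u x) = q} = s w q" if "length w = m" "q \<in> Q" for w q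
      using joint[OF that(1) measurable_sets[OF jj, of "{q}", simplified]] L(2)[of w q] that by (simp add: vimage_def)
    show "uniform_rv u"
    proof (rule mpI[OF F_borel[OF um]])
      fix A :: "real set" assume A: "A \<in> sets borel"
      have uA: "{x. u x \<in> A} \<in> sets borel" using measurable_sets[OF F_borel[OF um] A] by (simp add: vimage_def)
      have "measure \<mu> {x. u x \<in> A} = measure \<mu> (\<Union>w\<in>?W. {x. word m x = w \<and> u x \<in> A})"
        by (rule arg_cong[of _ _ "measure \<mu>"]) (auto simp: word_def)
      also have "\<dots> = (\<Sum>w\<in>?W. measure \<mu> {x. word m x = w \<and> u x \<in> A})"
        using W F_sets_borel[OF wm] uA
        by (intro finite_measure_finite_Union) (auto simp: disjoint_family_on_def sets_mu Collect_conj_eq)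
      also have "\<dots> = measure unif A" using joint[OF _ A] L(3)[OF A] by simp
      finally show "measure \<mu> {x. u x \<in> A} = measure unif A" .
    qed
  qed
qed

end

section \<open>Local plans\<close>

lemma nn_integral_finite_range:
  fixes G :: "'b \<Rightarrow> ennreal"
  assumes A: "finite A" "\<And>x. x \<in> space M \<Longrightarrow> f x \<in> A" "\<And>z. z \<in> A \<Longrightarrow> {x \<in> space M. f x = z} \<in> sets M"
  shows "(\<integral>\<^sup>+x. G (f x) \<partial>M) = (\<Sum>z\<in>A. G z * emeasure M {x \<in> space M. f x = z})"
proof -
  have "(\<integral>\<^sup>+x. G (f x) \<partial>M) = (\<integral>\<^sup>+x. (\<Sum>z\<in>A. G z * indicator {x \<in> space M. f x = z} x) \<partial>M)"
  proof (rule nn_integral_cong)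
    fix x assume x: "x \<in> space M"
    have "(\<Sum>z\<in>A. G z * indicator {x \<in> space M. f x = z} x) = (\<Sum>z\<in>{f x}. G z * indicator {x \<in> space M. f x = z} x)"
      using A x by (intro sum.mono_neutral_right) (auto simp: indicator_def)
    then show "G (f x) = (\<Sum>z\<in>A. G z * indicator {x \<in> space M. f x = z} x)" using x by simp
  qed
  also have "\<dots> = (\<Sum>z\<in>A. \<integral>\<^sup>+x. G z * indicator {x \<in> space M. f x = z} x \<partial>M)"
    using A by (intro nn_integral_sum) auto
  also have "\<dots> = (\<Sum>z\<in>A. G z * emeasure M {x \<in> space M. f x = z})"
    using A by (intro sum.cong refl nn_integral_cmult_indicator) auto
  finally show ?thesis .
qed

lemma dist_triple_le: "dist (x, y, t) (p, q, s) \<le> dist x p + dist y q + dist t s"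
proof -
  have *: "dist (a, b) (c, d) \<le> dist a c + dist b d" for a c :: "'e::metric_space" and b d :: "'f::metric_space"
    unfolding dist_Pair_Pair by (rule sqrt_sum_squares_le_sum) auto
  show ?thesis using *[of x "(y, t)" p "(q, s)"] *[of y t q s] by simp
qed

lemma borel_Times_UNIV:
  fixes A :: "'a::topological_space set" and C :: "'b::topological_space set"
  shows "A \<in> sets borel \<Longrightarrow> A \<times> (UNIV :: 'b set) \<in> sets borel"
    and "C \<in> sets borel \<Longrightarrow> (UNIV :: 'a set) \<times> C \<in> sets borel"
proof -
  have "fst -` A \<inter> space borel \<in> sets (borel :: ('a \<times> 'b) measure)" if "A \<in> sets borel"
    by (rule measurable_sets[OF borel_measurable_continuous_onI that]) (intro continuous_intros)
  moreover have "fst -` A = A \<times> (UNIV :: 'b set)" by auto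
  ultimately show "A \<in> sets borel \<Longrightarrow> A \<times> (UNIV :: 'b set) \<in> sets borel" by simp
  have "snd -` C \<inter> space borel \<in> sets (borel :: ('a \<times> 'b) measure)" if "C \<in> sets borel"
    by (rule measurable_sets[OF borel_measurable_continuous_onI that]) (intro continuous_intros)
  moreover have "snd -` C = (UNIV :: 'a set) \<times> C" by auto
  ultimately show "C \<in> sets borel \<Longrightarrow> (UNIV :: 'a set) \<times> C \<in> sets borel" by simp
qed

lemma measurable_find_dist:
  "(\<lambda>y. find (\<lambda>q. dist y q < d) ps) \<in> (borel :: 'a::metric_space measure) \<rightarrow>\<^sub>M count_space UNIV"
proof (induction ps)
  case (Cons p ps)
  have m: "Measurable.pred borel (\<lambda>y. dist y p < d)"
  proof -
    have "open {y. dist y p < d}" by (intro open_Collect_less continuous_intros)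
    then show ?thesis by (simp add: pred_def)
  qed
  have "(\<lambda>y. if dist y p < d then Some p else find (\<lambda>q. dist y q < d) ps) \<in> borel \<rightarrow>\<^sub>M count_space UNIV"
    by (rule measurable_If[OF _ Cons]) (use m in \<open>auto simp: pred_def\<close>)
  then show ?case by (simp cong: if_cong)
qed simp

text \<open>Collects the choices that precede all plans: the error unit \<open>e\<close>, the
  truncation level \<open>N\<close>, and \<open>Bad\<close>, off which words locate
  \<open>x\<close>. Where a cost estimate fails, the truncated cost is still at most
  \<open>N\<close>, so sets of measure at most \<open>e / N\<close> cost at most \<open>e\<close>.
  The error in \<open>tails\<close> is uniform in \<open>t\<close> and in the map.\<close>

locale monge_problem = bits \<mu> B
  for \<mu> :: "'x::complete_space measure" and B +
  fixes \<nu> :: "'t::metric_space \<Rightarrow> 'y::complete_space measure" and h :: "'x \<Rightarrow> 'y \<Rightarrow> 't \<Rightarrow> real"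
    and e N :: real and Bad :: "'x set"
  assumes nu: "\<And>t. \<nu> t \<in> radon_probs"
    and nu_cont: "continuous_map euclidean weak_topology \<nu>"
    and h_cont: "continuous_on UNIV (\<lambda>(x, y, t). h x y t)" and h_nonneg: "\<And>x y t. 0 \<le> h x y t"
    and e_pos: "0 < e" and N_pos: "0 < N"
    and tails: "\<And>t S. smeas borel S \<Longrightarrow> distr \<mu> borel S = \<nu> t \<Longrightarrow>
      (\<integral>\<^sup>+x. ennreal (h x (S x) t) \<partial>\<mu>) \<le> (\<integral>\<^sup>+x. ennreal (min (h x (S x) t) N) \<partial>\<mu>) + ennreal e"
    and Bad: "Bad \<in> sets borel" "N * measure \<mu> Bad \<le> e"
    and word_approx: "\<And>d. 0 < d \<Longrightarrow> \<exists>m c. \<forall>x. x \<notin> Bad \<longrightarrow> dist x (c (word m x)) < d"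
begin

abbreviation K :: "'t \<Rightarrow> ennreal" where
  "K t \<equiv> kantorovich_cost (\<lambda>x y. h x y t) \<mu> (\<nu> t)"

abbreviation sk :: "'t \<Rightarrow> real \<Rightarrow> 'y" where "sk t \<equiv> skor (\<nu> t)"

definition H :: "'x \<Rightarrow> 'y \<Rightarrow> 't \<Rightarrow> real" where "H x y t = min (h x y t) N"

abbreviation tcost :: "'t \<Rightarrow> ('x \<Rightarrow> real) \<Rightarrow> ennreal" where
  "tcost t u \<equiv> (\<integral>\<^sup>+x. ennreal (H x (sk t (u x)) t) \<partial>\<mu>)"

lemma H_bounds: "0 \<le> H x y t" "H x y t \<le> N" "H x y t \<le> h x y t"
  using h_nonneg N_pos by (auto simp: H_def)

lemma H_diff: "\<bar>h x y t - h x' y' t'\<bar> < k \<Longrightarrow> H x y t \<le> H x' y' t' + k"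
  unfolding H_def by linarith

lemma smeas_sk: "smeas borel (sk t)" by (rule smeas_skor[OF nu])

lemma smeas_sk_uniform_rv: "uniform_rv u \<Longrightarrow> smeas borel (\<lambda>x. sk t (u x))"
  by (rule smeas_compose[OF _ smeas_sk]) (simp add: uniform_rv_def)

lemma distr_sk: "distr unif borel (sk t) = \<nu> t"
  by (rule distr_skor[OF nu smeas_measurable[OF smeas_sk]])

lemma distr_sk_uniform_rv:
  assumes "uniform_rv u" shows "distr \<mu> borel (\<lambda>x. sk t (u x)) = \<nu> t"
proof -
  have "distr \<mu> borel (\<lambda>x. sk t (u x)) = distr (distr \<mu> borel u) borel (sk t)"
    using assms smeas_measurable[OF smeas_sk[of t]]
    by (subst distr_distr) (auto simp: uniform_rv_def comp_def)
  then show ?thesis using assms by (simp add: uniform_rv_def distr_sk)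
qed

lemma measurable_h_pair: "(\<lambda>z. h (fst z) (snd z) t) \<in> borel_measurable borel"
proof -
  have "continuous_on UNIV (\<lambda>z. (\<lambda>(x, y, t). h x y t) (fst z, snd z, t))"
    by (rule continuous_on_compose2[OF h_cont]) (auto intro!: continuous_intros)
  then show ?thesis by (intro borel_measurable_continuous_onI) simp
qed

lemma measurable_h:
  assumes "smeas borel S" shows "(\<lambda>x. h x (S x) t) \<in> borel_measurable borel"
  using measurable_compose[OF smeas_pair[OF measurable_ident assms] measurable_h_pair[of t]] by simp

text \<open>The graph of \<open>S\<close> carries a coupling; strong measurability makes the graph
  map Borel for the topological product.\<close>

lemma K_le:
  assumes S: "smeas borel S" and d: "distr \<mu> borel S = \<nu> t"
  shows "K t \<le> (\<integral>\<^sup>+x. ennreal (h x (S x) t) \<partial>\<mu>)"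
proof -
  have Sm: "S \<in> \<mu> \<rightarrow>\<^sub>M borel" using smeas_measurable[OF S] by simp
  have p: "(\<lambda>x. (x, S x)) \<in> \<mu> \<rightarrow>\<^sub>M borel" using smeas_pair[OF measurable_ident S] by simp
  let ?P = "distr \<mu> borel (\<lambda>x. (x, S x))"
  have "?P \<in> couplings \<mu> (\<nu> t)"
    unfolding couplings_def
  proof (intro CollectI conjI ballI)
    show "prob_space ?P" by (rule prob_space_distr[OF p])
    fix A :: "'x set" assume A: "A \<in> sets borel"
    have "(\<lambda>x. (x, S x)) -` (A \<times> UNIV) = A" by auto
    then show "emeasure ?P (A \<times> UNIV) = emeasure \<mu> A"
      using emeasure_distr[OF p borel_Times_UNIV(1)[OF A]] by simp
  next
    fix C :: "'y set" assume C: "C \<in> sets borel"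
    have "(\<lambda>x. (x, S x)) -` (UNIV \<times> C) = S -` C" by auto
    then show "emeasure ?P (UNIV \<times> C) = emeasure (\<nu> t) C"
      using emeasure_distr[OF p borel_Times_UNIV(2)[OF C]] emeasure_distr[OF Sm C] by (simp add: d)
  qed simp
  then have "K t \<le> (\<integral>\<^sup>+(x, y). ennreal (h x y t) \<partial>?P)"
    unfolding kantorovich_cost_def by (rule INF_lower)
  also have "\<dots> = (\<integral>\<^sup>+x. ennreal (h x (S x) t) \<partial>\<mu>)"
    using measurable_h_pair[of t] by (subst nn_integral_distr[OF p]) (auto simp: case_prod_beta)
  finally show ?thesis .
qed

lemma far_set_borel: "{v. d \<le> dist (sk t v) (sk t' v)} \<in> sets borel"
proof -
  have "(\<lambda>v. dist (sk t v) (sk t' v)) -` {d..} \<inter> space borel \<in> sets borel"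
    by (rule measurable_sets[OF smeas_dist[OF smeas_sk smeas_sk]]) simp
  then show ?thesis by (simp add: vimage_def)
qed

text \<open>Almost everywhere convergence along sequences implies convergence in measure, and
  sequences detect continuity at \<open>t0\<close> in a metric space of parameters.\<close>

lemma sk_close:
  assumes d: "0 < d" and k: "0 < k"
  shows "\<exists>r>0. \<forall>t. dist t t0 < r \<longrightarrow> measure unif {v. d \<le> dist (sk t0 v) (sk t v)} \<le> k"
proof (rule ccontr)
  interpret U: prob_space unif by (rule prob_space_unif)
  assume neg: "\<not> ?thesis"
  have "\<exists>t. dist t t0 < 1 / Suc n \<and> k < measure unif {v. d \<le> dist (sk t0 v) (sk t v)}" for n
    using neg[unfolded not_ex, rule_format, of "1 / Suc n"] by (auto simp: not_le)
  then obtain u where u: "\<And>n. dist (u n) t0 < 1 / Suc n"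
    "\<And>n. k < measure unif {v. d \<le> dist (sk t0 v) (sk (u n) v)}" by metis
  have "u \<longlonglongrightarrow> t0"
  proof (rule metric_LIMSEQ_I)
    fix r :: real assume "0 < r"
    then obtain n where n: "1 / Suc n < r" using nat_approx_posE by blast
    have "dist (u j) t0 < r" if "n \<le> j" for j
    proof -
      have "1 / Suc j \<le> 1 / Suc n" using that by (intro divide_left_mono) auto
      then show ?thesis using u(1)[of j] n by simp
    qed
    then show "\<exists>n. \<forall>j\<ge>n. dist (u j) t0 < r" by blast
  qed
  then have w: "weakconv (\<lambda>n. \<nu> (u n)) (\<nu> t0)" by (rule weak_topology_seq[OF nu_cont _ nu])
  obtain Z where Z: "countable Z" "\<And>Ns v. (\<And>n. Ns n \<in> radon_probs) \<Longrightarrow> weakconv Ns (\<nu> t0) \<Longrightarrow> 0 \<le> v \<Longrightarrow> v < 1 \<Longrightarrow> v \<notin> Z \<Longrightarrow>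
      (\<lambda>n. skor (Ns n) v) \<longlonglongrightarrow> sk t0 v"
    by (rule skor_converges[OF nu[of t0]]) metis
  define A where "A n = {v. d \<le> dist (sk t0 v) (sk (u n) v)}" for n
  have Ab: "A n \<in> sets borel" for n unfolding A_def by (rule far_set_borel)
  have "(\<lambda>n. \<integral>v. indicator (A n) v \<partial>unif) \<longlonglongrightarrow> (\<integral>v. (0::real) \<partial>unif)"
  proof (rule integral_dominated_convergence[where w="\<lambda>_. 1"])
    show "AE v in unif. (\<lambda>n. indicator (A n) v :: real) \<longlonglongrightarrow> 0"
      using AE_unif_01 AE_unif_countable[OF Z(1)]
    proof eventually_elim
      case (elim v)
      have "(\<lambda>n. sk (u n) v) \<longlonglongrightarrow> sk t0 v" using Z(2)[OF nu w] elim by auto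
      then have "\<forall>\<^sub>F n in sequentially. dist (sk (u n) v) (sk t0 v) < d" using d by (rule tendstoD)
      then have "\<forall>\<^sub>F n in sequentially. indicator (A n) v = (0::real)"
        by eventually_elim (auto simp: A_def dist_commute)
      then show ?case by (rule tendsto_eventually)
    qed
  qed (use Ab in \<open>auto simp: indicator_def\<close>)
  then have "(\<lambda>n. measure unif (A n)) \<longlonglongrightarrow> 0" using Ab by simp
  then have "k \<le> 0" by (rule tendsto_lowerbound) (use u(2) in \<open>auto simp: A_def less_imp_le\<close>)
  then show False using k by simp
qed

lemma h_uniform:
  assumes KX: "compact KX" and KY: "compact KY" and k: "0 < k"
  obtains d where "0 < d" "\<And>p q x y t. p \<in> KX \<Longrightarrow> q \<in> KY \<Longrightarrow> dist x p < d \<Longrightarrow> dist y q < d \<Longrightarrow> dist t t0 < d \<Longrightarrow>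
    \<bar>h x y t - h p q t0\<bar> < k"
proof -
  have "compact (KX \<times> KY \<times> {t0})" by (intro compact_Times KX KY) simp
  then obtain d where d: "0 < d" "\<And>p q. p \<in> KX \<times> KY \<times> {t0} \<Longrightarrow> dist q p < d \<Longrightarrow>
      \<bar>(\<lambda>(x, y, t). h x y t) q - (\<lambda>(x, y, t). h x y t) p\<bar> < k"
    by (rule compact_uniform_near[OF h_cont _ k]) metis
  show thesis
  proof (rule that[of "d / 3"])
    show "0 < d / 3" using d by simp
    fix p q x y t assume "p \<in> KX" "q \<in> KY" "dist x p < d / 3" "dist y q < d / 3" "dist t t0 < d / 3"
    then show "\<bar>h x y t - h p q t0\<bar> < k"
      using d(2)[of "(p, q, t0)" "(x, y, t)"] dist_triple_le[of x y t p q t0] by simp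
  qed
qed

lemma ennreal_N_measure: "measure \<mu> A \<le> e / N \<Longrightarrow> ennreal N * emeasure \<mu> A \<le> ennreal e"
  using N_pos e_pos
  by (simp add: emeasure_eq_measure ennreal_mult[symmetric] field_simps)

lemma ennreal_N_Bad: "ennreal N * emeasure \<mu> Bad \<le> ennreal e"
  using Bad N_pos e_pos by (simp add: emeasure_eq_measure ennreal_mult[symmetric])

text \<open>One radius works for all \<open>u\<close>, because the exceptional sets have measures
  that do not depend on \<open>u\<close> once it is uniform. One \<open>e\<close> comes from the
  variation of \<open>h\<close> near a compact set; the other three pay for leaving
  \<open>KX\<close>, for leaving \<open>KY\<close>, and for Skorohod values that are far
  apart.\<close>

lemma truncated_cost_stable:
  "\<exists>r>0. \<forall>t u. dist t t0 < r \<longrightarrow> uniform_rv u \<longrightarrow>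
    tcost t0 u \<le> tcost t u + ennreal (4 * e)"
proof -
  have eN: "0 < e / N" using e_pos N_pos by simp
  obtain KX where KX: "compact KX" "measure \<mu> (- KX) < e / N" using radon_compact[OF radon eN] .
  obtain KY where KY: "compact KY" "measure (\<nu> t0) (- KY) < e / N" using radon_compact[OF nu eN] .
  obtain d where d: "0 < d" "\<And>p q x y t. p \<in> KX \<Longrightarrow> q \<in> KY \<Longrightarrow> dist x p < d \<Longrightarrow> dist y q < d \<Longrightarrow> dist t t0 < d \<Longrightarrow>
    \<bar>h x y t - h p q t0\<bar> < e"
    by (rule h_uniform[OF KX(1) KY(1) e_pos, of t0]) metis
  obtain r where r: "0 < r" "\<And>t. dist t t0 < r \<Longrightarrow> measure unif {v. d \<le> dist (sk t0 v) (sk t v)} \<le> e / N"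
    using sk_close[OF d(1) eN, of t0] by auto
  have KXb: "- KX \<in> sets borel" and KYb: "- KY \<in> sets borel" using KX KY by (auto intro: borel_comp borel_compact)
  show ?thesis
  proof (intro exI[of _ "min r d"] conjI allI impI)
    show "0 < min r d" using r d by simp
    fix t u assume t: "dist t t0 < min r d" and u: "uniform_rv u"
    have um: "u \<in> borel \<rightarrow>\<^sub>M borel" using u by (simp add: uniform_rv_def)
    define A1 where "A1 = {x. sk t0 (u x) \<in> - KY}"
    define A2 where "A2 = {x. d \<le> dist (sk t0 (u x)) (sk t (u x))}"
    have S0: "(\<lambda>x. sk t0 (u x)) \<in> \<mu> \<rightarrow>\<^sub>M borel" using smeas_measurable[OF smeas_sk_uniform_rv[OF u, of t0]] by simp
    have A1b: "A1 \<in> sets borel" using measurable_sets[OF S0 KYb] by (simp add: A1_def vimage_def sets_mu)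
    have "measure \<mu> A1 = measure (distr \<mu> borel (\<lambda>x. sk t0 (u x))) (- KY)"
      using measure_distr[OF S0 KYb] by (simp add: A1_def vimage_def)
    then have A1m: "measure \<mu> A1 \<le> e / N" using KY by (simp add: distr_sk_uniform_rv[OF u])
    note Db = far_set_borel[of d t0 t]
    have A2b: "A2 \<in> sets borel" using measurable_sets[OF um Db] by (simp add: A2_def vimage_def)
    have "measure \<mu> A2 = measure unif {v. d \<le> dist (sk t0 v) (sk t v)}"
      using uniform_rv_measure[OF u Db] by (simp add: A2_def)
    then have A2m: "measure \<mu> A2 \<le> e / N" using r(2) t by simp
    have Hm: "(\<lambda>x. ennreal (H x (sk t (u x)) t)) \<in> borel_measurable \<mu>"
      using measurable_h[OF smeas_sk_uniform_rv[OF u, of t], of t] unfolding H_def by measurable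
    have pt: "ennreal (H x (sk t0 (u x)) t0) \<le> ennreal (H x (sk t (u x)) t) + ennreal e +
        (ennreal N * indicator (- KX) x + ennreal N * indicator A1 x + ennreal N * indicator A2 x)" for x
    proof (cases "x \<in> - KX \<or> x \<in> A1 \<or> x \<in> A2")
      case True
      have "ennreal (H x (sk t0 (u x)) t0) \<le> ennreal N" using H_bounds by (intro ennreal_leI)
      also have "\<dots> \<le> ennreal N * indicator (- KX) x + ennreal N * indicator A1 x + ennreal N * indicator A2 x"
        using True by (auto simp: indicator_def add_increasing add_increasing2)
      also have "\<dots> \<le> ennreal (H x (sk t (u x)) t) + ennreal e + \<dots>" by (simp add: add_increasing)
      finally show ?thesis .
    next
      case False
      then have "\<bar>h x (sk t (u x)) t - h x (sk t0 (u x)) t0\<bar> < e"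
        using t d(1) by (intro d(2)) (auto simp: A1_def A2_def dist_commute)
      then have "H x (sk t0 (u x)) t0 \<le> H x (sk t (u x)) t + e" by (intro H_diff) (simp add: abs_minus_commute)
      then have "ennreal (H x (sk t0 (u x)) t0) \<le> ennreal (H x (sk t (u x)) t + e)" by (rule ennreal_leI)
      also have "\<dots> = ennreal (H x (sk t (u x)) t) + ennreal e" using H_bounds e_pos by (intro ennreal_plus) auto
      finally show ?thesis using False by simp
    qed
    have "tcost t0 u \<le> (\<integral>\<^sup>+x. ennreal (H x (sk t (u x)) t) + ennreal e +
        (ennreal N * indicator (- KX) x + ennreal N * indicator A1 x + ennreal N * indicator A2 x) \<partial>\<mu>)"
      by (rule nn_integral_mono) (rule pt)
    also have "\<dots> = tcost t u + ennreal e +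
        (ennreal N * emeasure \<mu> (- KX) + ennreal N * emeasure \<mu> A1 + ennreal N * emeasure \<mu> A2)"
      using Hm KXb A1b A2b emeasure_space_1
      by (simp add: nn_integral_add nn_integral_cmult_indicator sets_mu)
    also have "\<dots> \<le> tcost t u + ennreal e + (ennreal e + ennreal e + ennreal e)"
      using KX(2) A1m A2m by (intro add_left_mono add_mono ennreal_N_measure) auto
    also have "\<dots> = tcost t u + ennreal (4 * e)"
      using e_pos by (simp add: add.assoc ennreal_plus[symmetric] del: ennreal_plus)
    finally show "tcost t0 u \<le> tcost t u + ennreal (4 * e)" .
  qed
qed

text \<open>Away from \<^term>\<open>Bad\<close> the cost of the map with parameter t is dominated by a function of
  the bits outside of \<^term>\<open>tail m\<close>, so that it may be averaged independently of events that
  depend on the bits in \<^term>\<open>tail m\<close> only.\<close>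

definition dominated :: "nat \<Rightarrow> ('x \<Rightarrow> real) \<Rightarrow> 't \<Rightarrow> ennreal \<Rightarrow> bool" where
  "dominated m u t C \<longleftrightarrow> (\<exists>\<Gamma>\<in>borel_measurable (\<F> (- tail m)). (\<integral>\<^sup>+x. \<Gamma> x \<partial>\<mu>) \<le> C \<and>
     (\<forall>x. x \<notin> Bad \<longrightarrow> ennreal (H x (sk t (u x)) t) \<le> \<Gamma> x))"

text \<open>An almost optimal coupling is remembered only through a finite table, words of
  \<open>x\<close> against classes of \<open>y\<close>, which \<open>lift_table\<close> realises by
  a uniform \<open>u\<close>. A surrogate cost \<open>G\<close> of word and class has equal
  integrals under both. Budget: \<open>e\<close> for the coupling, \<open>2 * e\<close> from the
  cost to \<open>G\<close>, \<open>3 * e\<close> for exceptional sets, then \<open>2 * e\<close>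
  back to the cost at \<open>t\<close> and \<open>e\<close> for distant Skorohod values.\<close>

lemma local_plan:
  "\<exists>m u d. 0 < d \<and> uniform_rv u \<and> u \<in> borel_measurable (\<F> (- tail m)) \<and>
    (\<forall>t. dist t t0 < d \<longrightarrow> dominated m u t (K t0 + ennreal (9 * e)))"
proof (cases "K t0 = \<infinity>")
  case True
  \<comment> \<open>The bound is infinite here, so any uniform variable made of odd bits will
    do.\<close>
  define u where "u x = bin (\<lambda>n. B x (2 * n + 1))" for x
  have "range (\<lambda>n. 2 * n + 1) \<subseteq> - tail 0" by (auto simp: tail_def)
  then have um: "u \<in> borel_measurable (\<F> (- tail 0))" unfolding u_def by (rule measurable_bits_bin)
  have "inj (\<lambda>n::nat. 2 * n + 1)" by (auto simp: inj_on_def)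
  from distr_bits_bin[OF this] have "uniform_rv u" using F_borel[OF um] by (simp add: uniform_rv_def u_def[abs_def])
  moreover have "dominated 0 u t (K t0 + ennreal (9 * e))" for t
    unfolding dominated_def True by (intro bexI[of _ "\<lambda>_. \<infinity>"]) auto
  ultimately show ?thesis using um by (intro exI[of _ 0] exI[of _ u] exI[of _ 1]) auto
next
  case False
  have "K t0 < K t0 + ennreal e" using False e_pos by (simp add: ennreal_add_left_cancel_less[of _ 0, simplified] less_top)
  then obtain \<sigma> where \<sigma>: "\<sigma> \<in> couplings \<mu> (\<nu> t0)"
    and \<sigma>K: "(\<integral>\<^sup>+(x, y). ennreal (h x y t0) \<partial>\<sigma>) < K t0 + ennreal e"
    unfolding kantorovich_cost_def by (auto simp: INF_less_iff)
  have \<sigma>s: "sets \<sigma> = sets borel" "prob_space \<sigma>" and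
    \<sigma>1: "\<And>A. A \<in> sets borel \<Longrightarrow> emeasure \<sigma> (A \<times> UNIV) = emeasure \<mu> A" and
    \<sigma>2: "\<And>C. C \<in> sets borel \<Longrightarrow> emeasure \<sigma> (UNIV \<times> C) = emeasure (\<nu> t0) C"
    using \<sigma> by (auto simp: couplings_def)
  have \<sigma>sp: "space \<sigma> = UNIV" using sets_eq_imp_space_eq[OF \<sigma>s(1)] by simp
  interpret S: prob_space \<sigma> by fact
  interpret N0: prob_space "\<nu> t0" using radon_probsD[OF nu] by simp
  interpret U: prob_space unif by (rule prob_space_unif)
  have eN: "0 < e / N" using e_pos N_pos by simp
  obtain KX where KX: "compact KX" "measure \<mu> (- KX) < e / N" using radon_compact[OF radon eN] .
  obtain KY where KY: "compact KY" "measure (\<nu> t0) (- KY) < e / N" using radon_compact[OF nu eN] .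
  have KXb: "- KX \<in> sets borel" and KYb: "- KY \<in> sets borel" using KX KY by (auto intro: borel_comp borel_compact)
  obtain d where d: "0 < d" "\<And>p q x y t. p \<in> KX \<Longrightarrow> q \<in> KY \<Longrightarrow> dist x p < d \<Longrightarrow> dist y q < d \<Longrightarrow> dist t t0 < d \<Longrightarrow>
    \<bar>h x y t - h p q t0\<bar> < e"
    by (rule h_uniform[OF KX(1) KY(1) e_pos, of t0]) metis
  have d2: "0 < d / 2" using d by simp
  obtain m c where mc: "\<And>x. x \<notin> Bad \<Longrightarrow> dist x (c (word m x)) < d / 2" using word_approx[OF d2] by auto
  obtain P where P: "finite P" "P \<subseteq> KY" "KY \<subseteq> (\<Union>y\<in>P. ball y (d / 2))"
  proof (rule compactE_image[OF KY(1), of KY "\<lambda>y. ball y (d / 2)"])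
    show "KY \<subseteq> (\<Union>y\<in>KY. ball y (d / 2))" using d by auto
  qed auto
  obtain ps where ps: "set ps = P" using finite_list[OF P(1)] by auto
  \<comment> \<open>Class of \<open>y\<close>: the first listed centre within \<open>d / 2\<close>.
    \<open>None\<close> can occur only off \<open>KY\<close>.\<close>
  define j where "j y = find (\<lambda>q. dist y q < d / 2) ps" for y
  have jm: "j \<in> borel \<rightarrow>\<^sub>M count_space UNIV" unfolding j_def by (rule measurable_find_dist)
  have jSome: "q \<in> KY \<and> dist y q < d / 2" if "j y = Some q" for y q
    using that P(2) ps by (auto simp: j_def find_Some_iff)
  have jNone: "y \<in> - KY" if "j y = None" for y
    using that P(3) ps by (auto simp: j_def find_None_iff dist_commute)
  define Q where "Q = insert None (Some ` P)"
  have jP: "q \<in> P" if "j y = Some q" for y q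
    using that ps by (auto simp: j_def find_Some_iff)
  have Q1: "finite Q" using P(1) by (simp add: Q_def)
  have Q2: "j y \<in> Q" for y using jP[of y] by (cases "j y") (auto simp: Q_def)
  note Q = Q1 Q2
  let ?W = "{w :: bool list. length w = m}"
  have W: "finite ?W" using finite_lists_length_eq[of "UNIV :: bool set" m] by simp
  have wb: "{x. word m x = w} \<in> sets borel" for w
    using measurable_sets[OF F_borel[OF measurable_word], of "{w}" m] by (simp add: vimage_def)
  have jb: "{y. j y = q} \<in> sets borel" for q
    using measurable_sets[OF jm, of "{q}"] by (simp add: vimage_def)
  define R where "R w q = {x. word m x = w} \<times> {y. j y = q}" for w q
  have "R w q = {x. word m x = w} \<times> UNIV \<inter> UNIV \<times> {y. j y = q}" for w q by (auto simp: R_def)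
  then have Rb: "R w q \<in> sets \<sigma>" for w q
    using sets.Int[OF borel_Times_UNIV(1)[OF wb[of w]] borel_Times_UNIV(2)[OF jb[of q]]] by (simp add: \<sigma>s(1))
  define s where "s w q = measure \<sigma> (R w q)" for w q
  define jj where "jj v = j (sk t0 v)" for v
  have jjm: "jj \<in> borel \<rightarrow>\<^sub>M count_space UNIV"
    unfolding jj_def by (rule measurable_compose[OF smeas_measurable[OF smeas_sk] jm])
  have col: "(\<Sum>w\<in>?W. s w q) = measure unif (jj -` {q})" for q
  proof -
    have "(\<Sum>w\<in>?W. s w q) = measure \<sigma> (\<Union>w\<in>?W. R w q)"
      unfolding s_def using W Rb
      by (intro S.finite_measure_finite_Union[symmetric]) (auto simp: disjoint_family_on_def R_def)
    also have "(\<Union>w\<in>?W. R w q) = UNIV \<times> {y. j y = q}" by (auto simp: R_def word_def)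
    also have "measure \<sigma> \<dots> = measure (\<nu> t0) {y. j y = q}"
      using \<sigma>2[OF jb] by (simp add: measure_def)
    also have "\<dots> = measure (distr unif borel (sk t0)) {y. j y = q}" by (simp add: distr_sk)
    also have "\<dots> = measure unif (jj -` {q})"
      using jb smeas_measurable[OF smeas_sk[of t0]]
      by (subst measure_distr) (auto simp: jj_def[abs_def] vimage_def)
    finally show ?thesis .
  qed
  have row: "(\<Sum>q\<in>Q. s w q) = measure \<mu> {x. word m x = w}" for w
  proof -
    have "(\<Sum>q\<in>Q. s w q) = measure \<sigma> (\<Union>q\<in>Q. R w q)"
      unfolding s_def using Q(1) Rb
      by (intro S.finite_measure_finite_Union[symmetric]) (auto simp: disjoint_family_on_def R_def)
    also have "(\<Union>q\<in>Q. R w q) = {x. word m x = w} \<times> UNIV" using Q(2) by (auto simp: R_def)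
    also have "measure \<sigma> \<dots> = measure \<mu> {x. word m x = w}"
      using \<sigma>1[OF wb] by (simp add: measure_def)
    finally show ?thesis .
  qed
  obtain u where u: "uniform_rv u" "u \<in> borel_measurable (\<F> (- tail m))"
    "\<And>w q. length w = m \<Longrightarrow> q \<in> Q \<Longrightarrow> measure \<mu> {x. word m x = w \<and> jj (u x) = q} = s w q"
    by (rule lift_table[OF jjm Q(1), of s m]) (use Q(2) col row in \<open>auto simp: s_def jj_def\<close>)
  \<comment> \<open>A word determines \<open>c w\<close> but not whether \<open>x\<close> is in
    \<open>KX\<close>. Words with \<open>c w\<close> away from \<open>KX\<close> are charged the
    full \<open>N\<close>, as is the class \<open>None\<close>.\<close>
  define near where "near w \<longleftrightarrow> (\<exists>p\<in>KX. dist (c w) p < d / 2)" for w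
  define G where "G w q = (case q of None \<Rightarrow> ennreal N | Some q' \<Rightarrow> if near w then ennreal (H (c w) q' t0) else ennreal N)" for w q
  have um: "u \<in> borel \<rightarrow>\<^sub>M borel" using u by (simp add: uniform_rv_def)
  have jub: "{x. jj (u x) = q} \<in> sets borel" for q
    using measurable_sets[OF measurable_compose[OF um jjm], of "{q}"] by (simp add: vimage_def)
  \<comment> \<open>Both integrands see only word and class, and both measures produce the same
    table \<open>s\<close>.\<close>
  have IG: "(\<integral>\<^sup>+x. G (word m x) (jj (u x)) \<partial>\<mu>) = (\<integral>\<^sup>+z. G (word m (fst z)) (j (snd z)) \<partial>\<sigma>)"
  proof -
    have "(\<integral>\<^sup>+x. G (word m x) (jj (u x)) \<partial>\<mu>) = (\<integral>\<^sup>+x. case_prod G (word m x, jj (u x)) \<partial>\<mu>)" by simp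
    also have "\<dots> = (\<Sum>z\<in>?W \<times> Q. case_prod G z * emeasure \<mu> {x \<in> space \<mu>. (word m x, jj (u x)) = z})"
    proof (rule nn_integral_finite_range)
      fix z assume "z \<in> ?W \<times> Q"
      have "{x \<in> space \<mu>. (word m x, jj (u x)) = z} = {x. word m x = fst z} \<inter> {x. jj (u x) = snd z}" by auto
      then show "{x \<in> space \<mu>. (word m x, jj (u x)) = z} \<in> events" using wb jub by (simp add: sets_mu)
    qed (use W Q in \<open>auto simp: word_def jj_def\<close>)
    also have "\<dots> = (\<Sum>z\<in>?W \<times> Q. case_prod G z * emeasure \<sigma> {x \<in> space \<sigma>. (word m (fst x), j (snd x)) = z})"
    proof (rule sum.cong[OF refl])
      fix z assume z: "z \<in> ?W \<times> Q"
      have "{x \<in> space \<mu>. (word m x, jj (u x)) = z} = {x. word m x = fst z \<and> jj (u x) = snd z}" by auto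
      moreover have "{x \<in> space \<sigma>. (word m (fst x), j (snd x)) = z} = R (fst z) (snd z)" by (auto simp: R_def \<sigma>sp)
      ultimately show "case_prod G z * emeasure \<mu> {x \<in> space \<mu>. (word m x, jj (u x)) = z} =
          case_prod G z * emeasure \<sigma> {x \<in> space \<sigma>. (word m (fst x), j (snd x)) = z}"
        using u(3)[of "fst z" "snd z"] z by (auto simp: emeasure_eq_measure S.emeasure_eq_measure s_def)
    qed
    also have "\<dots> = (\<integral>\<^sup>+x. case_prod G (word m (fst x), j (snd x)) \<partial>\<sigma>)"
    proof (rule nn_integral_finite_range[symmetric])
      fix z assume "z \<in> ?W \<times> Q"
      have "{x \<in> space \<sigma>. (word m (fst x), j (snd x)) = z} = R (fst z) (snd z)" by (auto simp: R_def \<sigma>sp)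
      then show "{x \<in> space \<sigma>. (word m (fst x), j (snd x)) = z} \<in> S.events" using Rb by simp
    qed (use W Q in \<open>auto simp: word_def\<close>)
    finally show ?thesis by simp
  qed
  have Gle: "G (word m x) (j y) \<le> ennreal (h x y t0) + ennreal (2 * e) +
      (ennreal N * indicator (Bad \<times> UNIV) (x, y) + ennreal N * indicator ((- KX) \<times> UNIV) (x, y) + ennreal N * indicator (UNIV \<times> (- KY)) (x, y))" for x y
  proof (cases "x \<in> Bad \<or> x \<in> - KX \<or> y \<in> - KY")
    case True
    have "G (word m x) (j y) \<le> ennreal N"
      using H_bounds by (auto simp: G_def intro: ennreal_leI split: option.splits)
    also have "\<dots> \<le> ennreal N * indicator (Bad \<times> UNIV) (x, y) + ennreal N * indicator ((- KX) \<times> UNIV) (x, y) + ennreal N * indicator (UNIV \<times> (- KY)) (x, y)"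
      using True by (auto simp: indicator_def add_increasing add_increasing2)
    also have "\<dots> \<le> ennreal (h x y t0) + ennreal (2 * e) + \<dots>" by (simp add: add_increasing)
    finally show ?thesis .
  next
    case False
    then obtain q where q: "j y = Some q" using jNone by (cases "j y") auto
    have x: "x \<in> KX" "dist x (c (word m x)) < d / 2" using False mc by auto
    have near: "near (word m x)" unfolding near_def using x by (intro bexI[of _ x]) (auto simp: dist_commute)
    have q': "q \<in> KY" "dist y q < d / 2" using jSome[OF q] by auto
    \<comment> \<open>Both values are compared with \<open>h x q t0\<close>, whose arguments lie in
      the compact sets.\<close>
    have "\<bar>h x y t0 - h x q t0\<bar> < e" "\<bar>h (c (word m x)) q t0 - h x q t0\<bar> < e"
      using x q' d(1) by (auto intro!: d(2) simp: dist_commute)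
    then have "H (c (word m x)) q t0 \<le> h x y t0 + 2 * e" unfolding H_def by linarith
    then have "ennreal (H (c (word m x)) q t0) \<le> ennreal (h x y t0 + 2 * e)" by (rule ennreal_leI)
    also have "\<dots> = ennreal (h x y t0) + ennreal (2 * e)" using h_nonneg e_pos by (intro ennreal_plus) auto
    finally show ?thesis using False by (simp add: G_def q near)
  qed
  have hm: "(\<lambda>z. ennreal (h (fst z) (snd z) t0)) \<in> borel_measurable \<sigma>"
    using measurable_h_pair[of t0] \<sigma>s(1) by (simp cong: measurable_cong_sets)
  have bS: "Bad \<times> UNIV \<in> sets \<sigma>" "(- KX) \<times> UNIV \<in> sets \<sigma>" "UNIV \<times> (- KY) \<in> sets \<sigma>"
    unfolding \<sigma>s(1) by (intro borel_Times_UNIV Bad KXb KYb)+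
  have "(\<integral>\<^sup>+z. G (word m (fst z)) (j (snd z)) \<partial>\<sigma>) \<le> (\<integral>\<^sup>+z. ennreal (h (fst z) (snd z) t0) + ennreal (2 * e) +
      (ennreal N * indicator (Bad \<times> UNIV) z + ennreal N * indicator ((- KX) \<times> UNIV) z + ennreal N * indicator (UNIV \<times> (- KY)) z) \<partial>\<sigma>)"
    by (rule nn_integral_mono) (use Gle in \<open>metis prod.collapse\<close>)
  also have "\<dots> = (\<integral>\<^sup>+z. ennreal (h (fst z) (snd z) t0) \<partial>\<sigma>) + ennreal (2 * e) +
      (ennreal N * emeasure \<sigma> (Bad \<times> UNIV) + ennreal N * emeasure \<sigma> ((- KX) \<times> UNIV) + ennreal N * emeasure \<sigma> (UNIV \<times> (- KY)))"
    using hm bS S.emeasure_space_1 by (simp add: nn_integral_add nn_integral_cmult_indicator)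
  also have "\<dots> \<le> (K t0 + ennreal e) + ennreal (2 * e) + (ennreal e + ennreal e + ennreal e)"
  proof (intro add_mono order_refl)
    show "(\<integral>\<^sup>+z. ennreal (h (fst z) (snd z) t0) \<partial>\<sigma>) \<le> K t0 + ennreal e"
      using less_imp_le[OF \<sigma>K] by (simp add: case_prod_beta')
    show "ennreal N * emeasure \<sigma> (Bad \<times> UNIV) \<le> ennreal e" using ennreal_N_Bad by (simp add: \<sigma>1[OF Bad(1)])
    show "ennreal N * emeasure \<sigma> ((- KX) \<times> UNIV) \<le> ennreal e"
      using KX by (simp add: \<sigma>1[OF KXb] ennreal_N_measure)
    show "ennreal N * emeasure \<sigma> (UNIV \<times> (- KY)) \<le> ennreal e"
      using KY N_pos e_pos by (simp add: \<sigma>2[OF KYb] N0.emeasure_eq_measure ennreal_mult[symmetric] field_simps)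
  qed
  also have "\<dots> = K t0 + ennreal (6 * e)"
    using e_pos by (simp add: add.assoc ennreal_plus[symmetric] del: ennreal_plus)
  finally have IG': "(\<integral>\<^sup>+x. G (word m x) (jj (u x)) \<partial>\<mu>) \<le> K t0 + ennreal (6 * e)" unfolding IG .
  obtain r where r: "0 < r" "\<And>t. dist t t0 < r \<Longrightarrow> measure unif {v. d / 2 \<le> dist (sk t0 v) (sk t v)} \<le> e / N"
    using sk_close[OF d2 eN, of t0] by auto
  have wt: "{..<m} \<subseteq> - tail m" by (auto simp: tail_def)
  have Gm: "(\<lambda>x. G (word m x) (jj (u x))) \<in> borel_measurable (\<F> (- tail m))"
  proof (rule measurable_compose_countable)
    show "(\<lambda>x. G w (jj (u x))) \<in> borel_measurable (\<F> (- tail m))" for w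
      by (rule measurable_compose[OF measurable_compose[OF u(2) jjm]]) simp
    show "word m \<in> \<F> (- tail m) \<rightarrow>\<^sub>M count_space UNIV" by (rule F_mono[OF wt measurable_word])
  qed
  have "dominated m u t (K t0 + ennreal (9 * e))" if t: "dist t t0 < min r d" for t
    unfolding dominated_def
  proof (intro bexI conjI allI impI)
    define A where "A = {v. d / 2 \<le> dist (sk t0 v) (sk t v)}"
    \<comment> \<open>Only the word and \<open>u\<close> enter, so the majorant ignores
      \<open>tail m\<close>. The true cost involves \<open>x\<close> itself and need not be
      independent of the selection.\<close>
    define \<Gamma> where "\<Gamma> x = G (word m x) (jj (u x)) + ennreal (2 * e) + ennreal N * indicator A (u x)" for x
    have Ab: "A \<in> sets borel" unfolding A_def by (rule far_set_borel)
    have Am: "(\<lambda>x. indicator A (u x) :: ennreal) \<in> borel_measurable (\<F> (- tail m))"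
      by (rule measurable_compose[OF u(2)]) (use Ab in simp)
    show "\<Gamma> \<in> borel_measurable (\<F> (- tail m))" unfolding \<Gamma>_def using Gm Am by measurable
    have uA: "{x. u x \<in> A} \<in> sets borel" using measurable_sets[OF um Ab] by (simp add: vimage_def)
    have "(\<integral>\<^sup>+x. \<Gamma> x \<partial>\<mu>) = (\<integral>\<^sup>+x. G (word m x) (jj (u x)) + ennreal (2 * e) + ennreal N * indicator {x. u x \<in> A} x \<partial>\<mu>)"
      unfolding \<Gamma>_def by (intro nn_integral_cong) (simp add: indicator_def)
    also have "\<dots> = (\<integral>\<^sup>+x. G (word m x) (jj (u x)) \<partial>\<mu>) + ennreal (2 * e) + ennreal N * emeasure \<mu> {x. u x \<in> A}"
      using F_borel[OF Gm] uA emeasure_space_1 by (simp add: nn_integral_add nn_integral_cmult_indicator sets_mu)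
    also have "\<dots> \<le> (K t0 + ennreal (6 * e)) + ennreal (2 * e) + ennreal e"
    proof (intro add_mono order_refl IG' ennreal_N_measure)
      show "measure \<mu> {x. u x \<in> A} \<le> e / N" using uniform_rv_measure[OF u(1) Ab] r(2)[of t] t by (simp add: A_def)
    qed
    also have "\<dots> = K t0 + ennreal (9 * e)"
      using e_pos by (simp add: add.assoc ennreal_plus[symmetric] del: ennreal_plus)
    finally show "(\<integral>\<^sup>+x. \<Gamma> x \<partial>\<mu>) \<le> K t0 + ennreal (9 * e)" .
    fix x assume x: "x \<notin> Bad"
    show "ennreal (H x (sk t (u x)) t) \<le> \<Gamma> x"
    proof (cases "u x \<notin> A \<and> near (word m x) \<and> (\<exists>q. jj (u x) = Some q)")
      case False
      have "ennreal (H x (sk t (u x)) t) \<le> ennreal N" using H_bounds by (intro ennreal_leI)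
      also have "\<dots> \<le> G (word m x) (jj (u x)) + ennreal N * indicator A (u x)"
        using False by (auto simp: G_def add_increasing add_increasing2 split: option.splits)
      also have "\<dots> \<le> \<Gamma> x" unfolding \<Gamma>_def by (intro add_right_mono) (simp add: add_increasing2)
      finally show ?thesis .
    next
      case True
      then obtain q p where q: "jj (u x) = Some q" and p: "p \<in> KX" "dist (c (word m x)) p < d / 2" by (auto simp: near_def)
      have q': "q \<in> KY" "dist (sk t0 (u x)) q < d / 2" using jSome[of "sk t0 (u x)" q] q by (auto simp: jj_def)
      have "dist x p < d" using mc[OF x] p dist_triangle2[of x p "c (word m x)"]
        by (smt (verit) dist_commute dist_triangle field_sum_of_halves)
      moreover have "dist (sk t (u x)) q < d"
        using True q' dist_triangle[of "sk t (u x)" q "sk t0 (u x)"] by (auto simp: A_def dist_commute not_le)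
      ultimately have "\<bar>h x (sk t (u x)) t - h p q t0\<bar> < e" using t p q' by (intro d(2)) auto
      moreover have "\<bar>h (c (word m x)) q t0 - h p q t0\<bar> < e" using p q' d(1) by (intro d(2)) auto
      ultimately have "H x (sk t (u x)) t \<le> H (c (word m x)) q t0 + 2 * e" unfolding H_def by linarith
      then have "ennreal (H x (sk t (u x)) t) \<le> ennreal (H (c (word m x)) q t0 + 2 * e)" by (rule ennreal_leI)
      also have "\<dots> = ennreal (H (c (word m x)) q t0) + ennreal (2 * e)" using H_bounds e_pos by (intro ennreal_plus) auto
      finally show ?thesis using True by (simp add: \<Gamma>_def G_def q)
    qed
  qed
  then show ?thesis using u r d by (intro exI[of _ m] exI[of _ u] exI[of _ "min r d"]) auto
qed

lemma dominated_cost: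
  assumes "dominated m u t C" and u: "uniform_rv u"
  shows "tcost t u \<le> C + ennreal e"
proof -
  obtain \<Gamma> where \<Gamma>: "\<Gamma> \<in> borel_measurable (\<F> (- tail m))" "(\<integral>\<^sup>+x. \<Gamma> x \<partial>\<mu>) \<le> C"
    "\<And>x. x \<notin> Bad \<Longrightarrow> ennreal (H x (sk t (u x)) t) \<le> \<Gamma> x" using assms by (auto simp: dominated_def)
  have "tcost t u \<le> (\<integral>\<^sup>+x. \<Gamma> x + ennreal N * indicator Bad x \<partial>\<mu>)"
  proof (rule nn_integral_mono)
    fix x show "ennreal (H x (sk t (u x)) t) \<le> \<Gamma> x + ennreal N * indicator Bad x"
      using \<Gamma>(3)[of x] H_bounds(2)[of x "sk t (u x)" t] N_pos
      by (cases "x \<in> Bad") (auto intro: add_increasing ennreal_leI)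
  qed
  also have "\<dots> = (\<integral>\<^sup>+x. \<Gamma> x \<partial>\<mu>) + ennreal N * emeasure \<mu> Bad"
    using F_borel[OF \<Gamma>(1)] Bad by (simp add: nn_integral_add nn_integral_cmult_indicator sets_mu)
  also have "\<dots> \<le> C + ennreal e" by (intro add_mono \<Gamma> ennreal_N_Bad)
  finally show ?thesis .
qed

text \<open>A plan made at \<open>t\<close> is used at \<open>t0\<close>: \<open>9 * e\<close> for
  the plan, \<open>e\<close> for \<open>Bad\<close>, \<open>4 * e\<close> for the change of
  parameter, \<open>e\<close> for the truncation. It turns bounds by the cost at the centre of a
  plan into bounds by the cost at nearby \<open>t\<close>.\<close>

lemma K_lower_semicontinuous: "\<exists>r>0. \<forall>t. dist t t0 < r \<longrightarrow> K t0 \<le> K t + ennreal (15 * e)"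
proof -
  obtain r where r: "0 < r" "\<And>t u. dist t t0 < r \<Longrightarrow> uniform_rv u \<Longrightarrow>
    tcost t0 u \<le> tcost t u + ennreal (4 * e)"
    using truncated_cost_stable[of t0] by auto
  have "K t0 \<le> K t + ennreal (15 * e)" if t: "dist t t0 < r" for t
  proof -
    obtain m u where u: "uniform_rv u" "dominated m u t (K t + ennreal (9 * e))"
    proof -
      obtain m u d where "0 < d" "uniform_rv u" "\<forall>s. dist s t < d \<longrightarrow> dominated m u s (K t + ennreal (9 * e))"
        using local_plan[of t] by blast
      then show thesis using that[of u m] by simp
    qed
    have "K t0 \<le> (\<integral>\<^sup>+x. ennreal (h x (sk t0 (u x)) t0) \<partial>\<mu>)"
      by (rule K_le[OF smeas_sk_uniform_rv distr_sk_uniform_rv]) (rule u)+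
    also have "\<dots> \<le> tcost t0 u + ennreal e"
      unfolding H_def by (rule tails[OF smeas_sk_uniform_rv distr_sk_uniform_rv]) (rule u)+
    also have "\<dots> \<le> (tcost t u + ennreal (4 * e)) + ennreal e"
      by (intro add_right_mono r t u)
    also have "\<dots> \<le> (((K t + ennreal (9 * e)) + ennreal e) + ennreal (4 * e)) + ennreal e"
      by (intro add_right_mono dominated_cost[OF u(2,1)])
    also have "\<dots> = K t + ennreal (15 * e)"
      using e_pos by (simp add: add.assoc ennreal_plus[symmetric] del: ennreal_plus)
    finally show ?thesis .
  qed
  then show ?thesis using r by blast
qed

text \<open>One integer controls both the bits that a plan may use and the ball in which it works.
  The 24 is 9 for the plan plus 15 for replacing the cost at \<open>i\<close> by the cost at
  \<open>t\<close>.\<close>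

definition good :: "'t \<Rightarrow> nat \<Rightarrow> bool" where
  "good i m \<longleftrightarrow> (\<exists>u. uniform_rv u \<and> u \<in> borel_measurable (\<F> (- tail m)) \<and>
     (\<forall>t. dist t i < 1 / Suc m \<longrightarrow> dominated m u t (K t + ennreal (24 * e))))"

lemma dominated_mono: "dominated m u t C \<Longrightarrow> m \<le> m' \<Longrightarrow> C \<le> C' \<Longrightarrow> dominated m' u t C'"
  unfolding dominated_def
  by (elim bexE conjE, rule bexI[rotated], erule F_mono[rotated]) (auto simp: tail_def intro: order_trans)

lemma good_ex: "\<exists>m. good i m"
proof -
  obtain m u d where u: "0 < d" "uniform_rv u" "u \<in> borel_measurable (\<F> (- tail m))"
    "\<And>t. dist t i < d \<Longrightarrow> dominated m u t (K i + ennreal (9 * e))" using local_plan[of i] by auto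
  obtain r where r: "0 < r" "\<And>t. dist t i < r \<Longrightarrow> K i \<le> K t + ennreal (15 * e)"
    using K_lower_semicontinuous[of i] by auto
  obtain n where n: "1 / Suc n < min d r" using nat_approx_posE[of "min d r"] u r by auto
  define m' where "m' = max m n"
  have m': "m \<le> m'" "1 / Suc m' \<le> 1 / Suc n" by (auto simp: m'_def intro!: divide_left_mono)
  have "good i m'"
    unfolding good_def
  proof (intro exI[of _ u] conjI allI impI u(2))
    show "u \<in> borel_measurable (\<F> (- tail m'))" by (rule F_mono[OF _ u(3)]) (use m' in \<open>auto simp: tail_def\<close>)
    fix t assume t: "dist t i < 1 / Suc m'"
    have "K i + ennreal (9 * e) \<le> (K t + ennreal (15 * e)) + ennreal (9 * e)"
      by (intro add_right_mono r) (use t m' n in auto)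
    also have "\<dots> = K t + ennreal (24 * e)"
      using e_pos by (simp add: add.assoc ennreal_plus[symmetric] del: ennreal_plus)
    finally show "dominated m' u t (K t + ennreal (24 * e))"
      by (intro dominated_mono[OF u(4) m'(1)]) (use t m' n in auto)
  qed
  then show ?thesis ..
qed

end

section \<open>Gluing the local plans\<close>

context monge_problem
begin

section \<open>Depths of the parameters\<close>

definition depth :: "'t \<Rightarrow> nat" where "depth i = (LEAST m. good i m)"

lemma good_depth: "good i (depth i)"
  unfolding depth_def using good_ex by (metis LeastI_ex)

definition local_rv :: "'t \<Rightarrow> 'x \<Rightarrow> real" where
  "local_rv i = (SOME u. uniform_rv u \<and> u \<in> borel_measurable (\<F> (- tail (depth i))) \<and>
     (\<forall>t. dist t i < 1 / Suc (depth i) \<longrightarrow> dominated (depth i) u t (K t + ennreal (24 * e))))"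

lemma local_rv: "uniform_rv (local_rv i)" "local_rv i \<in> borel_measurable (\<F> (- tail (depth i)))"
  "dist t i < 1 / Suc (depth i) \<Longrightarrow> dominated (depth i) (local_rv i) t (K t + ennreal (24 * e))"
  using someI_ex[OF good_depth[of i, unfolded good_def]] unfolding local_rv_def[symmetric] by auto

text \<open>The ball of radius \<open>1 / Suc m'\<close> around \<open>i'\<close> fits into the ball
  of radius \<open>1 / Suc m\<close> around \<open>i\<close>, so the same \<open>u\<close> serves; a
  larger depth only permits more bits.\<close>

lemma good_near:
  assumes "good i m" "m \<le> m'" "dist i' i \<le> 1 / Suc m - 1 / Suc m'"
  shows "good i' m'"
proof -
  obtain u where u: "uniform_rv u" "u \<in> borel_measurable (\<F> (- tail m))"
    "\<And>t. dist t i < 1 / Suc m \<Longrightarrow> dominated m u t (K t + ennreal (24 * e))"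
    using assms(1) by (auto simp: good_def)
  show ?thesis
    unfolding good_def
  proof (intro exI[of _ u] conjI allI impI u(1))
    show "u \<in> borel_measurable (\<F> (- tail m'))" by (rule F_mono[OF _ u(2)]) (use assms in \<open>auto simp: tail_def\<close>)
    fix t assume "dist t i' < 1 / Suc m'"
    then have "dist t i < 1 / Suc m" using assms(3) dist_triangle[of t i i'] by linarith
    then show "dominated m' u t (K t + ennreal (24 * e))" by (intro dominated_mono[OF u(3) assms(2)]) auto
  qed
qed

text \<open>An index near \<open>t0\<close> inherits a plan of depth \<open>2 * m + 1\<close> from
  \<open>t0\<close>; an index far from \<open>t0\<close> reaches points near \<open>t0\<close> only
  if its ball is large, so its depth is small. Hence only finitely many depths compete near
  \<open>t0\<close>.\<close>

lemma depth_locally_bounded: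
  obtains M d where "0 < d" "\<And>t i. dist t t0 < d \<Longrightarrow> dist t i < 1 / Suc (depth i) \<Longrightarrow> depth i \<le> M"
proof -
  define m where "m = depth t0"
  \<comment> \<open>Half of \<open>1 / Suc m\<close>, which is the margin
    \<open>1 / Suc m - 1 / Suc (2 * m + 1)\<close> demanded by \<open>good_near\<close>.\<close>
  define r where "r = 1 / (2 * (real m + 1))"
  have r: "0 < r" by (simp add: r_def)
  have rr: "1 / real (Suc m) - 1 / real (Suc (2 * m + 1)) = r" by (simp add: r_def field_simps)
  show thesis
  proof (rule that[of "r / 2" "4 * m + 4"])
    show "0 < r / 2" using r by simp
    fix t i assume t: "dist t t0 < r / 2" "dist t i < 1 / Suc (depth i)"
    show "depth i \<le> 4 * m + 4"
    proof (cases "dist i t0 \<le> r")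
      case True
      have "good i (2 * m + 1)" by (rule good_near[OF good_depth[of t0]]) (use True rr in \<open>auto simp: m_def\<close>)
      then have "depth i \<le> 2 * m + 1" unfolding depth_def by (rule Least_le)
      then show ?thesis by simp
    next
      case False
      then have "r / 2 < dist t i" using t(1) dist_triangle3[of i t0 t] by (simp add: field_simps)
      then have "r / 2 < 1 / Suc (depth i)" using t(2) by simp
      moreover have "r / 2 = 1 / (4 * (real m + 1))" by (simp add: r_def)
      ultimately have "real (Suc (depth i)) < 4 * (real m + 1)" by (simp add: field_simps)
      then have "real (Suc (depth i)) < real (4 * (m + 1))" by simp
      then have "Suc (depth i) < 4 * (m + 1)" by (simp only: of_nat_less_iff)
      then show ?thesis by simp
    qed
  qed
qed

text \<open>Uniform between half of \<open>1 / Suc m\<close> and \<open>1 / Suc m\<close>: never 0,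
  so every parameter is its own candidate; never beyond the ball where the plan works; and with a
  law that misses countable sets. The positions \<open>2 * (m + n)\<close> all lie in
  \<open>tail m\<close>. Radii of different depths share bits, and their mutual independence is
  never invoked.\<close>

definition radius :: "nat \<Rightarrow> 'x \<Rightarrow> real" where
  "radius m x = (1 / 2 + 1 / 2 * bin (\<lambda>n. B x (2 * (m + n)))) / Suc m"

lemma bin_bounds: "0 \<le> bin w" "bin w \<le> 1"
proof -
  have "(\<Sum>k. of_bool (w k) / 2 ^ Suc k) \<le> (\<Sum>k. (1 / 2 :: real) ^ Suc k)"
    by (rule suminf_le[OF _ summable_bin sums_summable[OF power_half_series]]) (simp add: power_one_over)
  then show "bin w \<le> 1" unfolding bin_def sums_unique[OF power_half_series, symmetric] .
  show "0 \<le> bin w" unfolding bin_def by (rule suminf_nonneg[OF summable_bin]) simp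
qed

lemma radius_bounds: "0 < radius m x" "radius m x \<le> 1 / Suc m"
  using bin_bounds[of "\<lambda>n. B x (2 * (m + n))"] unfolding radius_def
  by (auto intro!: divide_right_mono divide_pos_pos)

lemma measurable_radius: "radius m \<in> borel_measurable (\<F> (tail m))"
proof -
  have "(\<lambda>x. bin (\<lambda>n. B x (2 * (m + n)))) \<in> borel_measurable (\<F> (tail m))"
    by (rule measurable_bits_bin) (auto simp: tail_def)
  then show ?thesis unfolding radius_def[abs_def] by measurable
qed

lemma AE_radius_notin:
  assumes "countable Z" shows "AE x in \<mu>. radius m x \<notin> Z"
proof -
  define f where "f v = (1 / 2 + 1 / 2 * v) / Suc m" for v :: real
  have "inj f" by (auto simp: f_def inj_on_def)
  moreover have "countable (f ` (f -` Z))" by (rule countable_subset[OF _ assms]) auto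
  ultimately have c: "countable (f -` Z)"
    by (metis countable_image_inj_on inj_on_subset subset_UNIV)
  have i: "inj (\<lambda>n. 2 * (m + n))" by (auto simp: inj_on_def)
  have "(\<lambda>x. bin (\<lambda>n. B x (2 * (m + n)))) \<in> borel_measurable (\<F> (tail m))"
    by (rule measurable_bits_bin) (auto simp: tail_def)
  from F_borel[OF this] have m: "(\<lambda>x. bin (\<lambda>n. B x (2 * (m + n)))) \<in> borel_measurable \<mu>" by simp
  have "AE v in distr \<mu> borel (\<lambda>x. bin (\<lambda>n. B x (2 * (m + n)))). v \<notin> f -` Z"
    unfolding distr_bits_bin[OF i] by (rule AE_unif_countable[OF c])
  then have "AE x in \<mu>. bin (\<lambda>n. B x (2 * (m + n))) \<notin> f -` Z"
    by (rule AE_distrD[OF m])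
  then show ?thesis by eventually_elim (simp add: f_def radius_def)
qed

section \<open>The selected index and the glued variable\<close>

definition candidate :: "'t \<Rightarrow> 'x \<Rightarrow> nat \<Rightarrow> 't \<Rightarrow> bool" where
  "candidate t x m i \<longleftrightarrow> depth i = m \<and> dist t i < radius m x"

definition max_depth :: "'t \<Rightarrow> 'x \<Rightarrow> nat" where
  "max_depth t x = Max {m. \<exists>i. candidate t x m i}"

definition selected :: "'t \<Rightarrow> 'x \<Rightarrow> 't" where
  "selected t x = wleast (candidate t x (max_depth t x))"

lemma finite_candidate: "finite {m. \<exists>i. candidate t x m i}"
proof -
  obtain M d where "0 < d" "\<And>s i. dist s t < d \<Longrightarrow> dist s i < 1 / Suc (depth i) \<Longrightarrow> depth i \<le> M"
    by (rule depth_locally_bounded[of t]) metis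
  note M = this
  have "{m. \<exists>i. candidate t x m i} \<subseteq> {..M}"
  proof safe
    fix m i assume "candidate t x m i"
    then have "dist t i < 1 / Suc (depth i)" "depth i = m"
      using radius_bounds(2)[of m x] by (auto simp: candidate_def)
    then show "m \<le> M" using M(2)[of t i] M(1) by simp
  qed
  then show ?thesis by (rule finite_subset) simp
qed

lemma candidate_self: "candidate t x (depth t) t"
  using radius_bounds by (simp add: candidate_def)

lemma max_depth: "\<exists>i. candidate t x (max_depth t x) i" "candidate t x m i \<Longrightarrow> m \<le> max_depth t x"
proof -
  have "max_depth t x \<in> {m. \<exists>i. candidate t x m i}"
    unfolding max_depth_def by (rule Max_in[OF finite_candidate]) (use candidate_self in blast)
  then show "\<exists>i. candidate t x (max_depth t x) i" by simp
  show "candidate t x m i \<Longrightarrow> m \<le> max_depth t x"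
    unfolding max_depth_def by (rule Max_ge[OF finite_candidate]) auto
qed

lemma candidate_selected: "candidate t x (max_depth t x) (selected t x)"
proof -
  obtain i where "candidate t x (max_depth t x) i" using max_depth(1) by blast
  then show ?thesis unfolding selected_def by (rule wleastI)
qed

lemma depth_selected: "depth (selected t x) = max_depth t x" and dist_selected: "dist t (selected t x) < radius (max_depth t x) x"
  using candidate_selected[of t x] by (auto simp: candidate_def)

lemma dist_sel': "dist t (selected t x) < 1 / Suc (depth (selected t x))"
  using dist_selected[of t x] radius_bounds(2)[of "max_depth t x" x] by (simp add: depth_selected)

text \<open>Translates the maximum and the well-order into inequalities for radii of depth at least
  \<open>depth i\<close>; candidates of smaller depth never compete with \<open>i\<close>.\<close>

lemma selected_eq_iff:
  "selected t x = i \<longleftrightarrow> dist t i < radius (depth i) x \<and> (\<forall>j. depth i < depth j \<longrightarrow> radius (depth j) x \<le> dist t j) \<and>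
     (\<forall>j. before j i \<and> depth j = depth i \<longrightarrow> radius (depth i) x \<le> dist t j)" (is "_ \<longleftrightarrow> ?R")
proof
  assume i: "selected t x = i"
  have tp: "max_depth t x = depth i" using depth_selected[of t x] i by simp
  show ?R
  proof (intro conjI allI impI)
    show "dist t i < radius (depth i) x" using dist_selected[of t x] i tp by simp
    show "radius (depth j) x \<le> dist t j" if "depth i < depth j" for j
      using max_depth(2)[of t x "depth j" j] that tp by (auto simp: candidate_def not_less[symmetric])
    show "radius (depth i) x \<le> dist t j" if "before j i \<and> depth j = depth i" for j
    proof -
      have "before j (wleast (candidate t x (max_depth t x)))" using that i by (simp add: selected_def)
      from not_before_wleast[OF this] show ?thesis using that tp by (auto simp: candidate_def)
    qed
  qed
next
  assume R: ?R
  have c: "candidate t x (depth i) i" using R by (simp add: candidate_def)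
  have "max_depth t x \<le> depth i"
  proof (rule ccontr)
    assume "\<not> max_depth t x \<le> depth i"
    moreover obtain j where "candidate t x (max_depth t x) j" using max_depth(1) by blast
    ultimately have "depth i < depth j" "dist t j < radius (depth j) x" by (auto simp: candidate_def)
    then show False using R by (meson not_le)
  qed
  then have tp: "max_depth t x = depth i" using max_depth(2)[OF c] by simp
  show "selected t x = i"
    unfolding selected_def tp by (rule wleast_eqI[where P = "candidate t x (depth i)", OF c]) (use R in \<open>auto simp: candidate_def not_less\<close>)
qed

text \<open>Selecting the largest admissible depth first makes this event depend on the bits in
  \<^term>\<open>tail (depth i)\<close> only.\<close>

lemma selected_event: "{x. selected t x = i} \<in> sets (\<F> (tail (depth i)))"
proof -
  have tm: "radius m \<in> borel_measurable (\<F> (tail (depth i)))" if "depth i \<le> m" for m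
    by (rule F_mono[OF _ measurable_radius]) (use that in \<open>auto simp: tail_def\<close>)
  \<comment> \<open>At one depth, possibly uncountably many conditions amount to the radius lying in
    a closed set of reals; only the depths need a countable intersection.\<close>
  have cl: "{x. \<forall>j\<in>A. radius m x \<le> dist t j} \<in> sets (\<F> (tail (depth i)))" if "depth i \<le> m" for m A
  proof -
    have "closed (\<Inter>j\<in>A. {..dist t j})" by (intro closed_INT) auto
    then have "radius m -` (\<Inter>j\<in>A. {..dist t j}) \<inter> space (\<F> (tail (depth i))) \<in> sets (\<F> (tail (depth i)))"
      by (intro measurable_sets[OF tm[OF that]]) auto
    moreover have "radius m -` (\<Inter>j\<in>A. {..dist t j}) = {x. \<forall>j\<in>A. radius m x \<le> dist t j}" by auto
    ultimately show ?thesis by simp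
  qed
  have "radius (depth i) -` {dist t i<..} \<inter> space (\<F> (tail (depth i))) \<in> sets (\<F> (tail (depth i)))"
    by (rule measurable_sets[OF tm]) auto
  then have 1: "{x. dist t i < radius (depth i) x} \<in> sets (\<F> (tail (depth i)))" by (simp add: vimage_def)
  have 2: "(\<Inter>m\<in>{depth i<..}. {x. \<forall>j\<in>{j. depth j = m}. radius m x \<le> dist t j}) \<in> sets (\<F> (tail (depth i)))"
    by (intro sets.countable_INT'' cl sets.top[of "\<F> (tail (depth i))", simplified] countableI_type) auto
  have eq: "{x. selected t x = i} = {x. dist t i < radius (depth i) x} \<inter>
    (\<Inter>m\<in>{depth i<..}. {x. \<forall>j\<in>{j. depth j = m}. radius m x \<le> dist t j}) \<inter>
    {x. \<forall>j\<in>{j. before j i \<and> depth j = depth i}. radius (depth i) x \<le> dist t j}"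
    unfolding selected_eq_iff by auto
  show ?thesis unfolding eq by (intro sets.Int 1 2 cl order_refl)
qed

text \<open>A rational between \<open>dist t i\<close> and the radius lies below the distances to
  all earlier indices of the same depth, so depth and rational together determine the selected
  index.\<close>

lemma countable_selected: "countable (range (selected t))"
proof -
  define P where "P i q \<longleftrightarrow> q \<in> \<rat> \<and> dist t i < q \<and> (\<forall>j. before j i \<and> depth j = depth i \<longrightarrow> q < dist t j)" for i q
  have "\<exists>q. P i q" if i: "i \<in> range (selected t)" for i
  proof -
    obtain x where "selected t x = i" using i by auto
    then have x: "dist t i < radius (depth i) x" "\<And>j. before j i \<Longrightarrow> depth j = depth i \<Longrightarrow> radius (depth i) x \<le> dist t j"
      using selected_eq_iff[of t x i] by auto
    obtain q where "q \<in> \<rat>" "dist t i < q" "q < radius (depth i) x" using Rats_dense_in_real[OF x(1)] by auto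
    then show ?thesis using x(2) by (intro exI[of _ q]) (auto simp: P_def intro: less_le_trans)
  qed
  then obtain q where q: "\<And>i. i \<in> range (selected t) \<Longrightarrow> P i (q i)" by metis
  have "inj_on (\<lambda>i. (depth i, q i)) (range (selected t))"
  proof (rule inj_onI)
    fix i j assume ij: "i \<in> range (selected t)" "j \<in> range (selected t)" "(depth i, q i) = (depth j, q j)"
    show "i = j"
    proof (rule ccontr)
      assume "i \<noteq> j"
      then consider "before i j" | "before j i" using before_total by metis
      then show False
      proof cases
        case 1 then show False using q[OF ij(1)] q[OF ij(2)] ij(3) unfolding P_def
          by (metis less_asym prod.inject)
      next
        case 2 then show False using q[OF ij(1)] q[OF ij(2)] ij(3) unfolding P_def
          by (metis less_asym prod.inject)
      qed
    qed
  qed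
  moreover have "countable ((\<lambda>i. (depth i, q i)) ` range (selected t))"
  proof (rule countable_subset)
    show "(\<lambda>i. (depth i, q i)) ` range (selected t) \<subseteq> UNIV \<times> \<rat>" using q by (auto simp: P_def)
    show "countable ((UNIV :: nat set) \<times> (\<rat> :: real set))" by (intro countable_SIGMA countable_rat) auto
  qed
  ultimately show ?thesis by (rule countable_image_inj_on[rotated])
qed

lemma measurable_selected: "selected t \<in> borel \<rightarrow>\<^sub>M count_space (range (selected t))"
proof (subst measurable_count_space_eq_countable[OF countable_selected], intro conjI ballI)
  fix i
  have "selected t -` {i} = {x. selected t x = i}" by auto
  then show "selected t -` {i} \<inter> space borel \<in> sets borel" using F_sets_borel[OF selected_event[of t i]] by simp
qed auto

text \<open>Being selected is an event of \<open>tail (depth i)\<close> while \<open>f i\<close>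
  uses the complementary bits, so the integral over each piece factorises; countably many pieces
  allow the exchange of integrals.\<close>

lemma nn_integral_selected:
  assumes f: "\<And>i. i \<in> range (selected t) \<Longrightarrow> f i \<in> borel_measurable (\<F> (- tail (depth i)))"
  shows "(\<integral>\<^sup>+x. f (selected t x) x \<partial>\<mu>) =
    (\<integral>\<^sup>+i. emeasure \<mu> {x. selected t x = i} * (\<integral>\<^sup>+x. f i x \<partial>\<mu>) \<partial>count_space (range (selected t)))"
proof -
  have "(\<integral>\<^sup>+x. f (selected t x) x \<partial>\<mu>) = (\<integral>\<^sup>+x. \<integral>\<^sup>+i. indicator {x. selected t x = i} x * f i x \<partial>count_space (range (selected t)) \<partial>\<mu>)"
  proof (rule nn_integral_cong)
    fix x
    have "(\<integral>\<^sup>+i. indicator {x. selected t x = i} x * f i x \<partial>count_space (range (selected t))) =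
        (\<Sum>i\<in>{selected t x}. indicator {x. selected t x = i} x * f i x)"
      by (rule nn_integral_count_space') (auto simp: indicator_def)
    then show "f (selected t x) x = (\<integral>\<^sup>+i. indicator {x. selected t x = i} x * f i x \<partial>count_space (range (selected t)))" by simp
  qed
  also have "\<dots> = (\<integral>\<^sup>+i. \<integral>\<^sup>+x. indicator {x. selected t x = i} x * f i x \<partial>\<mu> \<partial>count_space (range (selected t)))"
  proof (rule nn_integral_count_space_nn_integral[OF countable_selected])
    fix i assume "i \<in> range (selected t)"
    then show "(\<lambda>x. indicator {x. selected t x = i} x * f i x) \<in> borel_measurable \<mu>"
      using F_borel[OF f] F_sets_borel[OF selected_event[of t i]] by measurable
  qed
  also have "\<dots> = (\<integral>\<^sup>+i. emeasure \<mu> {x. selected t x = i} * (\<integral>\<^sup>+x. f i x \<partial>\<mu>) \<partial>count_space (range (selected t)))"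
    by (rule nn_integral_cong) (use f in \<open>auto intro!: indep_F_nn_integral[OF selected_event]\<close>)
  finally show ?thesis .
qed

lemma nn_integral_selected_const:
  "(\<integral>\<^sup>+i. emeasure \<mu> {x. selected t x = i} * c \<partial>count_space (range (selected t))) = c"
  using nn_integral_selected[of t "\<lambda>_ _. c"] emeasure_space_1 by simp

definition glued_rv :: "'t \<Rightarrow> 'x \<Rightarrow> real" where
  "glued_rv t x = local_rv (selected t x) x"

text \<open>Given that \<open>i\<close> is selected, \<open>local_rv i\<close> keeps its uniform
  law, and a mixture of uniform laws is uniform.\<close>

lemma uniform_rv_glued_rv: "uniform_rv (glued_rv t)"
proof (rule mpI)
  show "glued_rv t \<in> borel \<rightarrow>\<^sub>M borel"
    unfolding glued_rv_def
    by (rule measurable_compose_countable'[OF _ measurable_selected countable_selected]) (rule F_borel[OF local_rv(2)])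
  then have tm: "glued_rv t \<in> \<mu> \<rightarrow>\<^sub>M borel" by simp
  fix A :: "real set" assume A: "A \<in> sets borel"
  interpret U: prob_space unif by (rule prob_space_unif)
  have tA: "{x. glued_rv t x \<in> A} \<in> events" using measurable_sets[OF tm A] by (simp add: vimage_def)
  have "emeasure \<mu> {x. glued_rv t x \<in> A} = (\<integral>\<^sup>+x. indicator {x. glued_rv t x \<in> A} x \<partial>\<mu>)" using tA by simp
  also have "\<dots> = (\<integral>\<^sup>+x. indicator A (local_rv (selected t x) x) \<partial>\<mu>)"
    by (intro nn_integral_cong) (simp add: glued_rv_def indicator_def)
  also have "\<dots> = (\<integral>\<^sup>+i. emeasure \<mu> {x. selected t x = i} * (\<integral>\<^sup>+x. indicator A (local_rv i x) \<partial>\<mu>) \<partial>count_space (range (selected t)))"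
    by (rule nn_integral_selected[of t "\<lambda>i x. indicator A (local_rv i x)"])
       (rule measurable_compose[OF local_rv(2)], use A in simp)
  also have "\<dots> = (\<integral>\<^sup>+i. emeasure \<mu> {x. selected t x = i} * ennreal (measure unif A) \<partial>count_space (range (selected t)))"
  proof (rule nn_integral_cong)
    fix i
    have pm: "local_rv i \<in> \<mu> \<rightarrow>\<^sub>M borel" using F_borel[OF local_rv(2)[of i]] by simp
    have "{x. local_rv i x \<in> A} \<in> events" using measurable_sets[OF pm A] by (simp add: vimage_def)
    then have "(\<integral>\<^sup>+x. indicator {x. local_rv i x \<in> A} x \<partial>\<mu>) = emeasure \<mu> {x. local_rv i x \<in> A}" by simp
    also have "\<dots> = ennreal (measure unif A)" using uniform_rv_measure[OF local_rv(1) A] by (simp add: emeasure_eq_measure)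
    finally have "(\<integral>\<^sup>+x. indicator A (local_rv i x) \<partial>\<mu>) = ennreal (measure unif A)" by (simp add: indicator_def)
    then show "emeasure \<mu> {x. selected t x = i} * (\<integral>\<^sup>+x. indicator A (local_rv i x) \<partial>\<mu>) =
        emeasure \<mu> {x. selected t x = i} * ennreal (measure unif A)" by simp
  qed
  also have "\<dots> = ennreal (measure unif A)" by (rule nn_integral_selected_const)
  finally show "measure \<mu> {x. glued_rv t x \<in> A} = measure unif A" by (simp add: emeasure_eq_measure)
qed

text \<open>The majorants of the local plans average to within \<open>24 * e\<close>;
  \<open>Bad\<close> and the truncation add one \<open>e\<close> each.\<close>

lemma cost_glued_rv:
  "(\<integral>\<^sup>+x. ennreal (h x (sk t (glued_rv t x)) t) \<partial>\<mu>) \<le> K t + ennreal (26 * e)"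
proof -
  have "\<exists>\<Gamma>. i \<in> range (selected t) \<longrightarrow> \<Gamma> \<in> borel_measurable (\<F> (- tail (depth i))) \<and> (\<integral>\<^sup>+x. \<Gamma> x \<partial>\<mu>) \<le> K t + ennreal (24 * e) \<and>
     (\<forall>x. x \<notin> Bad \<longrightarrow> ennreal (H x (sk t (local_rv i x)) t) \<le> \<Gamma> x)" for i
  proof (cases "i \<in> range (selected t)")
    case True
    then obtain x where "i = selected t x" by auto
    then have "dist t i < 1 / Suc (depth i)" using dist_sel'[of t x] by simp
    from local_rv(3)[OF this] show ?thesis by (auto simp: dominated_def)
  qed auto
  then obtain \<Gamma> where \<Gamma>: "\<And>i. i \<in> range (selected t) \<Longrightarrow> \<Gamma> i \<in> borel_measurable (\<F> (- tail (depth i)))"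
    "\<And>i. i \<in> range (selected t) \<Longrightarrow> (\<integral>\<^sup>+x. \<Gamma> i x \<partial>\<mu>) \<le> K t + ennreal (24 * e)"
    "\<And>i x. i \<in> range (selected t) \<Longrightarrow> x \<notin> Bad \<Longrightarrow> ennreal (H x (sk t (local_rv i x)) t) \<le> \<Gamma> i x" by metis
  have \<Gamma>m: "(\<lambda>x. \<Gamma> (selected t x) x) \<in> borel_measurable borel"
    by (rule measurable_compose_countable'[OF _ measurable_selected countable_selected]) (rule F_borel[OF \<Gamma>(1)])
  have "(\<integral>\<^sup>+x. ennreal (h x (sk t (glued_rv t x)) t) \<partial>\<mu>) \<le> tcost t (glued_rv t) + ennreal e"
    unfolding H_def by (rule tails[OF smeas_sk_uniform_rv distr_sk_uniform_rv]) (rule uniform_rv_glued_rv)+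
  also have "tcost t (glued_rv t) \<le> (\<integral>\<^sup>+x. \<Gamma> (selected t x) x + ennreal N * indicator Bad x \<partial>\<mu>)"
  proof (rule nn_integral_mono)
    fix x show "ennreal (H x (sk t (glued_rv t x)) t) \<le> \<Gamma> (selected t x) x + ennreal N * indicator Bad x"
      using \<Gamma>(3)[of "selected t x" x] H_bounds(2)[of x "sk t (glued_rv t x)" t]
      by (cases "x \<in> Bad") (auto simp: glued_rv_def intro: add_increasing ennreal_leI)
  qed
  also have "\<dots> = (\<integral>\<^sup>+x. \<Gamma> (selected t x) x \<partial>\<mu>) + ennreal N * emeasure \<mu> Bad"
    using \<Gamma>m Bad by (simp add: nn_integral_add nn_integral_cmult_indicator sets_mu)
  also have "(\<integral>\<^sup>+x. \<Gamma> (selected t x) x \<partial>\<mu>) =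
      (\<integral>\<^sup>+i. emeasure \<mu> {x. selected t x = i} * (\<integral>\<^sup>+x. \<Gamma> i x \<partial>\<mu>) \<partial>count_space (range (selected t)))"
    by (rule nn_integral_selected[OF \<Gamma>(1)])
  also have "\<dots> \<le> (\<integral>\<^sup>+i. emeasure \<mu> {x. selected t x = i} * (K t + ennreal (24 * e)) \<partial>count_space (range (selected t)))"
    by (intro nn_integral_mono mult_left_mono \<Gamma>(2)) auto
  also have "\<dots> = K t + ennreal (24 * e)" by (rule nn_integral_selected_const)
  finally have "(\<integral>\<^sup>+x. ennreal (h x (sk t (glued_rv t x)) t) \<partial>\<mu>) \<le> (K t + ennreal (24 * e)) + ennreal N * emeasure \<mu> Bad + ennreal e"
    by (simp add: add_right_mono)
  also have "\<dots> \<le> (K t + ennreal (24 * e)) + ennreal e + ennreal e"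
    by (intro add_mono order_refl ennreal_N_Bad)
  also have "\<dots> = K t + ennreal (26 * e)"
    using e_pos by (simp add: add.assoc ennreal_plus[symmetric] del: ennreal_plus)
  finally show ?thesis .
qed

text \<open>Infinitely many inequalities persist together if \<open>r\<close> is strictly below
  their infimum, since \<open>infdist\<close> is continuous. Only the one value
  \<open>infdist t A\<close> of \<open>r\<close> is excluded.\<close>

lemma infdist_eventually:
  assumes u: "u \<longlonglongrightarrow> t" and r: "\<And>j. j \<in> A \<Longrightarrow> r \<le> dist t j" "r \<noteq> infdist t A"
  shows "\<forall>\<^sub>F n in sequentially. \<forall>j\<in>A. r \<le> dist (u n) j"
proof (cases "A = {}")
  case False
  have "r \<le> infdist t A" using False r(1) by (auto simp: infdist_notempty intro: cINF_greatest)
  then have "r < infdist t A" using r(2) by simp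
  moreover have "(\<lambda>n. infdist (u n) A) \<longlonglongrightarrow> infdist t A" by (intro tendsto_intros u)
  ultimately have "\<forall>\<^sub>F n in sequentially. r < infdist (u n) A" by (auto dest: order_tendstoD)
  then show ?thesis
    by eventually_elim (auto intro: order_trans[OF less_imp_le infdist_le])
qed simp

text \<open>For fixed \<open>t\<close> almost every choice of radii avoids countably many critical
  distances. Then the conditions of \<open>selected_eq_iff\<close> hold with a margin, and only
  finitely many depths matter near \<open>t\<close>.\<close>

lemma selected_eventually_const:
  assumes u: "u \<longlonglongrightarrow> t"
  shows "AE x in \<mu>. \<forall>\<^sub>F n in sequentially. selected (u n) x = selected t x"
proof -
  \<comment> \<open>Critical values: the distance from \<open>t\<close> to the set of indices of
    depth \<open>m\<close>, and, for each of the countably many selectable \<open>i\<close>, to the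
    earlier indices of the same depth.\<close>
  define Z where "Z m = insert (infdist t {j. depth j = m}) ((\<lambda>i. infdist t {j. before j i \<and> depth j = depth i}) ` range (selected t))" for m
  have "countable (Z m)" for m unfolding Z_def by (intro countable_insert countable_image countable_selected)
  then have "AE x in \<mu>. \<forall>m. radius m x \<notin> Z m" by (subst AE_all_countable) (intro allI AE_radius_notin)
  then show ?thesis
  proof eventually_elim
    case (elim x)
    define i where "i = selected t x"
    have i: "dist t i < radius (depth i) x" "\<And>j. depth i < depth j \<Longrightarrow> radius (depth j) x \<le> dist t j"
      "\<And>j. before j i \<Longrightarrow> depth j = depth i \<Longrightarrow> radius (depth i) x \<le> dist t j"
      using selected_eq_iff[of t x i] by (auto simp: i_def)
    obtain M d where M: "0 < d" "\<And>s j. dist s t < d \<Longrightarrow> dist s j < 1 / Suc (depth j) \<Longrightarrow> depth j \<le> M"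
      by (rule depth_locally_bounded[of t]) metis
    have e1: "\<forall>\<^sub>F n in sequentially. dist (u n) t < d" using u M(1) by (rule tendstoD)
    have "(\<lambda>n. dist (u n) i) \<longlonglongrightarrow> dist t i" by (intro tendsto_intros u)
    then have e2: "\<forall>\<^sub>F n in sequentially. dist (u n) i < radius (depth i) x" using i(1) by (auto dest: order_tendstoD)
    have e3: "\<forall>\<^sub>F n in sequentially. \<forall>m\<in>{depth i<..M}. \<forall>j\<in>{j. depth j = m}. radius m x \<le> dist (u n) j"
    proof (rule eventually_ball_finite)
      show "\<forall>m\<in>{depth i<..M}. \<forall>\<^sub>F n in sequentially. \<forall>j\<in>{j. depth j = m}. radius m x \<le> dist (u n) j"
        by (intro ballI infdist_eventually[OF u]) (use i(2) elim in \<open>auto simp: Z_def\<close>)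
    qed simp
    have e4: "\<forall>\<^sub>F n in sequentially. \<forall>j\<in>{j. before j i \<and> depth j = depth i}. radius (depth i) x \<le> dist (u n) j"
    proof (rule infdist_eventually[OF u])
      have "infdist t {j. before j i \<and> depth j = depth i} \<in> Z (depth i)" by (auto simp: Z_def i_def)
      then show "radius (depth i) x \<noteq> infdist t {j. before j i \<and> depth j = depth i}" using elim by metis
    qed (use i(3) in auto)
    show ?case
      using e1 e2 e3 e4
    proof eventually_elim
      case (elim n)
      have "radius (depth j) x \<le> dist (u n) j" if j: "depth i < depth j" for j
      proof (cases "depth j \<le> M")
        case True then show ?thesis using elim j by auto
      next
        case False
        then have "\<not> dist (u n) j < 1 / Suc (depth j)" using M(2) elim by blast
        then show ?thesis using radius_bounds(2)[of "depth j" x] by simp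
      qed
      then show "selected (u n) x = selected t x"
        unfolding i_def[symmetric] selected_eq_iff using elim by auto
    qed
  qed
qed

text \<open>For almost every \<open>x\<close> the glued variable is eventually constant along the
  sequence, so only the measures move and Skorohod convergence at a fixed parameter applies. Its
  uniform law keeps that parameter out of the countable exceptional set.\<close>

lemma sk_glued_rv_converges:
  assumes u: "u \<longlonglongrightarrow> t"
  shows "AE x in \<mu>. (\<lambda>n. sk (u n) (glued_rv (u n) x)) \<longlonglongrightarrow> sk t (glued_rv t x)"
proof -
  have w: "weakconv (\<lambda>n. \<nu> (u n)) (\<nu> t)" by (rule weak_topology_seq[OF nu_cont u nu])
  obtain Z where Z: "countable Z" "\<And>Ns v. (\<And>n. Ns n \<in> radon_probs) \<Longrightarrow> weakconv Ns (\<nu> t) \<Longrightarrow> 0 \<le> v \<Longrightarrow> v < 1 \<Longrightarrow> v \<notin> Z \<Longrightarrow>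
      (\<lambda>n. skor (Ns n) v) \<longlonglongrightarrow> sk t v"
    by (rule skor_converges[OF nu[of t]]) metis
  have tm: "glued_rv t \<in> \<mu> \<rightarrow>\<^sub>M borel" and td: "distr \<mu> borel (glued_rv t) = unif" using uniform_rv_glued_rv[of t] by (auto simp: uniform_rv_def)
  have "AE v in distr \<mu> borel (glued_rv t). (0 \<le> v \<and> v < 1) \<and> v \<notin> Z"
    unfolding td using AE_unif_01 AE_unif_countable[OF Z(1)] by eventually_elim simp
  then have "AE x in \<mu>. (0 \<le> glued_rv t x \<and> glued_rv t x < 1) \<and> glued_rv t x \<notin> Z" by (rule AE_distrD[OF tm])
  then show ?thesis using selected_eventually_const[OF u]
  proof eventually_elim
    case (elim x)
    have "(\<lambda>n. sk (u n) (glued_rv t x)) \<longlonglongrightarrow> sk t (glued_rv t x)" using Z(2)[OF nu w] elim by auto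
    moreover have "\<forall>\<^sub>F n in sequentially. sk (u n) (glued_rv t x) = sk (u n) (glued_rv (u n) x)"
      using elim(2) by eventually_elim (simp add: glued_rv_def)
    ultimately show ?case by (rule Lim_transform_eventually)
  qed
qed

end

text \<open>Let \<open>f\<close> and \<open>g\<close> be the parts of \<open>a\<close> and
  \<open>b\<close> above \<open>R\<close>. If both vanish, \<open>h\<close> is below
  \<open>2 * R\<close>; otherwise the summand not covered by them is below \<open>R\<close>. Hence
  truncation at \<open>2 * R\<close> loses at most \<open>f x + g (S x)\<close>, and since
  \<open>S\<close> has law \<open>\<nu> t\<close> the integral of this loss is the tail term, small
  uniformly in \<open>t\<close>.\<close>

lemma truncation_uniform:
  fixes \<mu> :: "'x::metric_space measure" and \<nu> :: "'t \<Rightarrow> 'y::metric_space measure"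
  assumes mu: "sets \<mu> = sets borel" and nu: "\<And>t. sets (\<nu> t) = sets borel"
    and a: "\<And>t. integrable \<mu> (a t)" and b: "\<And>t. integrable (\<nu> t) (b t)"
    and hab: "\<And>x y t. h x y t \<le> a t x + b t y"
    and lim: "((\<lambda>R::real. SUP t. ereal ((LINT x:{x. a t x \<ge> R}|\<mu>. a t x) +
                                    (LINT y:{y. b t y \<ge> R}|\<nu> t. b t y))) \<longlongrightarrow> 0) at_top"
    and e: "0 < e"
  obtains N where "0 < N" "\<And>t S. S \<in> borel \<rightarrow>\<^sub>M borel \<Longrightarrow> (\<lambda>x. h x (S x) t) \<in> borel_measurable borel \<Longrightarrow> distr \<mu> borel S = \<nu> t \<Longrightarrow>
      (\<integral>\<^sup>+x. ennreal (h x (S x) t) \<partial>\<mu>) \<le> (\<integral>\<^sup>+x. ennreal (min (h x (S x) t) N) \<partial>\<mu>) + ennreal e"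
proof -
  have [measurable_cong]: "sets \<mu> = sets borel" by fact
  have "\<forall>\<^sub>F R in at_top. (SUP t. ereal ((LINT x:{x. a t x \<ge> R}|\<mu>. a t x) + (LINT y:{y. b t y \<ge> R}|\<nu> t. b t y))) < ereal e"
    by (rule order_tendstoD(2)[OF lim]) (use e in simp)
  then obtain R0 where R0: "\<And>R. R0 \<le> R \<Longrightarrow> (SUP t. ereal ((LINT x:{x. a t x \<ge> R}|\<mu>. a t x) + (LINT y:{y. b t y \<ge> R}|\<nu> t. b t y))) < ereal e"
    by (auto simp: eventually_at_top_linorder)
  define R where "R = max R0 1"
  have R: "0 < R" by (simp add: R_def)
  have tail: "(LINT x:{x. a t x \<ge> R}|\<mu>. a t x) + (LINT y:{y. b t y \<ge> R}|\<nu> t. b t y) \<le> e" for t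
  proof -
    have "ereal ((LINT x:{x. a t x \<ge> R}|\<mu>. a t x) + (LINT y:{y. b t y \<ge> R}|\<nu> t. b t y)) \<le>
      (SUP t. ereal ((LINT x:{x. a t x \<ge> R}|\<mu>. a t x) + (LINT y:{y. b t y \<ge> R}|\<nu> t. b t y)))"
      by (rule SUP_upper) simp
    also have "\<dots> < ereal e" by (rule R0) (simp add: R_def)
    finally show ?thesis by simp
  qed
  show thesis
  proof (rule that[of "2 * R"])
    show "0 < 2 * R" using R by simp
    fix t and S :: "'x \<Rightarrow> 'y" assume S: "S \<in> borel \<rightarrow>\<^sub>M borel" and hm: "(\<lambda>x. h x (S x) t) \<in> borel_measurable borel"
      and d: "distr \<mu> borel S = \<nu> t"
    have Sm: "S \<in> \<mu> \<rightarrow>\<^sub>M \<nu> t" using S nu[of t] mu by (simp cong: measurable_cong_sets)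
    define f where "f x = indicator {x. a t x \<ge> R} x * a t x" for x
    define g where "g y = indicator {y. b t y \<ge> R} y * b t y" for y
    have am: "a t \<in> borel_measurable \<mu>" and bm: "b t \<in> borel_measurable (\<nu> t)" using a b by auto
    have sp: "space \<mu> = UNIV" "space (\<nu> t) = UNIV" using sets_eq_imp_space_eq[OF mu] sets_eq_imp_space_eq[OF nu[of t]] by auto
    have A: "{x. a t x \<ge> R} \<in> sets \<mu>" using measurable_sets[OF am, of "{R..}"] sp by (simp add: vimage_def)
    have Bs: "{y. b t y \<ge> R} \<in> sets (\<nu> t)" using measurable_sets[OF bm, of "{R..}"] sp by (simp add: vimage_def)
    have fi: "integrable \<mu> f" unfolding f_def using integrable_mult_indicator[OF A a[of t]] by simp
    have gi: "integrable (\<nu> t) g" unfolding g_def using integrable_mult_indicator[OF Bs b[of t]] by simp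
    have f0: "0 \<le> f x" and g0: "0 \<le> g y" for x y using R by (auto simp: f_def g_def indicator_def)
    have gm: "g \<in> borel_measurable (\<nu> t)" using gi by simp
    have gSm: "(\<lambda>x. g (S x)) \<in> borel_measurable \<mu>" by (rule measurable_compose[OF Sm gm])
    have pt: "ennreal (h x (S x) t) \<le> ennreal (min (h x (S x) t) (2 * R)) + (ennreal (f x) + ennreal (g (S x)))" for x
    proof -
      have "h x (S x) t \<le> max 0 (min (h x (S x) t) (2 * R)) + (f x + g (S x))"
        using hab[of x "S x" t] R by (auto simp: f_def g_def indicator_def)
      then have "ennreal (h x (S x) t) \<le> ennreal (max 0 (min (h x (S x) t) (2 * R)) + (f x + g (S x)))" by (rule ennreal_leI)
      also have "\<dots> = ennreal (max 0 (min (h x (S x) t) (2 * R))) + (ennreal (f x) + ennreal (g (S x)))"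
        using f0 g0 by (simp add: ennreal_plus)
      also have "ennreal (max 0 (min (h x (S x) t) (2 * R))) = ennreal (min (h x (S x) t) (2 * R))"
        by (simp add: ennreal_max_0)
      finally show ?thesis .
    qed
    have "(\<integral>\<^sup>+x. ennreal (h x (S x) t) \<partial>\<mu>) \<le> (\<integral>\<^sup>+x. ennreal (min (h x (S x) t) (2 * R)) + (ennreal (f x) + ennreal (g (S x))) \<partial>\<mu>)"
      by (rule nn_integral_mono) (rule pt)
    also have "\<dots> = (\<integral>\<^sup>+x. ennreal (min (h x (S x) t) (2 * R)) \<partial>\<mu>) + ((\<integral>\<^sup>+x. ennreal (f x) \<partial>\<mu>) + (\<integral>\<^sup>+x. ennreal (g (S x)) \<partial>\<mu>))"
      using hm gSm fi by (simp add: nn_integral_add)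
    also have "(\<integral>\<^sup>+x. ennreal (g (S x)) \<partial>\<mu>) = (\<integral>\<^sup>+y. ennreal (g y) \<partial>distr \<mu> borel S)"
      using S gm nu[of t] mu by (subst nn_integral_distr) (auto cong: measurable_cong_sets)
    also have "\<dots> = ennreal (\<integral>y. g y \<partial>\<nu> t)" unfolding d by (rule nn_integral_eq_integral[OF gi]) (simp add: g0)
    also have "(\<integral>\<^sup>+x. ennreal (f x) \<partial>\<mu>) = ennreal (\<integral>x. f x \<partial>\<mu>)" by (rule nn_integral_eq_integral[OF fi]) (simp add: f0)
    also have "ennreal (\<integral>x. f x \<partial>\<mu>) + ennreal (\<integral>y. g y \<partial>\<nu> t) = ennreal ((\<integral>x. f x \<partial>\<mu>) + (\<integral>y. g y \<partial>\<nu> t))"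
      using f0 g0 by (intro ennreal_plus[symmetric] Bochner_Integration.integral_nonneg) auto
    also have "\<dots> \<le> ennreal e"
      using tail[of t] by (intro ennreal_leI) (simp add: f_def g_def set_lebesgue_integral_def)
    finally show "(\<integral>\<^sup>+x. ennreal (h x (S x) t) \<partial>\<mu>) \<le> (\<integral>\<^sup>+x. ennreal (min (h x (S x) t) (2 * R)) \<partial>\<mu>) + ennreal e"
      by (simp add: add_left_mono)
  qed
qed

theorem theorem3p1:
  fixes \<mu> :: "'x::complete_space measure"
    and \<nu> :: "'t::metric_space \<Rightarrow> 'y::complete_space measure"
    and h :: "'x \<Rightarrow> 'y \<Rightarrow> 't \<Rightarrow> real"
    and a :: "'t \<Rightarrow> 'x \<Rightarrow> real" and b :: "'t \<Rightarrow> 'y \<Rightarrow> real"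
    and \<epsilon> :: real
  assumes "\<mu> \<in> radon_probs" and "nonatomic \<mu>"
    and "\<And>t. \<nu> t \<in> radon_probs" and "continuous_map euclidean weak_topology \<nu>"
    and "continuous_on UNIV (\<lambda>(x, y, t). h x y t)" and "\<And>x y t. 0 \<le> h x y t"
    and "\<And>t. integrable \<mu> (a t)" and "\<And>t. integrable (\<nu> t) (b t)"
    and "\<And>x y t. h x y t \<le> a t x + b t y"
    and "((\<lambda>R::real. SUP t. ereal ((LINT x:{x. a t x \<ge> R}|\<mu>. a t x) +
                                    (LINT y:{y. b t y \<ge> R}|\<nu> t. b t y))) \<longlongrightarrow> 0) at_top"
    and "\<epsilon> > 0"
  shows "\<exists>S :: 't \<Rightarrow> 'x \<Rightarrow> 'y.
           (\<forall>t. optimal_monge_map \<epsilon> (\<lambda>x y. h x y t) \<mu> (\<nu> t) (S t)) \<and>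
           (\<forall>t u. u \<longlonglongrightarrow> t \<longrightarrow> (AE x in \<mu>. (\<lambda>n. S (u n) x) \<longlonglongrightarrow> S t x))"
proof -
  \<comment> \<open>Matches the total \<open>26 * e\<close> in \<open>cost_glued_rv\<close>.\<close>
  define e where "e = \<epsilon> / 26"
  have e: "0 < e" using assms(11) by (simp add: e_def)
  obtain B :: "'x \<Rightarrow> nat \<Rightarrow> bool" where B: "B \<in> borel \<rightarrow>\<^sub>M coins" "distr \<mu> coins B = coins"
    "\<And>A e. A \<in> sets borel \<Longrightarrow> 0 < e \<Longrightarrow>
      \<exists>m S. measure \<mu> ((A - {x. map (B x) [0..<m] \<in> S}) \<union> ({x. map (B x) [0..<m] \<in> S} - A)) < e"
    by (rule generating_bits[OF assms(1,2)]) (rule that, assumption+)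
  interpret bits \<mu> B by (rule bits.intro[OF assms(1) B])
  obtain N where N: "0 < N" "\<And>t S. S \<in> borel \<rightarrow>\<^sub>M borel \<Longrightarrow> (\<lambda>x. h x (S x) t) \<in> borel_measurable borel \<Longrightarrow> distr \<mu> borel S = \<nu> t \<Longrightarrow>
      (\<integral>\<^sup>+x. ennreal (h x (S x) t) \<partial>\<mu>) \<le> (\<integral>\<^sup>+x. ennreal (min (h x (S x) t) N) \<partial>\<mu>) + ennreal e"
    by (rule truncation_uniform[OF sets_mu radon_probsD(2)[OF assms(3)] assms(7,8,9,10) e]) (rule that, assumption+)
  \<comment> \<open>The order matters: \<open>N\<close> is already fixed, and \<open>Bad\<close> is
    then chosen small relative to it.\<close>
  have "0 < e / N" using e N by simp
  then obtain Bad where Bad: "Bad \<in> sets borel" "measure \<mu> Bad \<le> e / N"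
    "\<And>d. 0 < d \<Longrightarrow> \<exists>m c. \<forall>x. x \<notin> Bad \<longrightarrow> dist x (c (word m x)) < d"
    by (rule word_approximates) (rule that, assumption+)
  interpret monge_problem \<mu> B \<nu> h e N Bad
  proof
    fix t and S :: "'x \<Rightarrow> 'y" assume S: "smeas borel S" "distr \<mu> borel S = \<nu> t"
    have "continuous_on UNIV (\<lambda>z. (\<lambda>(x, y, t). h x y t) (fst z, snd z, t))"
      by (rule continuous_on_compose2[OF assms(5)]) (auto intro!: continuous_intros)
    then have "(\<lambda>z. h (fst z) (snd z) t) \<in> borel_measurable borel" by (intro borel_measurable_continuous_onI) simp
    from measurable_compose[OF smeas_pair[OF measurable_ident S(1)] this]
    have "(\<lambda>x. h x (S x) t) \<in> borel_measurable borel" by simp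
    from N(2)[OF smeas_measurable[OF S(1)] this S(2)]
    show "(\<integral>\<^sup>+x. ennreal (h x (S x) t) \<partial>\<mu>) \<le> (\<integral>\<^sup>+x. ennreal (min (h x (S x) t) N) \<partial>\<mu>) + ennreal e" .
  qed (use assms e N Bad in \<open>auto simp: field_simps\<close>)
  show ?thesis
  proof (intro exI[of _ "\<lambda>t x. sk t (glued_rv t x)"] conjI allI impI sk_glued_rv_converges)
    fix t
    show "optimal_monge_map \<epsilon> (\<lambda>x y. h x y t) \<mu> (\<nu> t) (\<lambda>x. sk t (glued_rv t x))"
      unfolding optimal_monge_map_def
      using smeas_measurable[OF smeas_sk_uniform_rv[OF uniform_rv_glued_rv]] distr_sk_uniform_rv[OF uniform_rv_glued_rv] cost_glued_rv[of t]
      by (simp add: e_def)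
  qed
qed

end
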